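(* Assume (A1), (A2), (A3) and (A3'). Let $u_0:\mathbb{R}^N\to\mathbb{R}$ be bounded and Lipschitz continuous. Let $u$ (resp. $v$) be a bounded subsolution (resp. bounded supersolution) of $$\partial_t u=\mu(\widehat{Du})\,\big[c_1(x)+\kappa[x,u]\big]\,|Du|\quad\text{in }(0,+\infty)\times\mathbb{R}^N .$$ If $u(0,x)\le u_0(x)\le v(0,x)$ for all $x\in\mathbb{R}^N$, then $u\le v$ on $(0,+\infty)\times\mathbb{R}^N$.
   Context: Notation: $\mathbb{S}^{N-1}$ is the unit sphere of $\mathbb{R}^N$; $B_\delta$ is the ball of radius $\delta$ centered at the origin and $B=B_1$; $\hat p=p/|p|$ for $p\ne0$; $D$ denotes the gradient in $x$. Assumptions. (A1) $\mu:\mathbb{S}^{N-1}\to(0,+\infty)$ is continuous. (A2) $c_1:\mathbb{R}^N\to\mathbb{R}$ is Lipschitz continuous. (A3) $\nu$ is a non-negative Radon measure on $\mathbb{R}^N\setminus\{0\}$ (regarded as a measure on $\mathbb{R}^N$ with $\nu(\{0\})=0$; it may have infinite mass near $0$) such that: for all $\delta>0$, $\nu(\mathbb{R}^N\setminus B_\delta)<+\infty$; for all $r>0$ and $e\in\mathbb{S}^{N-1}$, $\nu\{z\in B: r|z\cdot e|\le|z-(z\cdot e)e|^2\}<+\infty$; $\delta\,\nu(\mathbb{R}^N\setminus B_\delta)\to0$ as $\delta\to0$; and $r\,\nu\{z\in B: r|z\cdot e|\le|z-(z\cdot e)e|^2\}\to0$ as $r\to0$, uniformly with respect to $e\in\mathbb{S}^{N-1}$.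 (A3') $r\,\nu\{z\in B_\delta: r|z\cdot e|\le|z-(z\cdot e)e|^2\}\to0$ as $\delta\to0$, uniformly in $e\in\mathbb{S}^{N-1}$ and $r\in(0,1)$; and $\nu(dz)=J(z)\,dz$ with $J\in W^{1,1}(\mathbb{R}^N\setminus B_\delta)$ for all $\delta>0$. Fractional mean curvature. For $\phi:\mathbb{R}^N\to\mathbb{R}$ smooth with $D\phi(x)\neq0$, $$\kappa^*[x,\phi]=\nu\{z:\phi(x+z)\ge\phi(x),\ D\phi(x)\cdot z\le0\}-\nu\{z:\phi(x+z)<\phi(x),\ D\phi(x)\cdot z>0\},$$ $$\kappa_*[x,\phi]=\nu\{z:\phi(x+z)>\phi(x),\ D\phi(x)\cdot z<0\}-\nu\{z:\phi(x+z)\le\phi(x),\ D\phi(x)\cdot z\ge0\}.$$ Viscosity sub/supersolutions. An upper semicontinuous function $u:[0,+\infty)\times\mathbb{R}^N\to\mathbb{R}$ is a subsolution if for every smooth test function $\phi$ such that $u-\phi$ admits a global zero maximum at $(t,x)\in(0,+\infty)\times\mathbb{R}^N$, one has $\partial_t\phi(t,x)\le\mu(\widehat{D\phi(t,x)})\big[c_1(x)+\kappa^*[x,\phi(t,\cdot)]\big]|D\phi(t,x)|$ if $D\phi(t,x)\ne0$, and $\partial_t\phi(t,x)\le0$ if $D\phi(t,x)=0$. A lower semicontinuous function $v:[0,+\infty)\times\mathbb{R}^N\to\mathbb{R}$ is a supersolution if for every smooth test function $\phi$ such that $v-\phi$ admits a global zero minimum at $(t,x)\in(0,+\infty)\times\mathbb{R}^N$,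 one has $\partial_t\phi(t,x)\ge\mu(\widehat{D\phi(t,x)})\big[c_1(x)+\kappa_*[x,\phi(t,\cdot)]\big]|D\phi(t,x)|$ if $D\phi(t,x)\ne0$, and $\partial_t\phi(t,x)\ge0$ if $D\phi(t,x)=0$. *)

theory Defs
  imports "HOL-Analysis.Analysis"
begin

definition usc_on :: "'a::topological_space set \<Rightarrow> ('a \<Rightarrow> real) \<Rightarrow> bool" where
  "usc_on S f \<longleftrightarrow> (\<forall>x\<in>S. \<forall>c. f x < c \<longrightarrow> (\<forall>\<^sub>F y in at x within S. f y < c))"

definition lsc_on :: "'a::topological_space set \<Rightarrow> ('a \<Rightarrow> real) \<Rightarrow> bool" where
  "lsc_on S f \<longleftrightarrow> (\<forall>x\<in>S. \<forall>c. c < f x \<longrightarrow> (\<forall>\<^sub>F y in at x within S. c < f y))"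

(* C_diff k f: f is k times continuously differentiable on the whole space, by recursion
   on all directional derivatives. *)
primrec C_diff :: "nat \<Rightarrow> ('a::euclidean_space \<Rightarrow> real) \<Rightarrow> bool" where
  "C_diff 0 f \<longleftrightarrow> continuous_on UNIV f"
| "C_diff (Suc k) f \<longleftrightarrow>
     (\<forall>x. f differentiable (at x)) \<and> (\<forall>h. C_diff k (\<lambda>x. frechet_derivative f (at x) h))"

definition smooth :: "('a::euclidean_space \<Rightarrow> real) \<Rightarrow> bool" where
  "smooth f \<longleftrightarrow> (\<forall>k. C_diff k f)"

definition gradient :: "('a::euclidean_space \<Rightarrow> real) \<Rightarrow> 'a \<Rightarrow> 'a" where
  "gradient f x = (THE D. GDERIV f x :> D)"

lemma gradient_eqI:
  assumes "GDERIV f x :> D"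
  shows "gradient f x = D"
  unfolding gradient_def
proof (rule the_equality)
  fix E assume "GDERIV f x :> E"
  then have "(\<lambda>h. h \<bullet> E) = (\<lambda>h. h \<bullet> D)"
    using assms unfolding gderiv_def by (rule has_derivative_unique)
  then have "\<forall>h. h \<bullet> E = h \<bullet> D"
    by (auto dest: fun_cong)
  then show "E = D"
    by (simp only: vector_eq_ldot)
qed (rule assms)

definition W11 :: "'a::euclidean_space set \<Rightarrow> ('a \<Rightarrow> real) \<Rightarrow> bool" where
  "W11 \<Omega> f \<longleftrightarrow> set_integrable lborel \<Omega> f \<and>
     (\<exists>G :: 'a \<Rightarrow> 'a. set_integrable lborel \<Omega> G \<and>
        (\<forall>\<psi>. smooth \<psi> \<and> compact (closure {x. \<psi> x \<noteq> 0}) \<and> closure {x. \<psi> x \<noteq> 0} \<subseteq> \<Omega> \<longrightarrow>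
           (LINT x:\<Omega>|lborel. f x *\<^sub>R gradient \<psi> x) = - (LINT x:\<Omega>|lborel. \<psi> x *\<^sub>R G x)))"

(* The set {z in B_d : r |z.e| <= |z - (z.e)e|^2}. *)
definition paraboloid_set :: "real \<Rightarrow> real \<Rightarrow> 'a::euclidean_space \<Rightarrow> 'a set" where
  "paraboloid_set \<delta> r e =
     {z \<in> ball 0 \<delta>. r * \<bar>z \<bullet> e\<bar> \<le> (norm (z - (z \<bullet> e) *\<^sub>R e))\<^sup>2}"

(* A non-negative Radon measure on the punctured space, extended by 0 to the origin.
   On this sigma-compact, locally compact metric space, a Borel measure that is finite
   on compact sets is automatically regular. *)
definition punctured_radon :: "'a::euclidean_space measure \<Rightarrow> bool" where
  "punctured_radon \<nu> \<longleftrightarrow> sets \<nu> = sets borel \<and> emeasure \<nu> {0} = 0 \<and>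
     (\<forall>K. compact K \<and> 0 \<notin> K \<longrightarrow> emeasure \<nu> K < \<infinity>)"

(* The first two clauses make the real-valued measure used in the limits (here and in
   singular_density) agree with emeasure. *)
definition singular_measure :: "'a::euclidean_space measure \<Rightarrow> bool" where
  "singular_measure \<nu> \<longleftrightarrow> punctured_radon \<nu> \<and>
     (\<forall>\<delta>>0. emeasure \<nu> (- ball 0 \<delta>) < \<infinity>) \<and>
     (\<forall>r>0. \<forall>e\<in>sphere 0 1. emeasure \<nu> (paraboloid_set 1 r e) < \<infinity>) \<and>
     ((\<lambda>\<delta>. \<delta> * measure \<nu> (- ball 0 \<delta>)) \<longlongrightarrow> 0) (at_right 0) \<and>
     uniform_limit (sphere 0 1) (\<lambda>r e. r * measure \<nu> (paraboloid_set 1 r e)) (\<lambda>_. 0) (at_right 0)"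

(* J is taken to be a Borel, everywhere non-negative representative of its a.e. class.
   The complement of the closed ball is the open set on which the Sobolev space lives. *)
definition singular_density :: "'a::euclidean_space measure \<Rightarrow> bool" where
  "singular_density \<nu> \<longleftrightarrow>
     uniform_limit (sphere 0 1 \<times> {0<..<1})
       (\<lambda>\<delta> (e, r). r * measure \<nu> (paraboloid_set \<delta> r e)) (\<lambda>_. 0) (at_right 0) \<and>
     (\<exists>J. J \<in> borel_measurable borel \<and> (\<forall>z. 0 \<le> J z) \<and>
        \<nu> = density lborel (\<lambda>z. ennreal (J z)) \<and>
        (\<forall>\<delta>>0. W11 (- cball 0 \<delta>) J))"

(* If singular_measure \<nu> holds and \<phi> is smooth with nonzero gradient at x, the four sets
   below have finite \<nu>-measure, so real-valued measure loses nothing. *)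
definition kappa_upper :: "'a::euclidean_space measure \<Rightarrow> 'a \<Rightarrow> ('a \<Rightarrow> real) \<Rightarrow> real" where
  "kappa_upper \<nu> x \<phi> =
     measure \<nu> {z. \<phi> (x + z) \<ge> \<phi> x \<and> gradient \<phi> x \<bullet> z \<le> 0}
   - measure \<nu> {z. \<phi> (x + z) < \<phi> x \<and> gradient \<phi> x \<bullet> z > 0}"

definition kappa_lower :: "'a::euclidean_space measure \<Rightarrow> 'a \<Rightarrow> ('a \<Rightarrow> real) \<Rightarrow> real" where
  "kappa_lower \<nu> x \<phi> =
     measure \<nu> {z. \<phi> (x + z) > \<phi> x \<and> gradient \<phi> x \<bullet> z < 0}
   - measure \<nu> {z. \<phi> (x + z) \<le> \<phi> x \<and> gradient \<phi> x \<bullet> z \<ge> 0}"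

(* Functions of (t, x) are only constrained on t >= 0. Test functions are smooth on all of
   real \<times> 'a, and the extremum is global over t >= 0. The unit vector p/|p| is sgn p. *)
definition viscosity_subsolution ::
    "('a::euclidean_space \<Rightarrow> real) \<Rightarrow> ('a \<Rightarrow> real) \<Rightarrow> 'a measure \<Rightarrow> (real \<times> 'a \<Rightarrow> real) \<Rightarrow> bool" where
  "viscosity_subsolution \<mu> c \<nu> u \<longleftrightarrow> usc_on ({0..} \<times> UNIV) u \<and>
     (\<forall>\<phi> t x. smooth \<phi> \<and> t > 0 \<and> u (t, x) - \<phi> (t, x) = 0 \<and>
        (\<forall>s\<ge>0. \<forall>y. u (s, y) - \<phi> (s, y) \<le> 0) \<longrightarrow>
        (let p = gradient (\<lambda>y. \<phi> (t, y)) x in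
         if p \<noteq> 0
         then deriv (\<lambda>s. \<phi> (s, x)) t
                \<le> \<mu> (sgn p) * (c x + kappa_upper \<nu> x (\<lambda>y. \<phi> (t, y))) * norm p
         else deriv (\<lambda>s. \<phi> (s, x)) t \<le> 0))"

definition viscosity_supersolution ::
    "('a::euclidean_space \<Rightarrow> real) \<Rightarrow> ('a \<Rightarrow> real) \<Rightarrow> 'a measure \<Rightarrow> (real \<times> 'a \<Rightarrow> real) \<Rightarrow> bool" where
  "viscosity_supersolution \<mu> c \<nu> v \<longleftrightarrow> lsc_on ({0..} \<times> UNIV) v \<and>
     (\<forall>\<phi> t x. smooth \<phi> \<and> t > 0 \<and> v (t, x) - \<phi> (t, x) = 0 \<and>
        (\<forall>s\<ge>0. \<forall>y. v (s, y) - \<phi> (s, y) \<ge> 0) \<longrightarrow>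
        (let p = gradient (\<lambda>y. \<phi> (t, y)) x in
         if p \<noteq> 0
         then deriv (\<lambda>s. \<phi> (s, x)) t
                \<ge> \<mu> (sgn p) * (c x + kappa_lower \<nu> x (\<lambda>y. \<phi> (t, y))) * norm p
         else deriv (\<lambda>s. \<phi> (s, x)) t \<ge> 0))"

end

theory Submission
  imports Defs "HOL-Real_Asymp.Real_Asymp"
begin

text \<open>
  Doubling of variables. If \<open>u - v\<close> is positive somewhere, we maximize
  \<open>u (t, x) - v (s, y) - \<bar>x - y\<bar>\<^sup>2 / 2\<epsilon> - 8 M W\<^sup>2 - \<eta> t - \<alpha> ln (1 + \<bar>x\<bar>\<^sup>2)\<close> with
  \<open>W = ln (t / s) / \<beta> + g x\<close>. The logarithm forces \<open>t\<close> and \<open>s\<close> to vanish together, so that the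
  maximum is attained at positive times independently of \<open>\<alpha>\<close>. As \<open>c\<^sub>1\<close> may be unbounded while
  \<open>\<mu>\<close> is merely continuous, the change of gradient caused by the localizing term need not be
  negligible. Therefore \<open>g = 1\<close> where \<open>c\<^sub>1\<close> is large and \<open>g = -1\<close> where \<open>- c\<^sub>1\<close> is
  large: there \<open>s / t\<close> is bounded away from \<open>1\<close> in the direction which absorbs this error.

  In the limit \<open>\<alpha>, \<beta> \<rightarrow> 0\<close> the nonlocal terms near the origin are small by (A3) and (A3'). Away
  from the origin one compares \<open>u (t, x + z)\<close> with \<open>v (s, y + z + \<tau> (x - y))\<close>: if \<open>x \<noteq> y\<close>, the quadratic
  penalty is strictly smaller at the shifted point, so a superlevel set of \<open>u\<close> is contained in a
  strict superlevel set of \<open>v\<close> up to a small translation, whose effect on \<open>J\<close> is small in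
  \<open>L\<^sup>1\<close>. What remains is \<open>\<bar>c\<^sub>1 x - c\<^sub>1 y\<bar> \<bar>x - y\<bar> / \<epsilon>\<close>; it cannot stay away from \<open>0\<close> because each
  halving of \<open>\<epsilon>\<close> would then decrease the bounded maximum by a fixed amount.
\<close>

section \<open>Smooth functions\<close>

text \<open>The curvature sees a test function only through a level set, so a quadratic majorant may
  be reshaped below the touching value; this puts the solution itself in place of the test function
  away from the origin. The time derivatives of the logarithmic penalty are one and the same number
  divided by t and by s. Weighting the inequality for \<open>v\<close> by s/t cancels them and
  leaves \<eta>, while the two speeds keep the weights 1 and s/t. The factor 8M makes |W| at most
  1/2 at a positive maximum, so g = 1 forces s/t >= exp(\<beta>/2) and g = -1 forces s/t <=
  exp(-\<beta>/2): any relative error of \<open>sig\<close> below exp(\<beta>/2) gets a favourable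
  sign. Where g is not locally constant, |c| < R, and the viscosity inequalities themselves bound
  W/\<beta> by a multiple of R + 1, so the gradient of this penalty is small. The order of
  quantifiers is essential: g, \<alpha>, \<beta> are fixed before \<epsilon>, so that maxima for
  \<epsilon> and \<epsilon>/2 carry the same penalties and can be compared. Constants depending on
  \<epsilon> are absorbed by a bound B n that tends to infinity.\<close>

lemma C_diff_Suc_imp: "C_diff (Suc k) f \<Longrightarrow> C_diff k f"
proof (induction k arbitrary: f)
  case 0
  then show ?case
    by (simp add: continuous_at_imp_continuous_on differentiable_imp_continuous_within)
next
  case (Suc k)
  then show ?case by (metis C_diff.simps(2))
qed

lemma C_diff_SucI:
  assumes "\<And>x. (f has_derivative f' x) (at x)" "\<And>h. C_diff k (\<lambda>x. f' x h)"
  shows "C_diff (Suc k) f"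
proof -
  have "frechet_derivative f (at x) = f' x" for x
    using assms(1) frechet_derivative_at by metis
  then show ?thesis using assms by (auto simp: differentiable_def)
qed

lemma C_diff_Suc_derivative:
  assumes "C_diff (Suc k) f"
  shows "(f has_derivative frechet_derivative f (at x)) (at x)"
  using assms frechet_derivative_works by auto

lemma C_diff_const: "C_diff k (\<lambda>x. c)"
proof (induction k arbitrary: c)
  case (Suc k)
  show ?case by (rule C_diff_SucI[where f' = "\<lambda>_ _. 0"]) (auto intro: Suc)
qed auto

lemma C_diff_linear:
  assumes "bounded_linear f" shows "C_diff k f"
proof (cases k)
  case 0
  then show ?thesis by (simp add: assms linear_continuous_on)
next
  case (Suc j)
  show ?thesis unfolding Suc
    by (rule C_diff_SucI[where f' = "\<lambda>_. f"])
       (auto intro: bounded_linear_imp_has_derivative assms C_diff_const)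
qed

lemma C_diff_add:
  assumes "C_diff k f" "C_diff k g"
  shows "C_diff k (\<lambda>x. f x + g x)"
  using assms
proof (induction k arbitrary: f g)
  case 0 then show ?case by (auto intro: continuous_on_add)
next
  case (Suc k)
  show ?case
    by (rule C_diff_SucI[OF has_derivative_add[OF C_diff_Suc_derivative C_diff_Suc_derivative]])
       (use Suc in auto)
qed

lemma C_diff_mult:
  assumes "C_diff k f" "C_diff k g"
  shows "C_diff k (\<lambda>x. f x * g x)"
  using assms
proof (induction k arbitrary: f g)
  case 0 then show ?case by (auto intro: continuous_on_mult)
next
  case (Suc k)
  have k: "C_diff k f" "C_diff k g"
    using Suc.prems C_diff_Suc_imp by blast+
  show ?case
    by (rule C_diff_SucI[OF has_derivative_mult[OF C_diff_Suc_derivative C_diff_Suc_derivative]])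
       (use Suc k in \<open>auto intro!: C_diff_add\<close>)
qed

text \<open>The derivative of \<open>F\<close> at a point is linear on the reals, hence
  multiplication by its value at 1. The chain rule thus becomes a product of a composition and a
  derivative of \<open>g\<close>, to which the induction hypothesis and \<open>C_diff_mult\<close>
  apply.\<close>

lemma C_diff_compose:
  fixes F :: "real \<Rightarrow> real"
  assumes "C_diff k F" "C_diff k g"
  shows "C_diff k (\<lambda>x. F (g x))"
  using assms
proof (induction k arbitrary: F g)
  case 0
  then show ?case
    using continuous_on_compose2[of UNIV F UNIV g] by simp
next
  case (Suc k)
  have k: "C_diff k g"
    using Suc.prems C_diff_Suc_imp by blast
  let ?F' = "\<lambda>x. frechet_derivative F (at x)"
  let ?g' = "\<lambda>x. frechet_derivative g (at x)"
  have d: "((\<lambda>x. F (g x)) has_derivative (\<lambda>h. ?F' (g x) 1 * ?g' x h)) (at x)" for x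
  proof -
    have "((\<lambda>x. F (g x)) has_derivative (\<lambda>h. ?F' (g x) (?g' x h))) (at x)"
      using C_diff_Suc_derivative Suc.prems by (metis has_derivative_compose)
    moreover have "?F' (g x) y = ?F' (g x) 1 * y" for y
    proof -
      have "linear (?F' (g x))"
        using C_diff_Suc_derivative[OF Suc.prems(1)] has_derivative_linear by blast
      from linear_cmul[OF this, of y 1] show ?thesis by simp
    qed
    then have "(\<lambda>h. ?F' (g x) (?g' x h)) = (\<lambda>h. ?F' (g x) 1 * ?g' x h)" by blast
    ultimately show ?thesis by metis
  qed
  show ?case
    by (rule C_diff_SucI[OF d], rule C_diff_mult[OF Suc.IH[OF _ k]]) (use Suc.prems in auto)
qed

lemma C_diff_exp: "C_diff k (exp :: real \<Rightarrow> real)"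
proof (induction k)
  case 0 then show ?case by (simp add: continuous_on_exp)
next
  case (Suc k)
  show ?case
    by (rule C_diff_SucI[where f' = "\<lambda>x h. h * exp x"])
       (auto intro!: derivative_eq_intros C_diff_mult C_diff_const Suc)
qed

text \<open>The derivative of each member of this family is a linear combination of members.\<close>
definition flat :: "nat \<Rightarrow> real \<Rightarrow> real" where
  "flat n x = (if x > 0 then (1 / x) ^ n * exp (- (1 / x)) else 0)"

lemma flat_tendsto_0: "(flat n \<longlongrightarrow> 0) (at 0)"
proof -
  have "((\<lambda>x::real. (1 / x) ^ n * exp (- (1 / x))) \<longlongrightarrow> 0) (at_right 0)"
  proof -
    have "((\<lambda>y::real. y ^ n * exp (- y)) \<longlongrightarrow> 0) at_top"
      using tendsto_power_div_exp_0[of n] by (simp add: exp_minus field_simps)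
    then show ?thesis
      by (rule filterlim_compose) (auto simp: filterlim_inverse_at_top_right divide_inverse)
  qed
  then have "(flat n \<longlongrightarrow> 0) (at_right 0)"
    by (rule Lim_transform_eventually)
       (auto simp: flat_def eventually_at_filter intro!: always_eventually)
  moreover have "(flat n \<longlongrightarrow> 0) (at_left 0)"
    by (rule Lim_transform_eventually[OF tendsto_const])
       (auto simp: flat_def eventually_at_filter intro!: always_eventually)
  ultimately show ?thesis by (simp add: filterlim_split_at_real)
qed

lemma flat_deriv:
  "(flat n has_real_derivative (flat (n + 2) x - real n * flat (n + 1) x)) (at x)"
proof (cases "x = 0")
  case True
  \<comment> \<open>At the origin the difference quotient of \<open>flat n\<close> is
    \<open>flat (n + 1)\<close>, which tends to 0.\<close>
  have "((\<lambda>y. (flat n y - flat n 0) / (y - 0)) \<longlongrightarrow> 0) (at 0)"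
    by (rule Lim_transform_eventually[OF flat_tendsto_0[of "n + 1"]])
       (auto simp: flat_def)
  then show ?thesis unfolding has_field_derivative_iff True by (simp add: flat_def)
next
  case False
  consider "x > 0" | "x < 0" using False by linarith
  then show ?thesis
  proof cases
    case 1
    have "((\<lambda>x. (1 / x) ^ n * exp (- (1 / x))) has_real_derivative
       (flat (n + 2) x - real n * flat (n + 1) x)) (at x)"
    proof -
      have i: "((\<lambda>x. 1 / x) has_real_derivative - ((1 / x)\<^sup>2)) (at x)"
        using 1 by (auto intro!: derivative_eq_intros simp: power2_eq_square)
      have e: "((\<lambda>x. exp (- (1 / x))) has_real_derivative exp (- (1 / x)) * (1 / x)\<^sup>2) (at x)"
        using DERIV_chain2[OF DERIV_exp DERIV_minus[OF i]] by simp
      have "real n * (- (y\<^sup>2) * y ^ (n - Suc 0)) = - real n * y ^ (n + 1)" for y :: real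
        by (cases n) (auto simp: power2_eq_square algebra_simps)
      from DERIV_mult[OF DERIV_power[OF i, of n] e] this[of "1 / x"]
      have "((\<lambda>x. (1 / x) ^ n * exp (- (1 / x))) has_real_derivative
        - real n * (1 / x) ^ (n + 1) * exp (- (1 / x)) +
        exp (- (1 / x)) * (1 / x)\<^sup>2 * (1 / x) ^ n) (at x)" by (simp only:)
      moreover have "- real n * (1 / x) ^ (n + 1) * exp (- (1 / x)) +
        exp (- (1 / x)) * (1 / x)\<^sup>2 * (1 / x) ^ n = flat (n + 2) x - real n * flat (n + 1) x"
        unfolding flat_def if_P[OF 1] power_add by argo
      ultimately show ?thesis by (simp only:)
    qed
    then show ?thesis
      by (rule has_field_derivative_transform_within_open[where S = "{0<..}"])
         (use 1 in \<open>auto simp: flat_def\<close>)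
  next
    case 2
    have "((\<lambda>x. 0) has_real_derivative (flat (n + 2) x - real n * flat (n + 1) x)) (at x)"
      using 2 by (simp add: flat_def)
    then show ?thesis
      by (rule has_field_derivative_transform_within_open[where S = "{..<0}"])
         (use 2 in \<open>auto simp: flat_def\<close>)
  qed
qed

lemma C_diff_flat: "C_diff k (flat n)"
proof (induction k arbitrary: n)
  case 0
  show ?case using flat_deriv
    by (metis C_diff.simps(1) DERIV_isCont continuous_at_imp_continuous_on)
next
  case (Suc k)
  have "C_diff k (\<lambda>x. (flat (n + 2) x - real n * flat (n + 1) x) * h)" for h
    using C_diff_mult[OF C_diff_add[OF Suc C_diff_mult[OF C_diff_const[of _ "- real n"] Suc]] C_diff_const]
    by simp
  then show ?case
    by (rule C_diff_SucI[OF flat_deriv[unfolded has_field_derivative_def]])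
qed

section \<open>Closure properties of smoothness\<close>

lemma smooth_const [intro]: "smooth (\<lambda>x. c)"
  by (simp add: smooth_def C_diff_const)

lemma smooth_linear: "bounded_linear f \<Longrightarrow> smooth f"
  by (simp add: smooth_def C_diff_linear)

lemma smooth_add [intro]: "smooth f \<Longrightarrow> smooth g \<Longrightarrow> smooth (\<lambda>x. f x + g x)"
  by (simp add: smooth_def C_diff_add)

lemma smooth_mult [intro]: "smooth f \<Longrightarrow> smooth g \<Longrightarrow> smooth (\<lambda>x. f x * g x)"
  by (simp add: smooth_def C_diff_mult)

lemma smooth_minus [intro]: "smooth f \<Longrightarrow> smooth (\<lambda>x. - f x)"
  using smooth_mult[OF smooth_const[of "-1"], of f] by simp

lemma smooth_diff [intro]: "smooth f \<Longrightarrow> smooth g \<Longrightarrow> smooth (\<lambda>x. f x - g x)"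
  using smooth_add[OF _ smooth_minus, of f g] by simp

lemma smooth_compose:
  fixes F :: "real \<Rightarrow> real"
  shows "smooth F \<Longrightarrow> smooth g \<Longrightarrow> smooth (\<lambda>x. F (g x))"
  by (simp add: smooth_def C_diff_compose)

lemma smooth_flat: "smooth (flat n)"
  by (simp add: smooth_def C_diff_flat)

lemma smooth_exp: "smooth (exp :: real \<Rightarrow> real)"
  by (simp add: smooth_def C_diff_exp)

lemma smooth_sum [intro]:
  "(\<And>i. i \<in> I \<Longrightarrow> smooth (f i)) \<Longrightarrow> smooth (\<lambda>x. \<Sum>i\<in>I. f i x)"
  by (induction I rule: infinite_finite_induct) auto

lemma smooth_norm_diff_power2:
  fixes f :: "'a::euclidean_space \<Rightarrow> 'b::euclidean_space"
  assumes "bounded_linear f"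
  shows "smooth (\<lambda>x. (norm (f x - a))\<^sup>2)"
proof -
  have eq: "(\<lambda>x. (norm (f x - a))\<^sup>2) =
      (\<lambda>x. \<Sum>b\<in>Basis. (f x \<bullet> b - a \<bullet> b) * (f x \<bullet> b - a \<bullet> b))"
    by (rule ext, subst power2_norm_eq_inner, subst euclidean_inner) (simp add: inner_diff_left)
  show ?thesis unfolding eq
    by (intro smooth_sum smooth_mult smooth_diff smooth_const smooth_linear
        bounded_linear_compose[OF bounded_linear_inner_left assms])
qed

lemma smooth_has_derivative:
  "smooth f \<Longrightarrow> (f has_derivative frechet_derivative f (at x)) (at x)"
  unfolding smooth_def using C_diff_Suc_derivative by blast

text \<open>\<open>gradient\<close> is a definite description, so a representing vector has to be
  exhibited: its coordinates are the values of the derivative on the basis.\<close>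

lemma gradient_GDERIV:
  assumes "smooth \<phi>"
  shows "GDERIV (\<lambda>y. \<phi> (t, y)) x :> gradient (\<lambda>y. \<phi> (t, y)) x"
proof -
  have "((\<lambda>y. \<phi> (t, y)) has_derivative (\<lambda>h. frechet_derivative \<phi> (at (t, x)) (0, h))) (at x)"
    by (rule has_derivative_compose[OF has_derivative_Pair[OF has_derivative_const has_derivative_ident]
        smooth_has_derivative[OF assms]])
  then obtain D where D: "((\<lambda>y. \<phi> (t, y)) has_derivative D) (at x)" by blast
  define E where "E = (\<Sum>b\<in>Basis. D b *\<^sub>R b)"
  have "D h = h \<bullet> E" for h
  proof -
    have l: "linear D" using D has_derivative_linear by blast
    have "D h = D (\<Sum>b\<in>Basis. (h \<bullet> b) *\<^sub>R b)" by (simp add: euclidean_representation)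
    also have "\<dots> = h \<bullet> E"
      by (simp add: linear_sum[OF l] linear_cmul[OF l] E_def inner_sum_right mult.commute)
    finally show ?thesis .
  qed
  then have "D = (\<lambda>h. h \<bullet> E)" by auto
  with D have "GDERIV (\<lambda>y. \<phi> (t, y)) x :> E" by (simp add: gderiv_def)
  then show ?thesis using gradient_eqI by metis
qed

section \<open>Test functions\<close>

lemma usc_on_ball:
  fixes f :: "'a::metric_space \<Rightarrow> real"
  assumes "usc_on S f" "x \<in> S" "f x < c"
  shows "\<exists>r>0. \<forall>y\<in>S. dist y x < r \<longrightarrow> f y < c"
proof -
  have "\<forall>\<^sub>F y in at x within S. f y < c" using assms by (auto simp: usc_on_def)
  then obtain r where "r > 0" "\<forall>y\<in>S. y \<noteq> x \<and> dist y x < r \<longrightarrow> f y < c"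
    by (auto simp: eventually_at)
  then show ?thesis using assms(3) by metis
qed

lemma smooth_continuous: "smooth f \<Longrightarrow> continuous_on UNIV f"
  unfolding smooth_def using C_diff.simps(1) by blast

lemma flat_0_nonneg: "0 \<le> flat 0 x"
  and flat_0_pos_iff: "0 < flat 0 x \<longleftrightarrow> 0 < x"
  by (auto simp: flat_def)

text \<open>Semicontinuity keeps \<open>f\<close> below the midpoint of \<open>f x\<close> and
  \<open>a\<close> on a ball around each x in \<open>K\<close>. Finitely many of these balls, with
  halved radii, cover \<open>K\<close>, and \<open>\<sigma>\<close> is a sum of bumps living on the
  halved balls. As \<open>f x0\<close> is at least \<open>a\<close>, the point \<open>x0\<close>
  lies outside the full balls, hence at positive distance from the halved ones.\<close>

lemma smooth_bump_sublevel:
  fixes f :: "'a::euclidean_space \<Rightarrow> real"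
  assumes f: "usc_on S f" and K: "compact K" "K \<subseteq> S" "\<forall>x\<in>K. f x < a"
    and x0: "x0 \<in> S" "a \<le> f x0"
  obtains \<sigma> e where "smooth \<sigma>" "e > 0" "\<And>x. 0 \<le> \<sigma> x" "\<And>x. x \<in> K \<Longrightarrow> 0 < \<sigma> x"
    "\<And>x. x \<in> S \<Longrightarrow> 0 < \<sigma> x \<Longrightarrow> f x \<le> a - e" "\<forall>\<^sub>F x in nhds x0. \<sigma> x = 0"
proof -
  have "\<forall>x\<in>K. \<exists>r>0. \<forall>y\<in>S. dist y x < r \<longrightarrow> f y < (f x + a) / 2"
    using K by (intro ballI usc_on_ball[OF f]) (auto simp: field_simps)
  then obtain r where r: "\<And>x. x \<in> K \<Longrightarrow> r x > 0"
    "\<And>x y. x \<in> K \<Longrightarrow> y \<in> S \<Longrightarrow> dist y x < r x \<Longrightarrow> f y < (f x + a) / 2"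
    by metis
  have "K \<subseteq> (\<Union>x\<in>K. ball x (r x / 2))" using r(1) by force
  then obtain C where C: "C \<subseteq> K" "finite C" "K \<subseteq> (\<Union>x\<in>C. ball x (r x / 2))"
    using compactE_image[OF K(1), of K "\<lambda>x. ball x (r x / 2)"] by auto
  define \<sigma> where "\<sigma> y = (\<Sum>x\<in>C. flat 0 ((r x / 2)\<^sup>2 - (norm (y - x))\<^sup>2))" for y
  \<comment> \<open>The other entries are the gaps between \<open>a\<close> and the midpoints; the 1
    keeps the minimum meaningful for an empty cover.\<close>
  define e where "e = Min (insert 1 ((\<lambda>x. (a - f x) / 2) ` C))"
  have pos_iff: "0 < flat 0 ((r x / 2)\<^sup>2 - (norm (y - x))\<^sup>2) \<longleftrightarrow> dist y x < r x / 2" if "x \<in> C" for x y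
  proof -
    have "0 < r x / 2" using that C r by force
    then show ?thesis
      using power2_less_imp_less[of "norm (y - x)" "r x / 2"]
        power_strict_mono[of "norm (y - x)" "r x / 2" 2]
      by (auto simp: flat_0_pos_iff dist_norm)
  qed
  show ?thesis
  proof
    show "smooth \<sigma>"
      unfolding \<sigma>_def
      by (intro smooth_sum smooth_compose[OF smooth_flat] smooth_diff smooth_const
          smooth_norm_diff_power2 bounded_linear_ident)
    show "e > 0" using C K(3) by (auto simp: e_def)
    show "0 \<le> \<sigma> x" for x by (auto simp: \<sigma>_def intro: sum_nonneg flat_0_nonneg)
    show "0 < \<sigma> y" if yK: "y \<in> K" for y
    proof -
      have "y \<in> (\<Union>x\<in>C. ball x (r x / 2))" using C(3) yK by (rule subsetD)
      then obtain x where "x \<in> C" "y \<in> ball x (r x / 2)" by (elim UN_E)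
      then show ?thesis unfolding \<sigma>_def
        by (intro sum_pos2[OF C(2)]) (auto simp: pos_iff dist_commute flat_0_nonneg)
    qed
    show "f y \<le> a - e" if yS: "y \<in> S" and y0: "0 < \<sigma> y" for y
    proof -
      have "\<not> (\<forall>x\<in>C. flat 0 ((r x / 2)\<^sup>2 - (norm (y - x))\<^sup>2) = 0)"
      proof
        assume "\<forall>x\<in>C. flat 0 ((r x / 2)\<^sup>2 - (norm (y - x))\<^sup>2) = 0"
        then have "\<sigma> y = 0" unfolding \<sigma>_def by (rule sum.neutral)
        then show False using y0 by simp
      qed
      then obtain x where x: "x \<in> C" "0 < flat 0 ((r x / 2)\<^sup>2 - (norm (y - x))\<^sup>2)"
        using flat_0_nonneg order_le_less by metis
      then have "dist y x < r x / 2" "r x > 0" using pos_iff r(1) C(1) by auto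
      then have "dist y x < r x" by linarith
      then have "f y < (f x + a) / 2" using r(2) x C(1) yS by blast
      moreover have "e \<le> (a - f x) / 2" unfolding e_def using x C(2) by (intro Min_le) auto
      ultimately show ?thesis by argo
    qed
    have "\<forall>\<^sub>F y in nhds x0. dist y x > r x / 2" if "x \<in> C" for x
    proof -
      have "dist x0 x \<ge> r x" using r(2)[of x x0] x0 that C(1) K(3) by force
      moreover have "r x > 0" using that C r by force
      ultimately have "dist x0 x > r x / 2" by linarith
      then show ?thesis
        by (intro order_tendstoD(1)[where y="dist x0 x"] tendsto_dist filterlim_ident tendsto_const)
    qed
    then have "\<forall>\<^sub>F y in nhds x0. \<forall>x\<in>C. dist y x > r x / 2"
      using C(2) by (simp add: eventually_ball_finite_distrib)
    then show "\<forall>\<^sub>F y in nhds x0. \<sigma> y = 0"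
    proof eventually_elim
      case (elim y)
      show ?case unfolding \<sigma>_def
      proof (rule sum.neutral, rule ballI)
        fix x assume x: "x \<in> C"
        then have "\<not> 0 < flat 0 ((r x / 2)\<^sup>2 - (norm (y - x))\<^sup>2)" using elim pos_iff[OF x, of y] by force
        then show "flat 0 ((r x / 2)\<^sup>2 - (norm (y - x))\<^sup>2) = 0"
          using flat_0_nonneg order_le_less by metis
      qed
    qed
  qed
qed

text \<open>The test function interpolates between \<open>Q\<close> and a constant slightly below \<open>a\<close>.\<close>
lemma smooth_touching_modification:
  fixes f Q :: "'a::euclidean_space \<Rightarrow> real"
  assumes f: "usc_on S f" and K: "compact K" "K \<subseteq> S" "\<forall>x\<in>K. f x < a"
    and x0: "x0 \<in> S" "f x0 = a" and Q: "smooth Q" "\<And>x. x \<in> S \<Longrightarrow> f x \<le> Q x"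
  obtains \<phi> where "smooth \<phi>" "\<And>x. x \<in> S \<Longrightarrow> f x \<le> \<phi> x" "\<forall>\<^sub>F x in nhds x0. \<phi> x = Q x"
    "\<And>x. Q x < a \<Longrightarrow> \<phi> x < a" "\<And>x. x \<in> K \<Longrightarrow> \<phi> x < a"
proof -
  obtain \<sigma> e where \<sigma>: "smooth \<sigma>" "e > 0" "\<And>x. 0 \<le> \<sigma> x" "\<And>x. x \<in> K \<Longrightarrow> 0 < \<sigma> x"
    "\<And>x. x \<in> S \<Longrightarrow> 0 < \<sigma> x \<Longrightarrow> f x \<le> a - e" "\<forall>\<^sub>F x in nhds x0. \<sigma> x = 0"
    using smooth_bump_sublevel[OF f K x0(1)] x0(2) by blast
  have "\<exists>m>0. \<forall>x\<in>K. m \<le> \<sigma> x"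
  proof (cases "K = {}")
    case True then show ?thesis by (auto intro: exI[of _ 1])
  next
    case False
    have "continuous_on K \<sigma>" using smooth_continuous[OF \<sigma>(1)] continuous_on_subset by blast
    then obtain x where "x \<in> K" "\<forall>y\<in>K. \<sigma> x \<le> \<sigma> y" using continuous_attains_inf[OF K(1) False] by blast
    then show ?thesis using \<sigma>(4) by blast
  qed
  then obtain m where m: "m > 0" "\<And>x. x \<in> K \<Longrightarrow> m \<le> \<sigma> x" by blast
  have "continuous_on K (\<lambda>x. Q x - (a - e))"
    using smooth_continuous[OF Q(1)] continuous_on_subset by (auto intro!: continuous_intros)
  then have "bounded ((\<lambda>x. Q x - (a - e)) ` K)"
    using K(1) compact_continuous_image compact_imp_bounded by blast
  then obtain B where B: "B > 0" "\<And>x. x \<in> K \<Longrightarrow> \<bar>Q x - (a - e)\<bar> \<le> B"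
    unfolding bounded_pos by auto
  \<comment> \<open>The rate is chosen so that \<open>E\<close> is at most exp(-B/e) on
    \<open>K\<close>; since y < exp y, the product B exp(-B/e) is less than \<open>e\<close>, which
    puts \<open>\<phi>\<close> below \<open>a\<close> there.\<close>
  define E where "E x = exp (- (B / (e * m)) * \<sigma> x)" for x
  have E: "0 < E x" "E x \<le> 1" for x
    using B(1) \<sigma>(2,3) m(1) by (auto simp: E_def zero_le_mult_iff)
  define \<phi> where "\<phi> x = (a - e) + (Q x - (a - e)) * E x" for x
  have \<phi>_alt: "\<phi> x = (1 - E x) * (a - e) + E x * Q x" for x
    by (simp add: \<phi>_def algebra_simps)
  have E0: "\<phi> x = Q x" if "\<sigma> x = 0" for x using that by (simp add: \<phi>_def E_def)
  show ?thesis
  proof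
    show "smooth \<phi>" unfolding \<phi>_def E_def
      by (intro smooth_add smooth_mult smooth_diff smooth_const Q smooth_compose[OF smooth_exp] \<sigma>)
    show "f x \<le> \<phi> x" if "x \<in> S" for x
    proof (cases "\<sigma> x = 0")
      case True then show ?thesis using E0 Q(2) that by simp
    next
      case False
      \<comment> \<open>Where \<open>\<sigma>\<close> is positive, both endpoints
        \<open>a - e\<close> and \<open>Q x\<close> of the convex combination are at least
        \<open>f x\<close>.\<close>
      then have "f x \<le> a - e" using \<sigma>(3,5) that by (metis order_le_less)
      then have "(1 - E x) * f x + E x * f x \<le> \<phi> x"
        unfolding \<phi>_alt using E[of x] Q(2)[OF that] by (intro add_mono mult_left_mono) auto
      then show ?thesis by (simp add: algebra_simps)
    qed
    show "\<forall>\<^sub>F x in nhds x0. \<phi> x = Q x"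
      using \<sigma>(6) by eventually_elim (rule E0)
    show "\<phi> x < a" if "Q x < a" for x
    proof -
      have "E x * Q x < E x * a" using E that by simp
      moreover have "(1 - E x) * (a - e) \<le> (1 - E x) * a" using E[of x] \<sigma>(2) by (intro mult_left_mono) auto
      ultimately show ?thesis unfolding \<phi>_alt by (simp add: algebra_simps)
    qed
    show "\<phi> x < a" if "x \<in> K" for x
    proof -
      have El: "E x \<le> exp (- (B / e))"
        using m that B(1) \<sigma>(2) by (auto simp: E_def field_simps)
      have "(Q x - (a - e)) * E x \<le> B * exp (- (B / e))"
        using B(2)[OF that] El E[of x] B(1) by (intro mult_mono) auto
      also have "\<dots> < e"
      proof -
        have "B / e < exp (B / e)" using exp_ge_add_one_self[of "B / e"] by linarith
        then show ?thesis using \<sigma>(2) by (simp add: exp_minus field_simps)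
      qed
      finally show ?thesis by (simp add: \<phi>_def)
    qed
  qed
qed

text \<open>A global paraboloid touching \<open>u\<close> from above at (t, x). The coefficients
  \<open>a\<close> and \<open>p\<close> become the time derivative and the gradient of the test
  function; \<open>h\<close> decides which small jumps cannot be judged by the sign of
  \<open>p \<bullet> z\<close> alone.\<close>

definition majorized ::
  "(real \<times> 'a::euclidean_space \<Rightarrow> real) \<Rightarrow> real \<Rightarrow> 'a \<Rightarrow> real \<Rightarrow> real \<Rightarrow> 'a \<Rightarrow> real \<Rightarrow> bool" where
  "majorized u t x a A p h \<longleftrightarrow> (\<forall>t'\<ge>0. \<forall>x'.
     u (t', x') \<le> u (t, x) + a * (t' - t) + A * (t' - t)\<^sup>2 + p \<bullet> (x' - x) + h * (norm (x' - x))\<^sup>2)"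

text \<open>The paraboloid is lowered below the touching value over the compact set of points (t, x
  + z) with z in \<open>K\<close>. The modification does not act near (t, x), which preserves the
  derivatives, and raises no point to the touching value, which preserves the constraint inherited
  from the paraboloid.\<close>

lemma viscosity_subsolution_test:
  fixes u :: "real \<times> 'a::euclidean_space \<Rightarrow> real"
  assumes sub: "viscosity_subsolution \<mu> c \<nu> u" and t: "t > 0" and maj: "majorized u t x a A p h"
    and K: "compact K" "\<forall>z\<in>K. u (t, x + z) < u (t, x)"
  obtains \<psi> where "continuous_on UNIV \<psi>" "\<psi> x = u (t, x)"
    "\<And>z. u (t, x) \<le> \<psi> (x + z) \<Longrightarrow> 0 \<le> p \<bullet> z + h * (norm z)\<^sup>2"
    "\<And>z. z \<in> K \<Longrightarrow> \<psi> (x + z) < u (t, x)" "gradient \<psi> x = p"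
    "\<exists>r>0. \<forall>z. norm z < r \<longrightarrow> \<psi> (x + z) = u (t, x) + p \<bullet> z + h * (norm z)\<^sup>2"
    "if p \<noteq> 0 then a \<le> \<mu> (sgn p) * (c x + kappa_upper \<nu> x \<psi>) * norm p else a \<le> 0"
proof -
  define S where "S = ({0..} \<times> UNIV :: (real \<times> 'a) set)"
  define Q where "Q \<xi> = u (t, x) + a * (fst \<xi> - t) + A * (norm (fst \<xi> - t))\<^sup>2 + (p \<bullet> snd \<xi> - p \<bullet> x)
     + h * (norm (snd \<xi> - x))\<^sup>2" for \<xi> :: "real \<times> 'a"
  have Q: "smooth Q" unfolding Q_def
    by (intro smooth_add smooth_mult smooth_diff smooth_const smooth_norm_diff_power2
        bounded_linear_fst bounded_linear_snd smooth_linear[OF bounded_linear_fst]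
        smooth_linear[OF bounded_linear_compose[OF bounded_linear_inner_right bounded_linear_snd]])
  have uQ: "u \<xi> \<le> Q \<xi>" if "\<xi> \<in> S" for \<xi>
    using maj[unfolded majorized_def, rule_format, of "fst \<xi>" "snd \<xi>"] that
    by (auto simp: S_def Q_def inner_diff_right)
  have usc: "usc_on S u" using sub by (simp add: viscosity_subsolution_def S_def)
  define K' where "K' = {t} \<times> ((+) x ` K)"
  have K': "compact K'" "K' \<subseteq> S" "\<forall>\<xi>\<in>K'. u \<xi> < u (t, x)"
    unfolding K'_def S_def using K t by (auto intro!: compact_Times compact_translation)
  have tx: "(t, x) \<in> S" using t by (simp add: S_def)
  obtain \<phi> where \<phi>: "smooth \<phi>" "\<And>\<xi>. \<xi> \<in> S \<Longrightarrow> u \<xi> \<le> \<phi> \<xi>" "\<forall>\<^sub>F \<xi> in nhds (t, x). \<phi> \<xi> = Q \<xi>"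
    "\<And>\<xi>. Q \<xi> < u (t, x) \<Longrightarrow> \<phi> \<xi> < u (t, x)" "\<And>\<xi>. \<xi> \<in> K' \<Longrightarrow> \<phi> \<xi> < u (t, x)"
    using smooth_touching_modification[OF usc K' tx refl Q uQ] by blast
  have \<phi>tx: "\<phi> (t, x) = u (t, x)"
    using eventually_nhds_x_imp_x[OF \<phi>(3)] by (simp add: Q_def)
  have "((\<lambda>y. Q (t, y)) has_derivative (\<lambda>k. k \<bullet> p)) (at x)"
    unfolding Q_def power2_norm_eq_inner
    by (auto intro!: derivative_eq_intros simp: inner_commute)
  moreover have "\<forall>\<^sub>F y in nhds x. Q (t, y) = \<phi> (t, y)"
  proof -
    have "((\<lambda>y. (t, y)) \<longlongrightarrow> (t, x)) (nhds x)"
      by (intro tendsto_Pair tendsto_const filterlim_ident)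
    from eventually_compose_filterlim[OF \<phi>(3) this] show ?thesis by (simp add: eq_commute)
  qed
  moreover from this obtain r where r: "r > 0" "\<And>y. dist y x < r \<Longrightarrow> Q (t, y) = \<phi> (t, y)"
    unfolding eventually_nhds_metric by blast
  have near: "\<exists>r>0. \<forall>z. norm z < r \<longrightarrow> \<phi> (t, x + z) = u (t, x) + p \<bullet> z + h * (norm z)\<^sup>2"
  proof (intro exI conjI allI impI)
    fix z :: 'a assume "norm z < r"
    then have "Q (t, x + z) = \<phi> (t, x + z)" by (intro r(2)) (simp add: dist_norm)
    then show "\<phi> (t, x + z) = u (t, x) + p \<bullet> z + h * (norm z)\<^sup>2"
      by (simp add: Q_def inner_add_right)
  qed (rule r(1))
  ultimately have "((\<lambda>y. \<phi> (t, y)) has_derivative (\<lambda>k. k \<bullet> p)) (at x)"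
    using has_derivative_transform_eventually[of "\<lambda>y. Q (t, y)" _ x UNIV "\<lambda>y. \<phi> (t, y)"]
    by (simp add: eventually_nhds_conv_at)
  then have grad: "gradient (\<lambda>y. \<phi> (t, y)) x = p"
    by (intro gradient_eqI) (simp add: gderiv_def)
  have "((\<lambda>s. Q (s, x)) has_real_derivative a) (at t)"
    unfolding Q_def by (auto intro!: derivative_eq_intros)
  moreover have ev: "\<forall>\<^sub>F s in nhds t. \<phi> (s, x) = Q (s, x)"
  proof -
    have "((\<lambda>s. (s, x)) \<longlongrightarrow> (t, x)) (nhds t)"
      by (intro tendsto_Pair tendsto_const filterlim_ident)
    from eventually_compose_filterlim[OF \<phi>(3) this] show ?thesis by simp
  qed
  ultimately have "((\<lambda>s. \<phi> (s, x)) has_real_derivative a) (at t)"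
    by (subst DERIV_cong_ev[OF refl ev refl])
  then have der: "deriv (\<lambda>s. \<phi> (s, x)) t = a" by (rule DERIV_imp_deriv)
  have "smooth \<phi> \<and> t > 0 \<and> u (t, x) - \<phi> (t, x) = 0 \<and> (\<forall>s\<ge>0. \<forall>y. u (s, y) - \<phi> (s, y) \<le> 0)"
    using \<phi>(1,2) t \<phi>tx by (auto simp: S_def)
  then have concl: "if p \<noteq> 0 then a \<le> \<mu> (sgn p) * (c x + kappa_upper \<nu> x (\<lambda>y. \<phi> (t, y))) * norm p
      else a \<le> 0"
    using sub grad der unfolding viscosity_subsolution_def Let_def by metis
  show ?thesis
  proof (rule that[of "\<lambda>y. \<phi> (t, y)"])
    show "continuous_on UNIV (\<lambda>y. \<phi> (t, y))"
      using smooth_continuous[OF \<phi>(1)]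
      by (rule continuous_on_compose2) (auto intro!: continuous_intros)
    show "\<phi> (t, x) = u (t, x)" by (rule \<phi>tx)
    show "0 \<le> p \<bullet> z + h * (norm z)\<^sup>2" if "u (t, x) \<le> \<phi> (t, x + z)" for z
      using \<phi>(4)[of "(t, x + z)"] that by (force simp: Q_def inner_add_right)
    show "\<phi> (t, x + z) < u (t, x)" if "z \<in> K" for z
      using \<phi>(5)[of "(t, x + z)"] that by (simp add: K'_def)
  qed (use grad concl near in auto)
qed

section \<open>The singular measure\<close>

text \<open>The small jumps for which the quadratic term of a majorant can outweigh the linear one,
  so that its level set may leave the tangent half space.\<close>

definition near_set :: "real \<Rightarrow> real \<Rightarrow> 'a::euclidean_space \<Rightarrow> 'a set" where
  "near_set \<delta> h p = {z \<in> ball 0 \<delta>. \<bar>p \<bullet> z\<bar> \<le> h * (norm z)\<^sup>2}"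

text \<open>The speed as a positively homogeneous function of the gradient. It extends continuously
  by 0 to p = 0 and so absorbs the case of a vanishing gradient.\<close>

definition sig :: "('a::euclidean_space \<Rightarrow> real) \<Rightarrow> 'a \<Rightarrow> real" where
  "sig \<mu> p = \<mu> (sgn p) * norm p"

lemma near_set_measurable [measurable]: "near_set \<delta> h p \<in> sets borel"
proof -
  have "closed {z. \<bar>p \<bullet> z\<bar> \<le> h * (norm z)\<^sup>2}"
    by (intro closed_Collect_le continuous_intros)
  moreover have "near_set \<delta> h p = ball 0 \<delta> \<inter> {z. \<bar>p \<bullet> z\<bar> \<le> h * (norm z)\<^sup>2}"
    by (auto simp: near_set_def)
  ultimately show ?thesis by (auto intro!: sets.Int borel_open borel_closed)
qed

lemma near_set_uminus: "near_set \<delta> h (- p) = near_set \<delta> h p"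
  by (simp add: near_set_def)

lemma paraboloid_set_measurable [measurable]: "paraboloid_set \<delta> r e \<in> sets borel"
proof -
  have "closed {z. r * \<bar>z \<bullet> e\<bar> \<le> (norm (z - (z \<bullet> e) *\<^sub>R e))\<^sup>2}"
    by (intro closed_Collect_le continuous_intros)
  moreover have "paraboloid_set \<delta> r e = ball 0 \<delta> \<inter> {z. r * \<bar>z \<bullet> e\<bar> \<le> (norm (z - (z \<bullet> e) *\<^sub>R e))\<^sup>2}"
    by (auto simp: paraboloid_set_def)
  ultimately show ?thesis by (auto intro!: sets.Int borel_open borel_closed)
qed

lemma norm_power2_split_direction:
  assumes "norm e = 1"
  shows "(norm z)\<^sup>2 = (norm (z - (z \<bullet> e) *\<^sub>R e))\<^sup>2 + (z \<bullet> e)\<^sup>2"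
proof -
  have e: "e \<bullet> e = 1" using assms by (simp add: dot_square_norm)
  have "(norm (z - (z \<bullet> e) *\<^sub>R e))\<^sup>2 = (z - (z \<bullet> e) *\<^sub>R e) \<bullet> (z - (z \<bullet> e) *\<^sub>R e)"
    by (rule power2_norm_eq_inner)
  also have "\<dots> = z \<bullet> z - (z \<bullet> e)\<^sup>2"
    by (simp add: inner_diff_left inner_diff_right inner_commute power2_eq_square e algebra_simps)
  finally show ?thesis by (simp add: power2_norm_eq_inner)
qed

text \<open>Split |z|^2 into its normal and tangential parts with respect to p/|p|. For |z| <=
  |p|/(2h) the normal part costs at most half of the left-hand side; absorbing it leaves a
  paraboloid with parameter |p|/(2h).\<close>

lemma near_set_subset_paraboloid_point:
  assumes p: "p \<noteq> 0" and h: "h > 0" and z: "\<bar>p \<bullet> z\<bar> \<le> h * (norm z)\<^sup>2" "norm z \<le> norm p / (2 * h)"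
  shows "norm p / (2 * h) * \<bar>z \<bullet> sgn p\<bar> \<le> (norm (z - (z \<bullet> sgn p) *\<^sub>R sgn p))\<^sup>2"
proof -
  define q where "q = \<bar>z \<bullet> sgn p\<bar>"
  have ns: "norm (sgn p) = 1" using p by (simp add: norm_sgn)
  have pz: "\<bar>p \<bullet> z\<bar> = norm p * q"
  proof -
    have "p \<bullet> z = norm p * (z \<bullet> sgn p)" using p by (simp add: sgn_div_norm inner_commute)
    then show ?thesis by (simp add: q_def abs_mult)
  qed
  have q: "0 \<le> q" "q \<le> norm z"
    using Cauchy_Schwarz_ineq2[of z "sgn p"] ns by (auto simp: q_def)
  have "q * q \<le> q * (norm p / (2 * h))" using q z(2) by (intro mult_left_mono) auto
  then have "h * (q * q) \<le> norm p * q / 2" using h by (simp add: field_simps)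
  moreover have "norm p * q \<le> h * ((norm (z - (z \<bullet> sgn p) *\<^sub>R sgn p))\<^sup>2 + q * q)"
    using z(1) norm_power2_split_direction[OF ns, of z] pz by (simp add: q_def power2_eq_square)
  ultimately have "norm p * q / 2 \<le> h * (norm (z - (z \<bullet> sgn p) *\<^sub>R sgn p))\<^sup>2"
    by (simp add: distrib_left)
  then show ?thesis using h unfolding q_def by (simp add: field_simps)
qed

lemma near_set_subset_paraboloid:
  assumes "p \<noteq> 0" "h > 0" "\<delta> \<le> norm p / (2 * h)" "r \<le> norm p / (2 * h)"
  shows "near_set \<delta> h p \<subseteq> paraboloid_set \<delta> r (sgn p)"
proof
  fix z assume z: "z \<in> near_set \<delta> h p"
  then have "norm p / (2 * h) * \<bar>z \<bullet> sgn p\<bar> \<le> (norm (z - (z \<bullet> sgn p) *\<^sub>R sgn p))\<^sup>2"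
    using assms by (intro near_set_subset_paraboloid_point) (auto simp: near_set_def)
  moreover have "r * \<bar>z \<bullet> sgn p\<bar> \<le> norm p / (2 * h) * \<bar>z \<bullet> sgn p\<bar>"
    using assms(4) by (intro mult_right_mono) auto
  ultimately have "r * \<bar>z \<bullet> sgn p\<bar> \<le> (norm (z - (z \<bullet> sgn p) *\<^sub>R sgn p))\<^sup>2" by linarith
  then show "z \<in> paraboloid_set \<delta> r (sgn p)" using z by (auto simp: near_set_def paraboloid_set_def)
qed

text \<open>Jumps too long for the pointwise inclusion are covered by the complement of a ball of
  the same parameter r. These two pieces are exactly the sets whose masses become small under (A3)
  after multiplication by r.\<close>

lemma near_set_subset_Un:
  assumes "p \<noteq> 0" "h > 0" "r \<le> norm p / (2 * h)"
  shows "near_set \<delta> h p \<subseteq> paraboloid_set \<delta> r (sgn p) \<union> - ball 0 r"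
proof
  fix z assume z: "z \<in> near_set \<delta> h p"
  show "z \<in> paraboloid_set \<delta> r (sgn p) \<union> - ball 0 r"
  proof (cases "norm z < r")
    case True
    then have "norm p / (2 * h) * \<bar>z \<bullet> sgn p\<bar> \<le> (norm (z - (z \<bullet> sgn p) *\<^sub>R sgn p))\<^sup>2"
      using z assms by (intro near_set_subset_paraboloid_point) (auto simp: near_set_def)
    moreover have "r * \<bar>z \<bullet> sgn p\<bar> \<le> norm p / (2 * h) * \<bar>z \<bullet> sgn p\<bar>"
      using assms(3) by (intro mult_right_mono) auto
    ultimately have "r * \<bar>z \<bullet> sgn p\<bar> \<le> (norm (z - (z \<bullet> sgn p) *\<^sub>R sgn p))\<^sup>2" by linarith
    then show ?thesis using z by (auto simp: near_set_def paraboloid_set_def)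
  qed auto
qed

lemma paraboloid_set_mono:
  assumes "\<delta> \<le> \<delta>'" "r' \<le> r"
  shows "paraboloid_set \<delta> r e \<subseteq> paraboloid_set \<delta>' r' e"
proof
  fix z assume z: "z \<in> paraboloid_set \<delta> r e"
  have "r' * \<bar>z \<bullet> e\<bar> \<le> r * \<bar>z \<bullet> e\<bar>" using assms by (intro mult_right_mono) auto
  then show "z \<in> paraboloid_set \<delta>' r' e" using z assms unfolding paraboloid_set_def by auto
qed

section \<open>Mass of the near sets under (A3)\<close>

locale levy =
  fixes \<nu> :: "'a::euclidean_space measure"
  assumes A3: "singular_measure \<nu>"
begin

lemma sets_nu [simp, measurable_cong]: "sets \<nu> = sets borel"
  using A3 by (simp add: singular_measure_def punctured_radon_def)

lemma space_nu [simp]: "space \<nu> = UNIV"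
  using sets_eq_imp_space_eq[OF sets_nu] by simp

lemma far_finite: "\<delta> > 0 \<Longrightarrow> emeasure \<nu> (- ball 0 \<delta>) < \<infinity>"
  using A3 by (simp add: singular_measure_def)

lemma fmeasurable_far: "\<delta> > 0 \<Longrightarrow> - ball 0 \<delta> \<in> fmeasurable \<nu>"
  using far_finite by (intro fmeasurableI) (auto simp: borel_closed)

lemma fmeasurable_far_subset:
  assumes "\<delta> > 0" "A \<subseteq> - ball 0 \<delta>" "A \<in> sets borel"
  shows "A \<in> fmeasurable \<nu>"
  using fmeasurableI2[OF fmeasurable_far[OF assms(1)] assms(2)] assms(3) by simp

lemma fmeasurable_paraboloid:
  assumes "\<delta> \<le> 1" "r > 0" "norm e = 1"
  shows "paraboloid_set \<delta> r e \<in> fmeasurable \<nu>"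
proof -
  have "paraboloid_set 1 r e \<in> fmeasurable \<nu>"
    using A3 assms by (intro fmeasurableI) (auto simp: singular_measure_def)
  then show ?thesis
    by (rule fmeasurableI2) (use paraboloid_set_mono[OF assms(1) order_refl] in auto)
qed

lemma fmeasurable_near:
  assumes "p \<noteq> 0" "h > 0" "\<delta> \<le> 1"
  shows "near_set \<delta> h p \<in> fmeasurable \<nu>"
proof -
  define r where "r = norm p / (2 * h)"
  have r: "r > 0" using assms by (simp add: r_def)
  have "paraboloid_set \<delta> r (sgn p) \<union> - ball 0 r \<in> fmeasurable \<nu>"
    using assms r by (intro fmeasurable.Un fmeasurable_paraboloid fmeasurable_far) (auto simp: norm_sgn)
  then show ?thesis
    by (rule fmeasurableI2) (use near_set_subset_Un[of p h r \<delta>] assms r_def in auto)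
qed

text \<open>With r = |p|/(2h) the factor |p| is 2hr, and r times the mass of each piece in
  \<open>near_set_subset_Un\<close> is below e/4. No lower bound on |p| enters, so the estimate
  survives gradients tending to 0.\<close>

lemma near_measure_small:
  assumes "e > 0"
  obtains \<rho> where "\<rho> > 0"
    "\<And>p h. p \<noteq> 0 \<Longrightarrow> h > 0 \<Longrightarrow> norm p \<le> \<rho> * h \<Longrightarrow> norm p * measure \<nu> (near_set 1 h p) \<le> e * h"
    "\<And>p :: 'a. norm p \<le> \<rho> \<Longrightarrow> norm p * measure \<nu> (- ball 0 1) \<le> e"
proof -
  have lim: "((\<lambda>\<delta>. \<delta> * measure \<nu> (- ball 0 \<delta>)) \<longlongrightarrow> 0) (at_right 0)"
    "uniform_limit (sphere 0 1) (\<lambda>r e. r * measure \<nu> (paraboloid_set 1 r e)) (\<lambda>_. 0) (at_right 0)"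
    using A3 by (auto simp: singular_measure_def)
  have e4: "e / 4 > 0" using assms by simp
  have "\<forall>\<^sub>F \<delta> in at_right 0. dist (\<delta> * measure \<nu> (- ball 0 \<delta>)) 0 < e / 4"
    by (rule tendstoD[OF lim(1) e4])
  moreover have "\<forall>\<^sub>F r in at_right 0. \<forall>a\<in>sphere 0 1. dist (r * measure \<nu> (paraboloid_set 1 r a)) 0 < e / 4"
    by (rule uniform_limitD[OF lim(2) e4])
  ultimately have "\<forall>\<^sub>F r in at_right 0. dist (r * measure \<nu> (- ball 0 r)) 0 < e / 4 \<and>
     (\<forall>a\<in>sphere 0 1. dist (r * measure \<nu> (paraboloid_set 1 r a)) 0 < e / 4)"
    by (rule eventually_conj)
  then obtain b where b: "b > 0" "\<And>r. 0 < r \<Longrightarrow> r < b \<Longrightarrow> r * measure \<nu> (- ball 0 r) < e / 4"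
    "\<And>r a. 0 < r \<Longrightarrow> r < b \<Longrightarrow> norm a = 1 \<Longrightarrow> r * measure \<nu> (paraboloid_set 1 r a) < e / 4"
    unfolding eventually_at_right_field by (force simp: dist_real_def)
  define m where "m = measure \<nu> (- ball 0 1)"
  show ?thesis
  proof
    show "min b (e / (m + 1)) > 0" using b(1) assms by (simp add: m_def add_nonneg_pos)
    fix p :: 'a
    show "norm p * measure \<nu> (- ball 0 1) \<le> e" if "norm p \<le> min b (e / (m + 1))"
    proof -
      have "0 \<le> m" by (simp add: m_def)
      then have "norm p * m \<le> e / (m + 1) * (m + 1)"
        using that assms by (intro mult_mono) simp_all
      also have "\<dots> = e"
        using \<open>0 \<le> m\<close> by simp
      finally show ?thesis by (simp add: m_def)
    qed
    fix h :: real
    assume p: "p \<noteq> 0" and h: "h > 0" and ph: "norm p \<le> min b (e / (m + 1)) * h"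
    define r where "r = norm p / (2 * h)"
    have pbh: "norm p \<le> b * h" using ph h by (smt (verit) mult_right_mono)
    have r: "0 < r" "r < b"
    proof -
      show "0 < r" using p h by (simp add: r_def)
      have "norm p < 2 * (b * h)" using pbh b(1) h by (smt (verit) mult_pos_pos)
      then show "r < b" using h by (simp add: r_def field_simps)
    qed
    have "measure \<nu> (near_set 1 h p) \<le> measure \<nu> (paraboloid_set 1 r (sgn p) \<union> - ball 0 r)"
      using near_set_subset_Un[OF p h, of r 1] p r
      by (intro measure_mono_fmeasurable)
         (auto simp: r_def intro!: fmeasurable.Un fmeasurable_paraboloid fmeasurable_far simp: norm_sgn)
    also have "\<dots> \<le> measure \<nu> (paraboloid_set 1 r (sgn p)) + measure \<nu> (- ball 0 r)"
      using p r by (intro measure_Un_le) (auto simp: borel_closed)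
    finally have "r * measure \<nu> (near_set 1 h p) \<le> r * (measure \<nu> (paraboloid_set 1 r (sgn p)) + measure \<nu> (- ball 0 r))"
      using r by (intro mult_left_mono) auto
    also have "\<dots> \<le> e / 4 + e / 4"
      using b(2)[OF r] b(3)[OF r, of "sgn p"] p by (simp add: norm_sgn distrib_left)
    finally show "norm p * measure \<nu> (near_set 1 h p) \<le> e * h"
      using h by (simp add: r_def field_simps)
  qed
qed

text \<open>A crude bound valid for every gradient. Beyond the threshold \<rho>h the mass itself is
  at most 1/\<rho>, so the product grows only linearly in |p|.\<close>

lemma near_measure_bound:
  obtains C where "C \<ge> 0"
    "\<And>p h. p \<noteq> 0 \<Longrightarrow> h > 0 \<Longrightarrow> norm p * measure \<nu> (near_set 1 h p) \<le> C * (h + norm p)"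
proof -
  obtain \<rho> where \<rho>: "\<rho> > 0"
    "\<And>p h. p \<noteq> 0 \<Longrightarrow> h > 0 \<Longrightarrow> norm p \<le> \<rho> * h \<Longrightarrow> norm p * measure \<nu> (near_set 1 h p) \<le> 1 * h"
    by (rule near_measure_small[of 1]) auto
  show ?thesis
  proof
    show "1 + 1 / \<rho> \<ge> 0" using \<rho>(1) by simp
    fix p :: 'a and h :: real
    assume p: "p \<noteq> 0" and h: "h > 0"
    show "norm p * measure \<nu> (near_set 1 h p) \<le> (1 + 1 / \<rho>) * (h + norm p)"
    proof (cases "norm p \<le> \<rho> * h")
      case True
      then have "norm p * measure \<nu> (near_set 1 h p) \<le> h" using \<rho>(2) p h by fastforce
      also have "\<dots> \<le> (1 + 1 / \<rho>) * (h + norm p)" using \<rho>(1) h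
        by (simp add: distrib_left distrib_right add_nonneg_nonneg)
      finally show ?thesis .
    next
      case False
      text \<open>Scaling \<open>p\<close> down to the threshold enlarges the set.\<close>
      define l where "l = \<rho> * h / norm p"
      have l: "0 < l" "l \<le> 1" using False \<rho>(1) h p by (auto simp: l_def field_simps)
      have "near_set 1 h p \<subseteq> near_set 1 h (l *\<^sub>R p)"
        using l by (auto simp: near_set_def abs_mult intro: order_trans[OF mult_left_le_one_le])
      then have "measure \<nu> (near_set 1 h p) \<le> measure \<nu> (near_set 1 h (l *\<^sub>R p))"
        using p l h by (intro measure_mono_fmeasurable fmeasurable_near) auto
      moreover have ln: "norm (l *\<^sub>R p) = \<rho> * h" using \<rho>(1) h p by (simp add: l_def)
      moreover have "norm (l *\<^sub>R p) * measure \<nu> (near_set 1 h (l *\<^sub>R p)) \<le> h"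
        using \<rho>(2)[of "l *\<^sub>R p" h] p l h ln by simp
      ultimately have "\<rho> * h * measure \<nu> (near_set 1 h p) \<le> \<rho> * h * measure \<nu> (near_set 1 h (l *\<^sub>R p))"
        "\<rho> * h * measure \<nu> (near_set 1 h (l *\<^sub>R p)) \<le> h"
        using \<rho>(1) h by (auto intro: mult_left_mono)
      then have "\<rho> * h * measure \<nu> (near_set 1 h p) \<le> h" by (rule order_trans)
      then have "measure \<nu> (near_set 1 h p) \<le> 1 / \<rho>" using \<rho>(1) h by (simp add: field_simps)
      then have "norm p * measure \<nu> (near_set 1 h p) \<le> norm p * (1 / \<rho>)" by (intro mult_left_mono) auto
      also have "\<dots> \<le> (1 + 1 / \<rho>) * (h + norm p)" using \<rho>(1) h
        by (simp add: distrib_left distrib_right add_nonneg_nonneg)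
      finally show ?thesis .
    qed
  qed
qed

end

section \<open>The viscosity inequality with the solution itself at large jumps\<close>

context levy
begin

text \<open>By semicontinuity the set \<open>W\<close> of jumps that lower \<open>u\<close> is open,
  hence exhausted by compact sets \<open>C n\<close>, and for each of them there is a test function
  below the touching value on \<open>C n\<close>. In the far region its positive curvature set
  avoids \<open>C n\<close> and its negative one contains \<open>F \<inter> H \<inter> C n\<close>.
  Monotone limits of finite masses replace \<open>C n\<close> by \<open>W\<close>.\<close>

lemma viscosity_subsolution_nonlocal:
  fixes u :: "real \<times> 'a \<Rightarrow> real"
  assumes sub: "viscosity_subsolution \<mu> c \<nu> u" and t: "t > 0" and maj: "majorized u t x a A p h"
    and \<mu>: "\<forall>e\<in>sphere 0 1. 0 < \<mu> e" and h: "h > 0" and \<delta>: "0 < \<delta>" "\<delta> \<le> 1"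
  shows "a \<le> sig \<mu> p * (c x + (measure \<nu> (near_set \<delta> h p)
     + measure \<nu> {z \<in> - ball 0 \<delta>. u (t, x) \<le> u (t, x + z)}
     - measure \<nu> {z \<in> - ball 0 \<delta>. 0 < p \<bullet> z}))"
proof (cases "p = 0")
  case True
  have "\<forall>z\<in>{}. u (t, x + z) < u (t, x)" by simp
  then have "a \<le> 0"
    using viscosity_subsolution_test[OF sub t maj compact_empty] True by (metis (full_types))
  then show ?thesis by (simp add: True sig_def)
next
  case False
  have np: "norm p > 0" using False by simp
  have \<mu>p: "\<mu> (sgn p) > 0" using \<mu> False by (simp add: norm_sgn)
  define F where "F = - ball (0::'a) \<delta>"
  define W where "W = {z. u (t, x + z) < u (t, x)}"
  have F [measurable]: "F \<in> sets borel" "closed F" by (auto simp: F_def borel_closed)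
  have far: "A \<in> fmeasurable \<nu>" if "A \<subseteq> F" "A \<in> sets borel" for A
    using fmeasurable_far_subset[OF \<delta>(1)] that by (auto simp: F_def)
  have usc: "usc_on ({0..} \<times> UNIV) u" using sub by (simp add: viscosity_subsolution_def)
  have W: "open W"
    unfolding open_dist
  proof
    fix z assume "z \<in> W"
    then obtain r where r: "r > 0" "\<And>y. y \<in> {0..} \<times> UNIV \<Longrightarrow> dist y (t, x + z) < r \<Longrightarrow> u y < u (t, x)"
      using usc_on_ball[OF usc, of "(t, x + z)" "u (t, x)"] t by (auto simp: W_def)
    have "y \<in> W" if "dist y z < r" for y
      using r(2)[of "(t, x + y)"] that t by (simp add: W_def dist_Pair_Pair)
    then show "\<exists>e>0. \<forall>y. dist y z < e \<longrightarrow> y \<in> W" using r(1) by blast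
  qed
  then obtain C where C: "\<And>n. compact (C n)" "\<And>n. C n \<subseteq> W" "\<And>n. C n \<subseteq> interior (C (Suc n))"
    "(\<Union>n. C n) = W"
    using open_Union_compact_subsets by metis
  have C_mono: "incseq C" using C(3) interior_subset by (intro incseq_SucI) blast
  define H where "H = {z. 0 < p \<bullet> z}"
  have Hb [measurable]: "H \<in> sets borel" "W \<in> sets borel" "\<And>n. C n \<in> sets borel"
    using W C(1) unfolding H_def
    by (auto intro!: borel_open open_Collect_less continuous_intros borel_compact)
  define N where "N = measure \<nu> (near_set \<delta> h p)"
  have step: "a \<le> sig \<mu> p * (c x + (N + measure \<nu> (F - H - C n) - measure \<nu> (F \<inter> H \<inter> C n)))" for n
  proof -
    obtain \<psi> where \<psi>: "continuous_on UNIV \<psi>" "\<psi> x = u (t, x)"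
      "\<And>z. u (t, x) \<le> \<psi> (x + z) \<Longrightarrow> 0 \<le> p \<bullet> z + h * (norm z)\<^sup>2"
      "\<And>z. z \<in> C n \<Longrightarrow> \<psi> (x + z) < u (t, x)" "gradient \<psi> x = p"
      "\<exists>r>0. \<forall>z. norm z < r \<longrightarrow> \<psi> (x + z) = u (t, x) + p \<bullet> z + h * (norm z)\<^sup>2"
      "if p \<noteq> 0 then a \<le> \<mu> (sgn p) * (c x + kappa_upper \<nu> x \<psi>) * norm p else a \<le> 0"
      by (rule viscosity_subsolution_test[OF sub t maj C(1)[of n]]) (use C(2) in \<open>auto simp: W_def\<close>)
    have \<psi>c: "continuous_on UNIV (\<lambda>z. \<psi> (x + z))"
      by (rule continuous_on_compose2[OF \<psi>(1)]) (auto intro!: continuous_intros)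
    have up: "measure \<nu> {z. \<psi> (x + z) \<ge> \<psi> x \<and> gradient \<psi> x \<bullet> z \<le> 0} \<le> N + measure \<nu> (F - H - C n)"
    proof -
      \<comment> \<open>If \<psi> is not lowered by the jump, then 0 <= p . z + h |z|^2; together
        with p . z <= 0 this is the defining inequality of \<open>near_set\<close>.\<close>
      have sub: "{z. \<psi> (x + z) \<ge> \<psi> x \<and> gradient \<psi> x \<bullet> z \<le> 0} \<subseteq> near_set \<delta> h p \<union> (F - H - C n)"
        using \<psi>(3,4) by (force simp: \<psi>(2,5) near_set_def F_def H_def)
      have "{z. \<psi> (x + z) \<ge> \<psi> x \<and> gradient \<psi> x \<bullet> z \<le> 0} \<in> sets borel"
        by (intro borel_closed closed_Collect_conj closed_Collect_le \<psi>c continuous_intros)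
      then have "measure \<nu> {z. \<psi> (x + z) \<ge> \<psi> x \<and> gradient \<psi> x \<bullet> z \<le> 0}
          \<le> measure \<nu> (near_set \<delta> h p \<union> (F - H - C n))"
        using sub
        by (intro measure_mono_fmeasurable fmeasurable.Un fmeasurable_near far) (auto simp: False h \<delta>)
      also have "\<dots> \<le> N + measure \<nu> (F - H - C n)"
        unfolding N_def by (rule measure_Un_le) auto
      finally show ?thesis .
    qed
    have lo: "measure \<nu> (F \<inter> H \<inter> C n) \<le> measure \<nu> {z. \<psi> (x + z) < \<psi> x \<and> gradient \<psi> x \<bullet> z > 0}"
    proof (rule measure_mono_fmeasurable)
      show "F \<inter> H \<inter> C n \<subseteq> {z. \<psi> (x + z) < \<psi> x \<and> gradient \<psi> x \<bullet> z > 0}"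
        using \<psi>(4) by (auto simp: \<psi>(2,5) H_def)
      have "{z. \<psi> (x + z) < \<psi> x \<and> gradient \<psi> x \<bullet> z > 0} \<in> sets borel"
        by (intro borel_open open_Collect_conj open_Collect_less \<psi>c continuous_intros)
      \<comment> \<open>Near x the test function is still its paraboloid with h > 0, so p . z > 0
        excludes a decrease. The set therefore stays away from the origin and has finite
        mass.\<close>
      moreover obtain r where r: "r > 0" "\<And>z. norm z < r \<Longrightarrow> \<psi> (x + z) = u (t, x) + p \<bullet> z + h * (norm z)\<^sup>2"
        using \<psi>(6) by blast
      have "{z. \<psi> (x + z) < \<psi> x \<and> gradient \<psi> x \<bullet> z > 0} \<subseteq> - ball 0 r"
      proof
        fix z assume z: "z \<in> {z. \<psi> (x + z) < \<psi> x \<and> gradient \<psi> x \<bullet> z > 0}"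
        have "0 \<le> h * (norm z)\<^sup>2" using h by simp
        then have "\<not> norm z < r" using r(2)[of z] z by (auto simp: \<psi>(2,5))
        then show "z \<in> - ball 0 r" by simp
      qed
      ultimately show "{z. \<psi> (x + z) < \<psi> x \<and> gradient \<psi> x \<bullet> z > 0} \<in> fmeasurable \<nu>"
        by (intro fmeasurable_far_subset[OF r(1)])
    qed auto
    have "kappa_upper \<nu> x \<psi> \<le> N + measure \<nu> (F - H - C n) - measure \<nu> (F \<inter> H \<inter> C n)"
      using up lo unfolding kappa_upper_def by linarith
    then have "\<mu> (sgn p) * norm p * (c x + kappa_upper \<nu> x \<psi>)
        \<le> \<mu> (sgn p) * norm p * (c x + (N + measure \<nu> (F - H - C n) - measure \<nu> (F \<inter> H \<inter> C n)))"
      using \<mu>p np by (intro mult_left_mono) auto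
    moreover have "a \<le> \<mu> (sgn p) * norm p * (c x + kappa_upper \<nu> x \<psi>)"
      using \<psi>(7) False by (simp add: mult_ac)
    ultimately show ?thesis unfolding sig_def by (rule order_trans[rotated])
  qed
  have fin: "emeasure \<nu> A \<noteq> \<infinity>" if "A \<subseteq> F" "A \<in> sets borel" for A
    using far[OF that] by (auto simp: fmeasurable_def)
  have lim1: "(\<lambda>n. measure \<nu> (F \<inter> H \<inter> C n)) \<longlonglongrightarrow> measure \<nu> (\<Union>n. F \<inter> H \<inter> C n)"
  proof (rule Lim_measure_incseq)
    show "emeasure \<nu> (\<Union>n. F \<inter> H \<inter> C n) \<noteq> \<infinity>" by (rule fin) auto
  qed (use C_mono in \<open>auto simp: incseq_def\<close>)
  have lim2: "(\<lambda>n. measure \<nu> (F - H - C n)) \<longlonglongrightarrow> measure \<nu> (\<Inter>n. F - H - C n)"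
  proof (rule Lim_measure_decseq)
    show "emeasure \<nu> (F - H - C n) \<noteq> \<infinity>" for n by (rule fin) auto
  qed (use C_mono in \<open>auto simp: incseq_def decseq_def\<close>)
  have h1: "a \<le> sig \<mu> p * (c x + (N + measure \<nu> (\<Inter>n. F - H - C n) - measure \<nu> (\<Union>n. F \<inter> H \<inter> C n)))"
  proof (rule LIMSEQ_le_const[rotated])
    show "\<exists>n0. \<forall>n\<ge>n0. a \<le> sig \<mu> p * (c x + (N + measure \<nu> (F - H - C n) - measure \<nu> (F \<inter> H \<inter> C n)))"
      using step by blast
  qed (intro tendsto_intros lim1 lim2)
  have e1: "(\<Inter>n. F - H - C n) = (F - H) - W" "(\<Union>n. F \<inter> H \<inter> C n) = F \<inter> H \<inter> W"
    using C(4) by auto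
  \<comment> \<open>Each term on the left is completed by the mass of
    \<open>F \<inter> H - W\<close>, which is finite because everything lies in
    \<open>F\<close>.\<close>
  have "measure \<nu> (F - H - W) - measure \<nu> (F \<inter> H \<inter> W) = measure \<nu> (F - W) - measure \<nu> (F \<inter> H)"
  proof -
    have "measure \<nu> ((F - H - W) \<union> (F \<inter> H - W)) = measure \<nu> (F - H - W) + measure \<nu> (F \<inter> H - W)"
    proof -
      have "(F \<inter> H - W) - (F - H - W) = F \<inter> H - W" by auto
      then show ?thesis using measure_Un2[OF far far, of "F - H - W" "F \<inter> H - W"] by auto
    qed
    moreover have "measure \<nu> ((F \<inter> H - W) \<union> (F \<inter> H \<inter> W)) = measure \<nu> (F \<inter> H - W) + measure \<nu> (F \<inter> H \<inter> W)"
    proof -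
      have "(F \<inter> H \<inter> W) - (F \<inter> H - W) = F \<inter> H \<inter> W" by auto
      then show ?thesis using measure_Un2[OF far far, of "F \<inter> H - W" "F \<inter> H \<inter> W"] by auto
    qed
    moreover have "(F - H - W) \<union> (F \<inter> H - W) = F - W" "(F \<inter> H - W) \<union> (F \<inter> H \<inter> W) = F \<inter> H" by auto
    ultimately show ?thesis by simp
  qed
  then have "N + measure \<nu> (F - H - W) - measure \<nu> (F \<inter> H \<inter> W) = N + measure \<nu> (F - W) - measure \<nu> (F \<inter> H)"
    by linarith
  then have "a \<le> sig \<mu> p * (c x + (N + measure \<nu> (F - W) - measure \<nu> (F \<inter> H)))"
    using h1 unfolding e1 by (simp only:)
  moreover have "F - W = {z \<in> - ball 0 \<delta>. u (t, x) \<le> u (t, x + z)}" "F \<inter> H = {z \<in> - ball 0 \<delta>. 0 < p \<bullet> z}"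
    by (auto simp: F_def W_def H_def)
  ultimately show ?thesis by (simp only: N_def)
qed

end

text \<open>Negation exchanges minima with maxima, reverses the gradient (whence \<mu>(-e)), and
  turns \<open>kappa_lower\<close> into minus \<open>kappa_upper\<close>. Estimates for
  \<open>v\<close> thereby follow from those for subsolutions.\<close>

lemma subsolution_uminus:
  assumes "viscosity_supersolution \<mu> c \<nu> v"
  shows "viscosity_subsolution (\<lambda>e. \<mu> (- e)) (\<lambda>x. - c x) \<nu> (\<lambda>\<xi>. - v \<xi>)"
  unfolding viscosity_subsolution_def
proof (intro conjI allI impI)
  show "usc_on ({0..} \<times> UNIV) (\<lambda>\<xi>. - v \<xi>)"
    unfolding usc_on_def
  proof (intro ballI allI impI)
    fix \<xi> :: "real \<times> 'a" and r assume "\<xi> \<in> {0..} \<times> UNIV" "- v \<xi> < r"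
    then have "\<forall>\<^sub>F y in at \<xi> within {0..} \<times> UNIV. - r < v y"
      using assms by (auto simp: viscosity_supersolution_def lsc_on_def minus_less_iff)
    then show "\<forall>\<^sub>F y in at \<xi> within {0..} \<times> UNIV. - v y < r"
      by (rule eventually_mono) simp
  qed
  fix \<phi> :: "real \<times> 'a \<Rightarrow> real" and t x
  assume asm: "smooth \<phi> \<and> t > 0 \<and> - v (t, x) - \<phi> (t, x) = 0 \<and>
    (\<forall>s\<ge>0. \<forall>y. - v (s, y) - \<phi> (s, y) \<le> 0)"
  define p where "p = gradient (\<lambda>y. \<phi> (t, y)) x"
  have "smooth \<phi>" using asm by blast
  from gradient_GDERIV[OF this] have G: "GDERIV (\<lambda>y. \<phi> (t, y)) x :> p" unfolding p_def .
  then have G': "gradient (\<lambda>y. - \<phi> (t, y)) x = - p"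
    by (intro gradient_eqI GDERIV_minus)
  have "((\<lambda>s. \<phi> (s, x)) has_derivative (\<lambda>h. frechet_derivative \<phi> (at (t, x)) (h, 0))) (at t)"
    using asm by (intro has_derivative_compose[OF has_derivative_Pair[OF has_derivative_ident has_derivative_const]
        smooth_has_derivative]) auto
  then have "(\<lambda>s. \<phi> (s, x)) differentiable (at t)" by (auto simp: differentiable_def)
  then have "(\<lambda>s. \<phi> (s, x)) field_differentiable (at t)"
    by (simp add: real_differentiable_def field_differentiable_def)
  then have d: "deriv (\<lambda>s. - \<phi> (s, x)) t = - deriv (\<lambda>s. \<phi> (s, x)) t" by (rule deriv_minus)
  have k: "kappa_lower \<nu> x (\<lambda>y. - \<phi> (t, y)) = - kappa_upper \<nu> x (\<lambda>y. \<phi> (t, y))"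
    unfolding kappa_lower_def kappa_upper_def G' p_def[symmetric] by simp
  note sup = assms[unfolded viscosity_supersolution_def, THEN conjunct2]
  have "smooth (\<lambda>\<xi>. - \<phi> \<xi>) \<and> t > 0 \<and> v (t, x) - - \<phi> (t, x) = 0 \<and>
    (\<forall>s\<ge>0. \<forall>y. v (s, y) - - \<phi> (s, y) \<ge> 0)"
  proof (intro conjI allI impI)
    fix s y assume "0 \<le> (s::real)"
    then have "- v (s, y) - \<phi> (s, y) \<le> 0" using asm by blast
    then show "v (s, y) - - \<phi> (s, y) \<ge> 0" by simp
  qed (use asm in auto)
  from sup[THEN spec, THEN spec, THEN spec, THEN mp, OF this]
  have "let q = gradient (\<lambda>y. - \<phi> (t, y)) x in
     if q \<noteq> 0
     then deriv (\<lambda>s. - \<phi> (s, x)) t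
       \<ge> \<mu> (sgn q) * (c x + kappa_lower \<nu> x (\<lambda>y. - \<phi> (t, y))) * norm q
     else deriv (\<lambda>s. - \<phi> (s, x)) t \<ge> 0" .
  then show "let p = gradient (\<lambda>y. \<phi> (t, y)) x in
         if p \<noteq> 0
         then deriv (\<lambda>s. \<phi> (s, x)) t
                \<le> \<mu> (- sgn p) * (- c x + kappa_upper \<nu> x (\<lambda>y. \<phi> (t, y))) * norm p
         else deriv (\<lambda>s. \<phi> (s, x)) t \<le> 0"
    unfolding Let_def p_def[symmetric] d k G'
    by (auto simp: sgn_minus algebra_simps split: if_splits)
qed

section \<open>The homogeneous speed function\<close>

lemma sig_0 [simp]: "sig \<mu> 0 = 0"
  by (simp add: sig_def)

lemma sig_scaleR: "0 \<le> l \<Longrightarrow> sig \<mu> (l *\<^sub>R p) = l * sig \<mu> p"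
  by (cases "l = 0") (auto simp: sig_def sgn_scaleR)

locale speed =
  fixes \<mu> :: "'a::euclidean_space \<Rightarrow> real"
  assumes cont_mu: "continuous_on (sphere 0 1) \<mu>"
    and mu_pos: "\<forall>e\<in>sphere 0 1. 0 < \<mu> e"
begin

lemma sig_nonneg: "0 \<le> sig \<mu> p"
  using mu_pos by (cases "p = 0") (auto simp: sig_def norm_sgn less_imp_le)

lemma sig_bound: obtains M where "M > 0" "\<And>p. sig \<mu> p \<le> M * norm p"
proof -
  have "bounded (\<mu> ` sphere 0 1)"
    using cont_mu compact_continuous_image compact_imp_bounded compact_sphere by blast
  then obtain M where M: "M > 0" "\<And>e. e \<in> sphere 0 1 \<Longrightarrow> \<bar>\<mu> e\<bar> \<le> M" unfolding bounded_pos by auto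
  show ?thesis
  proof (rule that[OF M(1)])
    fix p
    show "sig \<mu> p \<le> M * norm p"
    proof (cases "p = 0")
      case False
      then have "\<mu> (sgn p) \<le> M" using M(2)[of "sgn p"] by (auto simp: norm_sgn)
      then show ?thesis unfolding sig_def by (intro mult_right_mono) auto
    qed simp
  qed
qed

lemma continuous_sig: "continuous_on UNIV (sig \<mu>)"
  unfolding continuous_on_eq_continuous_at[OF open_UNIV]
proof
  fix p :: 'a
  show "isCont (sig \<mu>) p"
  proof (cases "p = 0")
    case True
    obtain M where M: "M > 0" "\<And>p. sig \<mu> p \<le> M * norm p" using sig_bound by blast
    have "(sig \<mu> \<longlongrightarrow> 0) (at 0)"
    proof (rule tendsto_sandwich[of "\<lambda>_. 0" _ _ "\<lambda>p. M * norm p"])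
      have "isCont (\<lambda>p::'a. M * norm p) 0" by (intro continuous_intros)
      then show "((\<lambda>p::'a. M * norm p) \<longlongrightarrow> 0) (at 0)" by (simp add: isCont_def)
    qed (auto simp: sig_nonneg M(2))
    then show ?thesis by (simp add: True isCont_def)
  next
    case False
    have "continuous_on (- {0}) (\<lambda>p::'a. sgn p)"
      by (auto simp: sgn_div_norm intro!: continuous_intros)
    then have "continuous_on (- {0}) (\<lambda>p. \<mu> (sgn p))"
      by (rule continuous_on_compose2[OF cont_mu]) (auto simp: norm_sgn split: if_split_asm)
    then have "continuous_on (- {0}) (sig \<mu>)"
      unfolding sig_def by (intro continuous_intros)
    then show ?thesis using False
      by (simp add: continuous_on_eq_continuous_at open_Compl)
  qed
qed

lemma sig_uniformly_continuous:
  assumes "e > 0"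
  obtains d where "d > 0" "\<And>p q. norm p \<le> R \<Longrightarrow> norm (q - p) < d \<Longrightarrow> \<bar>sig \<mu> q - sig \<mu> p\<bar> < e"
proof -
  have "uniformly_continuous_on (cball 0 (R + 1)) (sig \<mu>)"
    using continuous_sig continuous_on_subset compact_uniformly_continuous compact_cball by blast
  then obtain d where d: "d > 0" "\<And>p q. p \<in> cball 0 (R + 1) \<Longrightarrow> q \<in> cball 0 (R + 1) \<Longrightarrow> dist q p < d
      \<Longrightarrow> dist (sig \<mu> q) (sig \<mu> p) < e"
    using assms unfolding uniformly_continuous_on_def by metis
  show ?thesis
  proof (rule that[of "min d 1"])
    show "min d 1 > 0" using d by simp
    fix p q :: 'a assume "norm p \<le> R" "norm (q - p) < min d 1"
    then show "\<bar>sig \<mu> q - sig \<mu> p\<bar> < e"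
      using d(2)[of p q] norm_triangle_sub[of q p] by (auto simp: dist_norm)
  qed
qed

text \<open>By homogeneity unit vectors suffice; there \<open>sig\<close> is uniformly continuous
  and at least m > 0, so a small absolute error is a small relative one. The exponential form
  matches the ratio s/t, which is bounded away from 1 by factors exp(\<beta>/2) and
  exp(-\<beta>/2).\<close>

lemma sig_relative_perturbation:
  assumes "b > 0"
  obtains \<theta> where "\<theta> > 0" "\<And>p w. norm w \<le> \<theta> * norm p \<Longrightarrow> sig \<mu> (p + w) \<le> exp b * sig \<mu> p"
    "\<And>p w. norm w \<le> \<theta> * norm p \<Longrightarrow> exp (- b) * sig \<mu> p \<le> sig \<mu> (p + w)"
proof -
  obtain m where m: "m > 0" "\<And>e. norm e = 1 \<Longrightarrow> m \<le> sig \<mu> e"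
  proof -
    obtain e0 :: 'a where e0: "e0 \<in> sphere 0 1" using vector_choose_size[of 1] by auto
    obtain e1 where e1: "e1 \<in> sphere 0 1" "\<forall>e\<in>sphere 0 1. \<mu> e1 \<le> \<mu> e"
      using continuous_attains_inf[OF compact_sphere _ cont_mu] e0 by blast
    have "\<mu> e1 \<le> sig \<mu> e" if "norm e = 1" for e
    proof -
      have "sgn e = e" using that by (simp add: sgn_div_norm)
      then show ?thesis using e1 that by (simp add: sig_def)
    qed
    then show ?thesis using that[of "\<mu> e1"] mu_pos e1 by blast
  qed
  define k where "k = m * (1 - exp (- b))"
  have k: "k > 0" using m assms by (simp add: k_def)
  obtain d where d: "d > 0" "\<And>p q. norm p \<le> 1 \<Longrightarrow> norm (q - p) < d \<Longrightarrow> \<bar>sig \<mu> q - sig \<mu> p\<bar> < k"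
    using sig_uniformly_continuous[OF k] by blast
  have main: "\<bar>sig \<mu> (p + w) - sig \<mu> p\<bar> \<le> (1 - exp (- b)) * sig \<mu> p" if w: "norm w \<le> d / 2 * norm p" for p w
  proof (cases "p = 0")
    case True
    then show ?thesis using w by simp
  next
    case False
    define l where "l = norm p"
    have l: "l > 0" using False by (simp add: l_def)
    define p' w' where "p' = p /\<^sub>R l" and "w' = w /\<^sub>R l"
    have p: "p = l *\<^sub>R p'" "w = l *\<^sub>R w'" and np: "norm p' = 1"
      using l by (auto simp: p'_def w'_def) (simp add: l_def)
    have "norm w' \<le> d / 2" using w l d(1) by (simp add: w'_def l_def[symmetric] field_simps)
    then have "norm w' < d" using d(1) by linarith
    then have "\<bar>sig \<mu> (p' + w') - sig \<mu> p'\<bar> < k" using d(2)[of p' "p' + w'"] np by simp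
    also have "k \<le> (1 - exp (- b)) * sig \<mu> p'"
      using m(2)[OF np] assms by (simp add: k_def mult.commute mult_right_mono)
    finally have "l * \<bar>sig \<mu> (p' + w') - sig \<mu> p'\<bar> \<le> l * ((1 - exp (- b)) * sig \<mu> p')"
      using l by (intro mult_left_mono) auto
    moreover have "sig \<mu> (p + w) = l * sig \<mu> (p' + w')" "sig \<mu> p = l * sig \<mu> p'"
      using l by (simp_all add: p scaleR_add_right[symmetric] sig_scaleR del: scaleR_add_right)
    ultimately show ?thesis using l
      by (simp add: right_diff_distrib[symmetric] abs_mult mult.left_commute)
  qed
  \<comment> \<open>The relative error 1 - exp(-b) is exact for the lower bound; this inequality
    makes it suffice for the upper one.\<close>
  have exp_b: "1 - exp (- b) \<le> exp b - 1"
  proof -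
    have "2 \<le> exp b + exp (- b)"
      using exp_ge_add_one_self[of b] exp_ge_add_one_self[of "- b"] by linarith
    then show ?thesis by linarith
  qed
  show ?thesis
  proof (rule that[of "d / 2"])
    fix p w :: 'a assume w: "norm w \<le> d / 2 * norm p"
    have "(1 - exp (- b)) * sig \<mu> p \<le> (exp b - 1) * sig \<mu> p"
      using exp_b sig_nonneg by (intro mult_right_mono) auto
    then show "sig \<mu> (p + w) \<le> exp b * sig \<mu> p" "exp (- b) * sig \<mu> p \<le> sig \<mu> (p + w)"
      using main[OF w] by (auto simp: algebra_simps abs_le_iff)
  qed (use d in auto)
qed

end

section \<open>Translations and mollification\<close>

lemma lborel_integral_shift:
  fixes f :: "'a::euclidean_space \<Rightarrow> real"
  assumes "f \<in> borel_measurable borel"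
  shows "(\<integral>x. f (x + h) \<partial>lborel) = (\<integral>x. f x \<partial>lborel)"
proof -
  have "(\<integral>x. f x \<partial>distr lborel borel ((+) h)) = (\<integral>x. f (h + x) \<partial>lborel)"
    by (rule integral_distr) (use assms in auto)
  then show ?thesis by (simp add: lborel_distr_plus add.commute)
qed

lemma lborel_integrable_shift:
  fixes f :: "'a::euclidean_space \<Rightarrow> real"
  assumes "integrable lborel f"
  shows "integrable lborel (\<lambda>x. f (x + h))"
proof -
  have "integrable (distr lborel borel ((+) h)) f" using assms by (simp add: lborel_distr_plus)
  then have "integrable lborel (\<lambda>x. f (h + x))"
    by (subst (asm) integrable_distr_eq) (use assms in auto)
  then show ?thesis by (simp add: add.commute)
qed

text \<open>Squeeze \<open>A\<close> between a compact \<open>K\<close> and an open \<open>U\<close>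
  of nearly equal measure. A shift shorter than the distance from \<open>K\<close> to the complement
  of \<open>U\<close> keeps \<open>K\<close> inside \<open>U\<close>.\<close>

lemma integral_abs_indicator_shift_small:
  fixes A :: "'a::euclidean_space set"
  assumes A: "A \<in> sets borel" "emeasure lborel A < \<infinity>" and e: "e > 0"
  shows "\<exists>d>0. \<forall>h. norm h < d \<longrightarrow> (\<integral>x. \<bar>indicator A (x + h) - indicator A x :: real\<bar> \<partial>lborel) \<le> e"
proof -
  \<comment> \<open>Lebesgue measure restricted to \<open>A\<close>: inner regularity is applied to
    a finite measure.\<close>
  define M where "M = density lborel (indicator A :: 'a \<Rightarrow> ennreal)"
  have M: "emeasure M B = emeasure lborel B" if "B \<subseteq> A" "B \<in> sets borel" for B
    using that A by (simp add: M_def emeasure_density nn_integral_set_ennreal flip: indicator_inter_arith)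
      (simp add: Int_absorb1 Int_absorb2)
  have fin: "emeasure M (space M) \<noteq> \<infinity>"
    using A by (simp add: M_def emeasure_density)
  have "emeasure M A = (SUP K \<in> {K. K \<subseteq> A \<and> compact K}. emeasure M K)"
    by (rule inner_regular) (use A fin in \<open>auto simp: M_def\<close>)
  moreover have "emeasure M A \<noteq> \<infinity>" using M[of A] A by simp
  ultimately have "\<exists>K\<in>{K. K \<subseteq> A \<and> compact K}. emeasure M A < emeasure M K + ennreal (e / 4)"
    using e by (intro SUP_approx_ennreal) auto
  then obtain K where K: "K \<subseteq> A" "compact K" "emeasure M A < emeasure M K + ennreal (e / 4)" by auto
  have Kb: "K \<in> sets borel" using K by (simp add: borel_compact)
  have lA: "A \<in> fmeasurable lborel" using A by (simp add: fmeasurable_def)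
  have lK: "K \<in> fmeasurable lborel" by (rule fmeasurableI2[OF lA]) (use K Kb in auto)
  have mK: "measure lborel A < measure lborel K + e / 4"
  proof -
    have "ennreal (measure lborel A) < ennreal (measure lborel K) + ennreal (e / 4)"
      using K(3) M[of A] M[of K] K(1) Kb A lA lK by (simp add: emeasure_eq_measure2)
    then show ?thesis using e by (simp add: ennreal_plus[symmetric] ennreal_less_iff del: ennreal_plus)
  qed
  obtain U where U: "open U" "A \<subseteq> U" "emeasure lborel (U - A) < ennreal (e / 4)"
    using outer_regular_lborel[OF A(1), of "e / 4"] e by auto
  have lUA: "U - A \<in> fmeasurable lborel"
    using U A by (intro fmeasurableI) (auto intro: order.strict_trans)
  have lU: "U \<in> fmeasurable lborel"
    using fmeasurable.Un[OF lA lUA] U(2) by (simp add: Un_absorb1)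
  have mU: "measure lborel U < measure lborel A + e / 4"
  proof -
    have "measure lborel U = measure lborel A + measure lborel (U - A)"
      using measure_Un2[OF lA lU] U(2) by (simp add: Un_absorb1)
    moreover have "measure lborel (U - A) < e / 4"
      using U(3) lUA e by (simp add: emeasure_eq_measure2 ennreal_less_iff)
    ultimately show ?thesis by simp
  qed
  obtain d where d: "d > 0" "\<And>x y. x \<in> K \<Longrightarrow> y \<in> - U \<Longrightarrow> d \<le> dist x y"
  proof -
    have "\<exists>d>0. \<forall>x\<in>K. \<forall>y\<in>- U. d \<le> dist x y"
      using U K by (intro separate_compact_closed) (auto simp: closed_Compl)
    then show thesis using that by blast
  qed
  have int: "integrable lborel (indicator B :: 'a \<Rightarrow> real)" if "B \<in> fmeasurable lborel" for B
    using that by (intro integrable_real_indicator) (auto simp: fmeasurable_def)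
  note intA = int[OF lA] and intK = int[OF lK] and intU = int[OF lU]
  have "(\<integral>x. \<bar>indicator A (x + h) - indicator A x :: real\<bar> \<partial>lborel) \<le> e" if h: "norm h < d" for h
  proof -
    note shA = lborel_integrable_shift[OF intA, of h] and shK = lborel_integrable_shift[OF intK, of h]
    have "x \<in> U" if "x + h \<in> K" for x
      using d(2)[OF that, of x] h by (auto simp: dist_norm)
    then have le: "indicator K (x + h) \<le> (indicator U x :: real)" for x by (auto simp: indicator_def)
    have le2: "indicator K x \<le> (indicator A x :: real)" "indicator A x \<le> (indicator U x :: real)" for x
      using K U by (auto simp: indicator_def)
    \<comment> \<open>Pass from the shifted \<open>A\<close> to the shifted \<open>K\<close>, then
      to \<open>A\<close>; in the second difference both indicators are at most that of
      \<open>U\<close>. Integration leaves twice the measure of \<open>U\<close> minus twice that of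
      \<open>K\<close>, hence at most e.\<close>
    have "(\<integral>x. \<bar>indicator A (x + h) - indicator A x :: real\<bar> \<partial>lborel)
      \<le> (\<integral>x. indicator A (x + h) - 2 * indicator K (x + h) + 2 * indicator U x - indicator A x \<partial>lborel)"
    proof (rule integral_mono)
      fix x
      show "\<bar>indicator A (x + h) - indicator A x :: real\<bar>
        \<le> indicator A (x + h) - 2 * indicator K (x + h) + 2 * indicator U x - indicator A x"
        using le[of x] le2[of x] le2[of "x + h"] by linarith
    qed (use intA intK intU shA shK in auto)
    also have "\<dots> = (\<integral>x. indicator A (x + h) \<partial>lborel) - 2 * (\<integral>x. indicator K (x + h) \<partial>lborel)
        + 2 * measure lborel U - measure lborel A"
      using intA intK intU shA shK by simp
    also have "(\<integral>x. indicator A (x + h) \<partial>lborel) = measure lborel A"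
      using lborel_integral_shift[of "indicator A" h] A by simp
    also have "(\<integral>x. indicator K (x + h) \<partial>lborel) = measure lborel K"
      using lborel_integral_shift[of "indicator K" h] Kb by simp
    finally show ?thesis using mU mK by linarith
  qed
  then show ?thesis using d(1) by blast
qed

text \<open>Continuity of translations in L1, by induction over integrable functions. In the limit
  step translation invariance gives the shifted approximation error the same norm as the unshifted
  one.\<close>

lemma integral_abs_shift_small:
  fixes f :: "'a::euclidean_space \<Rightarrow> real"
  assumes "integrable lborel f" and "e > 0"
  shows "\<exists>d>0. \<forall>h. norm h < d \<longrightarrow> (\<integral>x. \<bar>f (x + h) - f x\<bar> \<partial>lborel) \<le> e"
proof -
  have "\<forall>e>0. \<exists>d>0. \<forall>h. norm h < d \<longrightarrow> (\<integral>x. \<bar>f (x + h) - f x\<bar> \<partial>lborel) \<le> e"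
    using assms(1)
  proof (induction f rule: integrable_induct)
    case (base A c)
    show ?case
    proof (intro allI impI)
      fix e :: real assume "e > 0"
      then obtain d where d: "d > 0" "\<And>h. norm h < d \<Longrightarrow>
         (\<integral>x. \<bar>indicator A (x + h) - indicator A x :: real\<bar> \<partial>lborel) \<le> e / (\<bar>c\<bar> + 1)"
        using integral_abs_indicator_shift_small[of A "e / (\<bar>c\<bar> + 1)"] base by (auto simp: add_nonneg_pos)
      have "(\<integral>x. \<bar>indicator A (x + h) *\<^sub>R c - indicator A x *\<^sub>R c\<bar> \<partial>lborel) \<le> e" if "norm h < d" for h
      proof -
        have "(\<integral>x. \<bar>indicator A (x + h) *\<^sub>R c - indicator A x *\<^sub>R c\<bar> \<partial>lborel)
           = (\<integral>x. \<bar>indicator A (x + h) - indicator A x\<bar> * \<bar>c\<bar> \<partial>lborel)"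
          by (simp add: left_diff_distrib[symmetric] abs_mult)
        also have "\<dots> = (\<integral>x. \<bar>indicator A (x + h) - indicator A x\<bar> \<partial>lborel) * \<bar>c\<bar>" by simp
        also have "\<dots> \<le> e / (\<bar>c\<bar> + 1) * (\<bar>c\<bar> + 1)"
          using d(2)[OF that] \<open>e > 0\<close> by (intro mult_mono) auto
        also have "\<dots> = e" by (simp add: add_nonneg_eq_0_iff)
        finally show ?thesis .
      qed
      then show "\<exists>d>0. \<forall>h. norm h < d \<longrightarrow>
          (\<integral>x. \<bar>indicator A (x + h) *\<^sub>R c - indicator A x *\<^sub>R c\<bar> \<partial>lborel) \<le> e" using d(1) by blast
    qed
  next
    case (add f g)
    show ?case
    proof (intro allI impI)
      fix e :: real assume "e > 0"
      then have e2: "e / 2 > 0" by simp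
      obtain d1 where d1: "d1 > 0" "\<And>h. norm h < d1 \<Longrightarrow> (\<integral>x. \<bar>f (x + h) - f x\<bar> \<partial>lborel) \<le> e / 2"
        using add.IH(1) e2 by blast
      obtain d2 where d2: "d2 > 0" "\<And>h. norm h < d2 \<Longrightarrow> (\<integral>x. \<bar>g (x + h) - g x\<bar> \<partial>lborel) \<le> e / 2"
        using add.IH(2) e2 by blast
      have "(\<integral>x. \<bar>f (x + h) + g (x + h) - (f x + g x)\<bar> \<partial>lborel) \<le> e" if "norm h < min d1 d2" for h
      proof -
        have i: "integrable lborel (\<lambda>x. \<bar>f (x + h) - f x\<bar>)" "integrable lborel (\<lambda>x. \<bar>g (x + h) - g x\<bar>)"
          "integrable lborel (\<lambda>x. \<bar>f (x + h) + g (x + h) - (f x + g x)\<bar>)"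
          using add.hyps lborel_integrable_shift[OF add.hyps(1), of h] lborel_integrable_shift[OF add.hyps(2), of h]
          by auto
        have "(\<integral>x. \<bar>f (x + h) + g (x + h) - (f x + g x)\<bar> \<partial>lborel)
           \<le> (\<integral>x. \<bar>f (x + h) - f x\<bar> + \<bar>g (x + h) - g x\<bar> \<partial>lborel)"
          using i by (intro integral_mono) auto
        also have "\<dots> = (\<integral>x. \<bar>f (x + h) - f x\<bar> \<partial>lborel) + (\<integral>x. \<bar>g (x + h) - g x\<bar> \<partial>lborel)"
          using i by simp
        finally show ?thesis using d1(2)[of h] d2(2)[of h] that by auto
      qed
      then show "\<exists>d>0. \<forall>h. norm h < d \<longrightarrow> (\<integral>x. \<bar>f (x + h) + g (x + h) - (f x + g x)\<bar> \<partial>lborel) \<le> e"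
        using d1(1) d2(1) by (metis min_less_iff_conj)
    qed
  next
    case (lim f s)
    have "(\<lambda>i. \<integral>x. \<bar>s i x - f x\<bar> \<partial>lborel) \<longlonglongrightarrow> (\<integral>x. 0 \<partial>(lborel :: 'a measure))"
    proof (rule integral_dominated_convergence[where w = "\<lambda>x. 3 * \<bar>f x\<bar>"])
      show "AE x in lborel. (\<lambda>i. \<bar>s i x - f x\<bar>) \<longlonglongrightarrow> 0"
        using lim.hyps(2) by (auto intro!: tendsto_rabs_zero simp: LIM_zero)
      show "AE x in lborel. norm \<bar>s i x - f x\<bar> \<le> 3 * \<bar>f x\<bar>" for i
      proof (rule AE_I2)
        fix x :: 'a
        show "norm \<bar>s i x - f x\<bar> \<le> 3 * \<bar>f x\<bar>" using lim.hyps(3)[of x i] by simp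
      qed
    qed (use lim.hyps(1,4) in auto)
    then have to0: "(\<lambda>i. \<integral>x. \<bar>s i x - f x\<bar> \<partial>lborel) \<longlonglongrightarrow> 0" by simp
    show ?case
    proof (intro allI impI)
      fix e :: real assume "e > 0"
      then have e3: "e / 3 > 0" by simp
      obtain i where i: "(\<integral>x. \<bar>s i x - f x\<bar> \<partial>lborel) < e / 3"
        using eventually_happens[OF order_tendstoD(2)[OF to0 e3]] by auto
      obtain d where d: "d > 0" "\<And>h. norm h < d \<Longrightarrow> (\<integral>x. \<bar>s i (x + h) - s i x\<bar> \<partial>lborel) \<le> e / 3"
        using lim.IH e3 by blast
      have "(\<integral>x. \<bar>f (x + h) - f x\<bar> \<partial>lborel) \<le> e" if "norm h < d" for h
      proof -
        have int: "integrable lborel (\<lambda>x. \<bar>s i x - f x\<bar>)" "integrable lborel (\<lambda>x. \<bar>s i (x + h) - s i x\<bar>)"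
          "integrable lborel (\<lambda>x. \<bar>f (x + h) - f x\<bar>)"
          using lim.hyps(1,4) lborel_integrable_shift[OF lim.hyps(1), of i h] lborel_integrable_shift[OF lim.hyps(4), of h]
          by auto
        note int4 = lborel_integrable_shift[OF int(1), of h]
        have "(\<integral>x. \<bar>f (x + h) - f x\<bar> \<partial>lborel)
          \<le> (\<integral>x. \<bar>s i (x + h) - f (x + h)\<bar> + \<bar>s i (x + h) - s i x\<bar> + \<bar>s i x - f x\<bar> \<partial>lborel)"
          using int int4 by (intro integral_mono) auto
        also have "\<dots> = (\<integral>x. \<bar>s i (x + h) - f (x + h)\<bar> \<partial>lborel) +
           (\<integral>x. \<bar>s i (x + h) - s i x\<bar> \<partial>lborel) + (\<integral>x. \<bar>s i x - f x\<bar> \<partial>lborel)"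
          using int int4 by simp
        also have "(\<integral>x. \<bar>s i (x + h) - f (x + h)\<bar> \<partial>lborel) = (\<integral>x. \<bar>s i x - f x\<bar> \<partial>lborel)"
          by (rule lborel_integral_shift[of "\<lambda>x. \<bar>s i x - f x\<bar>"]) (use lim.hyps(1,4) in auto)
        finally show ?thesis using i d(2)[OF that] by simp
      qed
      then show "\<exists>d>0. \<forall>h. norm h < d \<longrightarrow> (\<integral>x. \<bar>f (x + h) - f x\<bar> \<partial>lborel) \<le> e" using d(1) by blast
    qed
  qed
  then show ?thesis using assms(2) by blast
qed

section \<open>Mollification with a quadratic Taylor remainder\<close>

lemma integrable_continuous_supported:
  fixes h :: "'a::euclidean_space \<Rightarrow> 'b::{banach, second_countable_topology}"
  assumes "continuous_on UNIV h" "\<And>w. w \<notin> cball x R \<Longrightarrow> h w = 0"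
  shows "integrable lborel h"
proof -
  have "integrable lborel (\<lambda>w. indicator (cball x R) w *\<^sub>R h w)"
    by (intro borel_integrable_compact compact_cball) (rule continuous_on_subset[OF assms(1)], simp)
  also have "(\<lambda>w. indicator (cball x R) w *\<^sub>R h w) = h"
    using assms(2) by (auto simp: indicator_def fun_eq_iff)
  finally show ?thesis .
qed

lemma truncated_square_taylor:
  fixes a b :: real
  shows "\<bar>(max 0 b)\<^sup>2 - (max 0 a)\<^sup>2 - 2 * max 0 a * (b - a)\<bar> \<le> (b - a)\<^sup>2"
proof -
  consider "a \<ge> 0" "b \<ge> 0" | "a \<ge> 0" "b < 0" | "a < 0" "b \<ge> 0" | "a < 0" "b < 0" by linarith
  then show ?thesis
  proof cases
    case 1
    then have "(max 0 b)\<^sup>2 - (max 0 a)\<^sup>2 - 2 * max 0 a * (b - a) = (b - a)\<^sup>2"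
      by (simp add: power2_eq_square algebra_simps)
    then show ?thesis by simp
  next
    case 2
    then have "a * b \<le> 0" by (simp add: mult_nonneg_nonpos)
    then have "\<bar>a * a - 2 * (a * b)\<bar> \<le> a * a - 2 * (a * b) + b * b"
      using zero_le_square[of a] zero_le_square[of b] by linarith
    with 2 show ?thesis by (simp add: max_def power2_eq_square algebra_simps)
  next
    case 3
    then have "b * b \<le> (b - a) * (b - a)" by (intro mult_mono) auto
    with 3 show ?thesis by (simp add: max_def power2_eq_square)
  qed simp
qed

text \<open>The kernel need not be smooth: the smoothed function enters the test functions only through
  quadratic majorants.\<close>
definition bump :: "'a::euclidean_space \<Rightarrow> real" where
  "bump z = (max 0 (1 - (norm z)\<^sup>2))\<^sup>2"

definition bump_grad :: "'a::euclidean_space \<Rightarrow> 'a" where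
  "bump_grad z = (4 * max 0 (1 - (norm z)\<^sup>2)) *\<^sub>R z"

lemma bump_nonneg: "0 \<le> bump z"
  by (simp add: bump_def)

lemma bump_eq_0: "norm z \<ge> 1 \<Longrightarrow> bump z = 0" "norm z \<ge> 1 \<Longrightarrow> bump_grad z = 0"
  by (simp_all add: bump_def bump_grad_def one_le_power)

text \<open>The truncated square is expanded along r = 2 z . k - |k|^2, where |r| <= 5|k| for |z| <=
  2. The constant 27 is 25, from r^2, plus 2, from the |k|^2 inside the linear term. For |z| > 2 all
  terms vanish, since z - k stays outside the unit ball.\<close>

lemma bump_taylor:
  assumes k: "norm k \<le> 1"
  shows "\<bar>bump (z - k) - bump z - bump_grad z \<bullet> k\<bar> \<le> 27 * (norm k)\<^sup>2 * indicator (cball 0 2) z"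
proof (cases "norm z \<le> 2")
  case False
  have "norm (z - k) \<ge> 1" using False k norm_triangle_ineq2[of z k] by linarith
  then show ?thesis using False by (simp add: bump_eq_0)
next
  case True
  define m where "m = max 0 (1 - (norm z)\<^sup>2)"
  have m: "0 \<le> m" "m \<le> 1" by (auto simp: m_def)
  define r where "r = (norm z)\<^sup>2 - (norm (z - k))\<^sup>2"
  have r: "r = 2 * (z \<bullet> k) - (norm k)\<^sup>2"
    by (simp add: r_def power2_norm_eq_inner inner_diff_left inner_diff_right inner_commute)
  have "\<bar>z \<bullet> k\<bar> \<le> 2 * norm k"
    using Cauchy_Schwarz_ineq2[of z k] True mult_right_mono[of "norm z" 2 "norm k"] by simp
  moreover have "(norm k)\<^sup>2 \<le> norm k" using k by (simp add: power2_eq_square mult_left_le)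
  moreover have "0 \<le> (norm k)\<^sup>2" "0 \<le> norm k" by simp_all
  ultimately have "\<bar>r\<bar> \<le> 5 * norm k" unfolding r by linarith
  then have r2: "r\<^sup>2 \<le> 25 * (norm k)\<^sup>2"
    using power_mono[of "\<bar>r\<bar>" "5 * norm k" 2] by (simp add: power_mult_distrib)
  have "\<bar>bump (z - k) - bump z - 2 * m * r\<bar> \<le> r\<^sup>2"
    using truncated_square_taylor[of "1 - (norm (z - k))\<^sup>2" "1 - (norm z)\<^sup>2"]
    by (simp add: bump_def m_def r_def)
  moreover have "2 * m * r = bump_grad z \<bullet> k - 2 * m * (norm k)\<^sup>2"
    unfolding r by (simp add: bump_grad_def m_def algebra_simps)
  moreover have "m * (norm k)\<^sup>2 \<le> (norm k)\<^sup>2" "0 \<le> m * (norm k)\<^sup>2" using m by (auto intro: mult_left_le_one_le)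
  ultimately show ?thesis using r2 True by auto
qed

lemma continuous_bump: "continuous_on UNIV (\<lambda>w. bump (w - x))" "continuous_on UNIV (\<lambda>w. bump_grad (w - x))"
  unfolding bump_def bump_grad_def by (intro continuous_intros)+

lemma bump_integral_pos: "0 < (\<integral>w. bump w \<partial>(lborel :: 'a::euclidean_space measure))"
proof -
  let ?B = "ball (0::'a) (1/2)"
  have i: "integrable lborel (bump :: 'a \<Rightarrow> real)"
    using continuous_bump(1)[of 0]
    by (intro integrable_continuous_supported[of _ 0 1]) (auto intro: bump_eq_0)
  have "bump w \<ge> (9/16) * indicator ?B w" for w :: 'a
  proof (cases "w \<in> ?B")
    case True
    then have "(norm w)\<^sup>2 \<le> (1/2)\<^sup>2" by (intro power_mono) auto
    then have "3/4 \<le> 1 - (norm w)\<^sup>2" by (simp add: power2_eq_square)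
    then have "3/4 \<le> max 0 (1 - (norm w)\<^sup>2)" by (rule max.coboundedI2)
    then have "(3/4)\<^sup>2 \<le> bump w" unfolding bump_def by (rule power_mono) simp
    then show ?thesis using True by (simp add: power2_eq_square)
  qed (simp add: bump_nonneg)
  moreover have "integrable lborel (indicator ?B :: 'a \<Rightarrow> real)"
    by (intro integrable_real_indicator emeasure_lborel_ball_finite) auto
  ultimately have "(\<integral>w. (9/16) * indicator ?B w \<partial>lborel) \<le> (\<integral>w. bump w \<partial>(lborel :: 'a measure))"
    using i by (intro integral_mono) auto
  moreover have "(\<integral>w. (9/16) * indicator ?B w \<partial>lborel) = (9/16) * measure lborel ?B" by simp
  moreover have "(9/16) * measure lborel ?B > 0" using content_ball_pos[of "1/2" "0::'a"] by simp
  ultimately show ?thesis by linarith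
qed

text \<open>Convolution with the normalized \<open>bump\<close>. The constant \<open>C\<close> comes
  from the kernel and from |f| <= 1 alone and does not involve \<open>K\<close>: one Hessian bound
  serves all cut-offs, however slowly they vary. The last clause holds because values of
  \<open>f\<close> within distance 2 of x determine \<open>g\<close> within distance 1.\<close>

lemma C11_smoothing:
  obtains C where "C \<ge> 0"
    "\<And>(f :: 'a::euclidean_space \<Rightarrow> real) K. (\<And>x. \<bar>f x\<bar> \<le> 1) \<Longrightarrow> (\<And>x y. \<bar>f x - f y\<bar> \<le> K * norm (x - y)) \<Longrightarrow>
      \<exists>g D. (\<forall>x. \<bar>g x\<bar> \<le> 1) \<and> (\<forall>x z. \<bar>g (x + z) - g x\<bar> \<le> K * norm z) \<and>
        (\<forall>x z. \<bar>g (x + z) - g x - D x \<bullet> z\<bar> \<le> C * (norm z)\<^sup>2) \<and>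
        (\<forall>x k. (\<forall>w. norm (w - x) < 2 \<longrightarrow> f w = k) \<longrightarrow> (\<forall>z. norm z < 1 \<longrightarrow> g (x + z) = k))"
proof -
  define Z where "Z = (\<integral>w. bump w \<partial>(lborel :: 'a measure))"
  have Z: "Z > 0" using bump_integral_pos by (simp add: Z_def)
  define C where "C = 27 * measure lborel (cball (0::'a) 2) / Z"
  have C: "C \<ge> 0" using Z by (simp add: C_def)
  show ?thesis
  proof (rule that[of "4 + C"])
    show "4 + C \<ge> 0" using C by simp
    fix f :: "'a \<Rightarrow> real" and K
    assume f1: "\<And>x. \<bar>f x\<bar> \<le> 1" and fK: "\<And>x y. \<bar>f x - f y\<bar> \<le> K * norm (x - y)"
    have "\<bar>f x - f y\<bar> \<le> \<bar>K\<bar> * dist x y" for x y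
      using fK[of x y] mult_right_mono[OF abs_ge_self norm_ge_zero, of K "x - y"] by (simp add: dist_norm)
    then have "\<bar>K\<bar>-lipschitz_on UNIV f" by (intro lipschitz_onI) (auto simp: dist_real_def)
    then have fc: "continuous_on UNIV f" by (rule lipschitz_on_continuous_on)
    have fb: "f \<in> borel_measurable borel" using fc by (simp add: borel_measurable_continuous_onI)
    have i1: "integrable lborel (\<lambda>w. f w * bump (w - x))" for x
      using fc continuous_bump(1)[of x]
      by (intro integrable_continuous_supported[of _ x 1] continuous_on_mult)
         (auto simp: dist_norm norm_minus_commute intro!: bump_eq_0(1))
    have i2: "integrable lborel (\<lambda>w. f w *\<^sub>R bump_grad (w - x))" for x
      using fc continuous_bump(2)[of x]
      by (intro integrable_continuous_supported[of _ x 1] continuous_on_scaleR)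
         (auto simp: dist_norm norm_minus_commute intro!: bump_eq_0(2))
    have i3: "integrable lborel (\<lambda>w. f (x + w) * bump w)" for x
      using continuous_bump(1)[of 0]
      by (intro integrable_continuous_supported[of _ 0 1] continuous_on_mult continuous_on_compose2[OF fc])
         (auto intro!: continuous_intros bump_eq_0(1))
    have i4: "integrable lborel (bump :: 'a \<Rightarrow> real)"
      using continuous_bump(1)[of 0]
      by (intro integrable_continuous_supported[of _ 0 1]) (auto intro: bump_eq_0)
    define g where "g x = (\<integral>w. f (x + w) * bump w \<partial>lborel) / Z" for x
    define D where "D x = (\<integral>w. f w *\<^sub>R bump_grad (w - x) \<partial>lborel) /\<^sub>R Z" for x
    have g_alt: "g x = (\<integral>w. f w * bump (w - x) \<partial>lborel) / Z" for x
      using lborel_integral_shift[of "\<lambda>w. f w * bump (w - x)" x] i1[of x] by (simp add: g_def add.commute)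
    \<comment> \<open>A weighted mean deviates from k no more than \<open>f\<close> does on the unit
      ball. The case k = 0, e = 1 yields the bound on \<open>g\<close>, the case e = 0 its
      locality.\<close>
    have diff: "\<bar>(\<integral>w. f (x + w) * bump w \<partial>lborel) - k * Z\<bar> \<le> e * Z"
      if "\<And>w. norm w < 1 \<Longrightarrow> \<bar>f (x + w) - k\<bar> \<le> e" for x k e
    proof -
      have "(\<integral>w. f (x + w) * bump w \<partial>lborel) - k * Z = (\<integral>w. (f (x + w) - k) * bump w \<partial>lborel)"
        using i3[of x] i4 by (simp add: Z_def left_diff_distrib)
      also have "\<bar>\<dots>\<bar> \<le> (\<integral>w. e * bump w \<partial>(lborel :: 'a measure))"
      proof -
        have b: "\<bar>(f (x + w) - k) * bump w\<bar> \<le> e * bump w" for w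
        proof (cases "norm w < 1")
          case True
          then show ?thesis using that[of w] bump_nonneg[of w] by (simp add: abs_mult mult_right_mono)
        qed (simp add: bump_eq_0)
        have "integrable lborel (\<lambda>w. (f (x + w) - k) * bump w)"
          using i3[of x] i4 by (simp add: left_diff_distrib)
        have "\<bar>\<integral>w. (f (x + w) - k) * bump w \<partial>lborel\<bar> \<le> (\<integral>w. \<bar>(f (x + w) - k) * bump w\<bar> \<partial>lborel)"
          by (rule integral_abs_bound)
        also have "\<dots> \<le> (\<integral>w. e * bump w \<partial>(lborel :: 'a measure))"
        proof (rule integral_mono)
          show "integrable lborel (\<lambda>w. \<bar>(f (x + w) - k) * bump w\<bar>)"
            using i3[of x] i4 by (simp add: left_diff_distrib)
          show "integrable lborel (\<lambda>w::'a. e * bump w)" using i4 by (rule integrable_mult_right)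
        qed (rule b)
        finally show ?thesis .
      qed
      finally show ?thesis by (simp add: Z_def)
    qed
    have g1: "\<bar>g x\<bar> \<le> 1" for x
      using diff[of x 0 1] f1 Z by (simp add: g_def abs_divide)
    have gK: "\<bar>g (x + z) - g x\<bar> \<le> K * norm z" for x z
    proof -
      have "(\<integral>w. f (x + z + w) * bump w \<partial>lborel) - (\<integral>w. f (x + w) * bump w \<partial>lborel)
         = (\<integral>w. (f (x + z + w) - f (x + w)) * bump w \<partial>lborel)"
        using i3[of x] i3[of "x + z"] by (simp add: left_diff_distrib)
      also have "\<bar>\<dots>\<bar> \<le> (\<integral>w. \<bar>(f (x + z + w) - f (x + w)) * bump w\<bar> \<partial>lborel)"
        by (rule integral_abs_bound)
      also have "\<dots> \<le> (\<integral>w. (K * norm z) * bump w \<partial>(lborel :: 'a measure))"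
      proof (rule integral_mono)
        show "\<bar>(f (x + z + w) - f (x + w)) * bump w\<bar> \<le> (K * norm z) * bump w" for w
          using fK[of "x + z + w" "x + w"] bump_nonneg[of w] by (simp add: abs_mult mult_right_mono)
        have "integrable lborel (\<lambda>w. f (x + z + w) * bump w - f (x + w) * bump w)"
          using i3 by (intro Bochner_Integration.integrable_diff)
        then show "integrable lborel (\<lambda>w. \<bar>(f (x + z + w) - f (x + w)) * bump w\<bar>)"
          by (simp only: left_diff_distrib integrable_abs)
        show "integrable lborel (\<lambda>w::'a. (K * norm z) * bump w)"
          using i4 by (rule integrable_mult_right)
      qed
      also have "\<dots> = (K * norm z) * Z" by (simp add: Z_def)
      finally show ?thesis using Z by (simp add: g_def diff_divide_distrib[symmetric] abs_divide field_simps)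
    qed
    have small: "\<bar>g (x + k) - g x - D x \<bullet> k\<bar> \<le> C * (norm k)\<^sup>2" if k: "norm k \<le> 1" for x k
    proof -
      let ?T = "\<lambda>w. bump (w - x - k) - bump (w - x) - bump_grad (w - x) \<bullet> k"
      have fT: "f w * ?T w = f w * bump (w - (x + k)) - f w * bump (w - x) - f w * (bump_grad (w - x) \<bullet> k)" for w
        by (simp add: right_diff_distrib diff_diff_add distrib_left)
      have i2k: "integrable lborel (\<lambda>w. f w * (bump_grad (w - x) \<bullet> k))"
        using integrable_inner_left[of k lborel "\<lambda>w. f w *\<^sub>R bump_grad (w - x)"] i2[of x] by simp
      have I2k: "(\<integral>w. f w *\<^sub>R bump_grad (w - x) \<partial>lborel) \<bullet> k = (\<integral>w. f w * (bump_grad (w - x) \<bullet> k) \<partial>lborel)"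
        using integral_inner_left[of k lborel "\<lambda>w. f w *\<^sub>R bump_grad (w - x)"] i2[of x] by simp
      have iT: "integrable lborel (\<lambda>w. f w * ?T w)"
        unfolding fT using i1 i2k by (intro Bochner_Integration.integrable_diff)
      define I1 where "I1 = (\<integral>w. f w * bump (w - (x + k)) \<partial>lborel)"
      define I0 where "I0 = (\<integral>w. f w * bump (w - x) \<partial>lborel)"
      define I2 where "I2 = (\<integral>w. f w * (bump_grad (w - x) \<bullet> k) \<partial>lborel)"
      have eqT: "(\<integral>w. f w * ?T w \<partial>lborel) = I1 - I0 - I2"
        unfolding fT I1_def I0_def I2_def using i1 i2k
        by (simp only: Bochner_Integration.integral_diff Bochner_Integration.integrable_diff)
      have "g (x + k) = I1 / Z" "g x = I0 / Z" by (simp_all only: g_alt I1_def I0_def)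
      moreover have "D x \<bullet> k = I2 / Z"
        unfolding D_def inner_scaleR_left I2k I2_def by (simp add: divide_inverse)
      ultimately have "Z * (g (x + k) - g x - D x \<bullet> k) = (\<integral>w. f w * ?T w \<partial>lborel)"
        unfolding eqT using Z by (simp add: right_diff_distrib)
      also have "\<bar>\<dots>\<bar> \<le> (\<integral>w. \<bar>f w * ?T w\<bar> \<partial>lborel)" by (rule integral_abs_bound)
      also have "\<dots> \<le> (\<integral>w. 27 * (norm k)\<^sup>2 * indicator (cball x 2) w \<partial>lborel)"
      proof (rule integral_mono)
        fix w
        have "\<bar>f w\<bar> * \<bar>?T w\<bar> \<le> 1 * \<bar>?T w\<bar>" using f1 by (intro mult_right_mono) auto
        then have "\<bar>f w * ?T w\<bar> \<le> 1 * \<bar>?T w\<bar>" by (simp only: abs_mult)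
        also have "\<dots> \<le> 27 * (norm k)\<^sup>2 * indicator (cball 0 2) (w - x)"
          using bump_taylor[OF k, of "w - x"] by simp
        also have "\<dots> = 27 * (norm k)\<^sup>2 * indicator (cball x 2) w"
          by (simp add: indicator_def dist_norm norm_minus_commute)
        finally show "\<bar>f w * ?T w\<bar> \<le> 27 * (norm k)\<^sup>2 * indicator (cball x 2) w" .
      next
        have "integrable lborel (indicator (cball x 2) :: 'a \<Rightarrow> real)"
          by (intro integrable_real_indicator emeasure_lborel_cball_finite) auto
        then show "integrable lborel (\<lambda>w. 27 * (norm k)\<^sup>2 * indicator (cball x 2) w)" by simp
        show "integrable lborel (\<lambda>w. \<bar>f w * ?T w\<bar>)" using iT by (rule integrable_abs)
      qed
      also have "\<dots> = 27 * (norm k)\<^sup>2 * measure lborel (cball x 2)" by simp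
      also have "measure lborel (cball x 2) = measure lborel (cball (0::'a) 2)"
        by (simp add: content_cball)
      finally have "Z * \<bar>g (x + k) - g x - D x \<bullet> k\<bar> \<le> 27 * (norm k)\<^sup>2 * measure lborel (cball (0::'a) 2)"
        using Z by (simp only: abs_mult abs_of_pos)
      then have "\<bar>g (x + k) - g x - D x \<bullet> k\<bar> \<le> 27 * (norm k)\<^sup>2 * measure lborel (cball (0::'a) 2) / Z"
        using Z by (simp add: pos_le_divide_eq mult.commute)
      then show ?thesis by (simp add: C_def mult_ac)
    qed
    have Db: "\<bar>D x \<bullet> k\<bar> \<le> (2 + C) * norm k" for x k
    proof (cases "k = 0")
      case False
      have "\<bar>g (x + sgn k) - g x - D x \<bullet> sgn k\<bar> \<le> C" using small[of "sgn k" x] False by (simp add: norm_sgn)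
      then have "\<bar>D x \<bullet> sgn k\<bar> \<le> 2 + C" using g1[of x] g1[of "x + sgn k"] by linarith
      then have "\<bar>D x \<bullet> sgn k\<bar> * norm k \<le> (2 + C) * norm k" by (rule mult_right_mono) simp
      moreover have "\<bar>D x \<bullet> sgn k\<bar> * norm k = \<bar>D x \<bullet> k\<bar>"
        using False by (simp add: sgn_div_norm abs_mult)
      ultimately show ?thesis by simp
    qed simp
    \<comment> \<open>The kernel estimate covers |z| <= 1. For longer z the trivial bound 2 + (2 +
      C)|z| suffices and accounts for the 4 in the constant.\<close>
    have taylor: "\<bar>g (x + z) - g x - D x \<bullet> z\<bar> \<le> (4 + C) * (norm z)\<^sup>2" for x z
    proof (cases "norm z \<le> 1")
      case True
      then have "\<bar>g (x + z) - g x - D x \<bullet> z\<bar> \<le> C * (norm z)\<^sup>2" by (rule small)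
      also have "\<dots> \<le> (4 + C) * (norm z)\<^sup>2" by (intro mult_right_mono) auto
      finally show ?thesis .
    next
      case False
      then have le: "1 \<le> (norm z)\<^sup>2" "norm z \<le> (norm z)\<^sup>2" 
        using one_le_power[of "norm z" 2] mult_left_mono[of 1 "norm z" "norm z"] by (auto simp: power2_eq_square)
      have "\<bar>g (x + z) - g x - D x \<bullet> z\<bar> \<le> 2 + (2 + C) * norm z"
        using Db[of x z] g1[of x] g1[of "x + z"] by linarith
      also have "\<dots> \<le> 2 * (norm z)\<^sup>2 + (2 + C) * (norm z)\<^sup>2"
        using le C by (intro add_mono mult_left_mono) auto
      finally show ?thesis by (simp add: algebra_simps)
    qed
    have loc: "g (x + z) = k" if "\<forall>w. norm (w - x) < 2 \<longrightarrow> f w = k" "norm z < 1" for x z k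
    proof -
      have "\<bar>f (x + z + w) - k\<bar> \<le> 0" if "norm w < 1" for w
      proof -
        have "norm (x + z + w - x) < 2" using that \<open>norm z < 1\<close> norm_triangle_ineq[of z w] by simp
        then show ?thesis using \<open>\<forall>w. _\<close> by simp
      qed
      from diff[OF this] show ?thesis using Z by (simp add: g_def)
    qed
    show "\<exists>g D. (\<forall>x. \<bar>g x\<bar> \<le> 1) \<and> (\<forall>x z. \<bar>g (x + z) - g x\<bar> \<le> K * norm z) \<and>
        (\<forall>x z. \<bar>g (x + z) - g x - D x \<bullet> z\<bar> \<le> (4 + C) * (norm z)\<^sup>2) \<and>
        (\<forall>x k. (\<forall>w. norm (w - x) < 2 \<longrightarrow> f w = k) \<longrightarrow> (\<forall>z. norm z < 1 \<longrightarrow> g (x + z) = k))"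
      using g1 gK taylor loc by blast
  qed
qed

section \<open>The doubled functional\<close>

lemma usc_on_sequentially:
  fixes f :: "'a::metric_space \<Rightarrow> real"
  assumes "usc_on S f" "x \<in> S" "\<And>n. X n \<in> S" "X \<longlonglongrightarrow> x" "e > 0"
  shows "\<forall>\<^sub>F n in sequentially. f (X n) < f x + e"
proof -
  obtain r where "r > 0" "\<And>y. y \<in> S \<Longrightarrow> dist y x < r \<Longrightarrow> f y < f x + e"
    using usc_on_ball[OF assms(1,2), of "f x + e"] assms(5) by auto
  moreover from this have "\<forall>\<^sub>F n in sequentially. dist (X n) x < r"
    using assms(4) by (simp add: tendsto_iff)
  ultimately show ?thesis using assms(3) by (auto elim: eventually_mono)
qed

lemma ln_near_one_bounds:
  assumes "(r::real) \<ge> 1 / 2"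
  shows "\<bar>ln r - (r - 1)\<bar> \<le> 2 * (r - 1)\<^sup>2" "(ln r)\<^sup>2 \<le> 4 * (r - 1)\<^sup>2"
proof -
  have r: "r > 0" using assms by simp
  have up: "ln r \<le> r - 1" using ln_le_minus_one[OF r] .
  have lo: "1 - 1 / r \<le> ln r"
    using ln_le_minus_one[of "1 / r"] r by (simp add: ln_div)
  have "(r - 1) - (1 - 1 / r) = (r - 1)\<^sup>2 / r" using r by (simp add: field_simps power2_eq_square)
  also have "\<dots> \<le> (r - 1)\<^sup>2 / (1 / 2)" using assms by (intro divide_left_mono) auto
  finally show "\<bar>ln r - (r - 1)\<bar> \<le> 2 * (r - 1)\<^sup>2" using up lo by auto
  have "\<bar>ln r\<bar> \<le> 2 * \<bar>r - 1\<bar>"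
  proof (cases "r \<ge> 1")
    case True
    then show ?thesis using up by auto
  next
    case False
    have "1 / r - 1 = (1 - r) / r" using r by (simp add: field_simps)
    also have "\<dots> \<le> (1 - r) / (1 / 2)" using assms False by (intro divide_left_mono) auto
    finally show ?thesis using up lo False by auto
  qed
  then have "\<bar>ln r\<bar>\<^sup>2 \<le> (2 * \<bar>r - 1\<bar>)\<^sup>2" by (intro power_mono) auto
  then show "(ln r)\<^sup>2 \<le> 4 * (r - 1)\<^sup>2" by (simp add: power_mult_distrib)
qed

lemma inner_plus_square_lower:
  fixes q z :: "'a::real_inner"
  assumes "h > 0"
  shows "- (norm q)\<^sup>2 / (4 * h) \<le> q \<bullet> z + h * (norm z)\<^sup>2"
proof -
  have "- (norm q * norm z) \<le> q \<bullet> z" using Cauchy_Schwarz_ineq2[of q z] by linarith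
  moreover have "0 \<le> (norm q - 2 * h * norm z)\<^sup>2 / (4 * h)" using assms by simp
  moreover have "(norm q - 2 * h * norm z)\<^sup>2 / (4 * h) = (norm q)\<^sup>2 / (4 * h) - norm q * norm z + h * (norm z)\<^sup>2"
    using assms by (simp add: power2_eq_square field_simps)
  ultimately show ?thesis by linarith
qed

text \<open>The penalty in time is logarithmic, hence only local; boundedness of \<open>f\<close> makes the
  quadratic majorant global.\<close>
lemma majorized_log_penalty:
  fixes f :: "real \<times> 'a::euclidean_space \<Rightarrow> real"
  assumes f: "\<And>t x. t \<ge> 0 \<Longrightarrow> \<bar>f (t, x)\<bar> \<le> M" and t: "t > 0" and h: "h > 0" and \<beta>: "\<beta> > 0" and k: "k > 0"
    and \<omega>: "\<bar>\<omega>\<bar> \<le> 1 / 2"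
    and le: "\<And>t' x'. t' > 0 \<Longrightarrow> f (t', x') \<le> f (t, x) + (q \<bullet> (x' - x) + h * (norm (x' - x))\<^sup>2)
      + \<eta> * (t' - t) + k * (2 * \<omega> * (ln (t' / t) / \<beta>) + 2 * (ln (t' / t) / \<beta>)\<^sup>2)"
  obtains A where "majorized f t x (2 * k * \<omega> / (\<beta> * t) + \<eta>) A q h"
proof -
  define a where "a = 2 * k * \<omega> / (\<beta> * t) + \<eta>"
  \<comment> \<open>\<open>A1\<close> collects the second-order errors of the logarithm for t' >=
    t/2. For earlier t' the distance to t exceeds t/2, and \<open>A2\<close> is chosen so that its
    parabola is at least \<open>B\<close> there, the worst deficit of all other terms.\<close>
  define A1 where "A1 = k * (2 / \<beta> + 8 / \<beta>\<^sup>2) / t\<^sup>2"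
  define B where "B = 2 * M + \<bar>a\<bar> * t + (norm q)\<^sup>2 / (4 * h)"
  define A2 where "A2 = 4 * B / t\<^sup>2"
  have M: "M \<ge> 0" using f[of t x] t by linarith
  have B: "B \<ge> 0" using M h t by (simp add: B_def)
  have A: "A1 \<ge> 0" "A2 \<ge> 0" using k \<beta> t B by (auto simp: A1_def A2_def)
  have "f (t', x') \<le> f (t, x) + a * (t' - t) + (A1 + A2) * (t' - t)\<^sup>2 + q \<bullet> (x' - x) + h * (norm (x' - x))\<^sup>2"
    if t': "t' \<ge> 0" for t' x'
  proof (cases "t' \<ge> t / 2")
    case True
    define r where "r = t' / t"
    have r: "r \<ge> 1 / 2" using True t by (simp add: r_def field_simps)
    have rt: "(r - 1) = (t' - t) / t" using t by (simp add: r_def field_simps)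
    have "2 * \<omega> * ln r \<le> 2 * \<omega> * (r - 1) + 2 * (r - 1)\<^sup>2"
    proof -
      have "\<bar>2 * \<omega> * (ln r - (r - 1))\<bar> \<le> 1 * (2 * (r - 1)\<^sup>2)"
        unfolding abs_mult[of "2 * \<omega>"] using \<omega> ln_near_one_bounds(1)[OF r] by (intro mult_mono) auto
      then show ?thesis by (simp add: right_diff_distrib abs_le_iff)
    qed
    then have "2 * \<omega> * (ln r / \<beta>) \<le> (2 * \<omega> * (r - 1) + 2 * (r - 1)\<^sup>2) / \<beta>"
      using \<beta> by (simp add: divide_right_mono)
    moreover have "2 * (ln r / \<beta>)\<^sup>2 \<le> 8 * (r - 1)\<^sup>2 / \<beta>\<^sup>2"
      using ln_near_one_bounds(2)[OF r] \<beta> by (simp add: power_divide divide_right_mono)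
    ultimately have "k * (2 * \<omega> * (ln r / \<beta>) + 2 * (ln r / \<beta>)\<^sup>2)
        \<le> k * ((2 * \<omega> * (r - 1) + 2 * (r - 1)\<^sup>2) / \<beta> + 8 * (r - 1)\<^sup>2 / \<beta>\<^sup>2)"
      using k by (intro mult_left_mono add_mono) auto
    also have "\<dots> = 2 * k * \<omega> / (\<beta> * t) * (t' - t) + A1 * (t' - t)\<^sup>2"
      using \<beta> t by (simp add: A1_def rt power_divide field_simps power2_eq_square)
    finally have "f (t', x') \<le> f (t, x) + (q \<bullet> (x' - x) + h * (norm (x' - x))\<^sup>2)
      + \<eta> * (t' - t) + (2 * k * \<omega> / (\<beta> * t) * (t' - t) + A1 * (t' - t)\<^sup>2)"
      using le[of t' x'] True t unfolding r_def by simp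
    moreover have "0 \<le> A2 * (t' - t)\<^sup>2" using A by simp
    ultimately show ?thesis by (simp add: a_def distrib_right)
  next
    case False
    have "(t / 2)\<^sup>2 \<le> (t' - t)\<^sup>2" using False t by (simp add: abs_le_square_iff[symmetric])
    then have "A2 * (t / 2)\<^sup>2 \<le> A2 * (t' - t)\<^sup>2" using A by (intro mult_left_mono)
    moreover have "A2 * (t / 2)\<^sup>2 = B" using t by (simp add: A2_def power2_eq_square)
    moreover have "0 \<le> A1 * (t' - t)\<^sup>2" using A by simp
    moreover have "- (\<bar>a\<bar> * t) \<le> a * (t' - t)"
    proof -
      have "\<bar>a * (t' - t)\<bar> \<le> \<bar>a\<bar> * t" unfolding abs_mult using False t' t by (intro mult_left_mono) auto
      then show ?thesis by linarith
    qed
    moreover have "- (norm q)\<^sup>2 / (4 * h) \<le> q \<bullet> (x' - x) + h * (norm (x' - x))\<^sup>2"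
      by (rule inner_plus_square_lower[OF h])
    moreover have "\<bar>f (t', x')\<bar> \<le> M" "\<bar>f (t, x)\<bar> \<le> M" using f t' t by auto
    ultimately show ?thesis unfolding B_def distrib_right by linarith
  qed
  then show ?thesis using that[of "A1 + A2"] unfolding majorized_def a_def by blast
qed

locale comparison = levy \<nu> + speed \<mu> for \<nu> :: "'a::euclidean_space measure" and \<mu> :: "'a \<Rightarrow> real" +
  fixes c u0 :: "'a \<Rightarrow> real" and u v :: "real \<times> 'a \<Rightarrow> real" and M L Lc :: real
  assumes A3': "singular_density \<nu>"
    and c_lip: "\<And>x y. \<bar>c x - c y\<bar> \<le> Lc * norm (x - y)" and Lc: "Lc \<ge> 0"
    and u0_lip: "\<And>x y. \<bar>u0 x - u0 y\<bar> \<le> L * norm (x - y)"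
    and sub: "viscosity_subsolution \<mu> c \<nu> u" and super: "viscosity_supersolution \<mu> c \<nu> v"
    and M: "M \<ge> 1" and u_bound: "\<And>t x. t \<ge> 0 \<Longrightarrow> \<bar>u (t, x)\<bar> \<le> M"
    and v_bound: "\<And>t x. t \<ge> 0 \<Longrightarrow> \<bar>v (t, x)\<bar> \<le> M"
    and init: "\<And>x. u (0, x) \<le> u0 x" "\<And>x. u0 x \<le> v (0, x)"
begin

definition phase :: "real \<Rightarrow> ('a \<Rightarrow> real) \<Rightarrow> real \<Rightarrow> real \<Rightarrow> 'a \<Rightarrow> real" where
  "phase \<beta> g t s x = ln (t / s) / \<beta> + g x"

text \<open>The coefficient 8M is matched to the bound 2M for u - v: a positive value leaves at most
  2M for the phase term, so the phase is at most 1/2, half the amplitude of the cut-off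
  \<open>g\<close>.\<close>

definition Phi :: "real \<Rightarrow> real \<Rightarrow> real \<Rightarrow> real \<Rightarrow> ('a \<Rightarrow> real) \<Rightarrow> real \<Rightarrow> real \<Rightarrow> 'a \<Rightarrow> 'a \<Rightarrow> real" where
  "Phi \<epsilon> \<eta> \<alpha> \<beta> g t s x y = u (t, x) - v (s, y) - (norm (x - y))\<^sup>2 / (2 * \<epsilon>)
     - 8 * M * (phase \<beta> g t s x)\<^sup>2 - \<eta> * t - \<alpha> * ln (1 + (norm x)\<^sup>2)"

lemma usc_u: "usc_on ({0..} \<times> UNIV) u"
  using sub by (simp add: viscosity_subsolution_def)

lemma usc_mv: "usc_on ({0..} \<times> UNIV) (\<lambda>\<xi>. - v \<xi>)"
  using subsolution_uminus[OF super] by (simp add: viscosity_subsolution_def)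

text \<open>All penalties are non-negative and together less than 2M, hence each of them is at most
  2M.\<close>

lemma Phi_pos_bounds:
  assumes par: "\<epsilon> > 0" "\<eta> > 0" "\<alpha> > 0" and ts: "t > 0" "s > 0"
    and pos: "Phi \<epsilon> \<eta> \<alpha> \<beta> g t s x y > 0"
  shows "(norm (x - y))\<^sup>2 \<le> 4 * M * \<epsilon>" "\<bar>phase \<beta> g t s x\<bar> \<le> 1 / 2" "\<eta> * t \<le> 2 * M"
    "\<alpha> * ln (1 + (norm x)\<^sup>2) \<le> 2 * M"
proof -
  define a b d e where "a = (norm (x - y))\<^sup>2 / (2 * \<epsilon>)" and "b = 8 * M * (phase \<beta> g t s x)\<^sup>2"
    and "d = \<eta> * t" and "e = \<alpha> * ln (1 + (norm x)\<^sup>2)"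
  have "u (t, x) - v (s, y) \<le> 2 * M" using u_bound[of t x] v_bound[of s y] ts by auto
  then have sum: "a + b + d + e < 2 * M"
    using pos unfolding Phi_def a_def b_def d_def e_def by linarith
  have nn: "a \<ge> 0" "b \<ge> 0" "d \<ge> 0" "e \<ge> 0"
    using par ts M by (auto simp: a_def b_def d_def e_def)
  have "a \<le> 2 * M" using sum nn by linarith
  then show "(norm (x - y))\<^sup>2 \<le> 4 * M * \<epsilon>" using par by (simp add: a_def field_simps)
  have "b \<le> 2 * M" using sum nn by linarith
  then have "8 * M * (phase \<beta> g t s x)\<^sup>2 \<le> 8 * M * (1 / 2)\<^sup>2" by (simp add: b_def power_divide)
  then have "(phase \<beta> g t s x)\<^sup>2 \<le> (1 / 2)\<^sup>2" using M by simp
  then show "\<bar>phase \<beta> g t s x\<bar> \<le> 1 / 2"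
    using abs_le_square_iff[of "phase \<beta> g t s x" "1 / 2"] by simp
  show "\<eta> * t \<le> 2 * M" using sum nn by (simp add: d_def)
  show "\<alpha> * ln (1 + (norm x)\<^sup>2) \<le> 2 * M" using sum nn by (simp add: e_def)
qed

text \<open>The threshold is the maximum of L r - r^2/(2\<epsilon>) over r, which bounds the
  functional at time 0, where u - v <= L|x - y|. The penalties confine a maximizing sequence to a
  compact set. As |W| <= 1/2 and |g| <= 1 keep ln(t/s) within 3\<beta>/2, the limit times can vanish
  only together, and the threshold excludes that.\<close>

lemma Phi_attains_max:
  assumes par: "\<epsilon> > 0" "\<eta> > 0" "\<alpha> > 0" "\<beta> > 0" and g: "continuous_on UNIV g" "\<And>x. \<bar>g x\<bar> \<le> 1"
    and pt: "t1 > 0" "s1 > 0" "Phi \<epsilon> \<eta> \<alpha> \<beta> g t1 s1 x1 y1 > L\<^sup>2 * \<epsilon> / 2"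
  obtains t s x y where "t > 0" "s > 0" "Phi \<epsilon> \<eta> \<alpha> \<beta> g t1 s1 x1 y1 \<le> Phi \<epsilon> \<eta> \<alpha> \<beta> g t s x y"
    "\<And>t' s' x' y'. t' > 0 \<Longrightarrow> s' > 0 \<Longrightarrow> Phi \<epsilon> \<eta> \<alpha> \<beta> g t' s' x' y' \<le> Phi \<epsilon> \<eta> \<alpha> \<beta> g t s x y"
proof -
  let ?P = "Phi \<epsilon> \<eta> \<alpha> \<beta> g"
  define l where "l = L\<^sup>2 * \<epsilon> / 2"
  have l0: "l \<ge> 0" using par by (simp add: l_def)
  define V where "V = {?P t s x y | t s x y. t > 0 \<and> s > 0}"
  have up: "?P t s x y \<le> 2 * M" if "t > 0" "s > 0" for t s x y
  proof (rule ccontr)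
    assume n: "\<not> ?P t s x y \<le> 2 * M"
    have "u (t, x) - v (s, y) \<le> 2 * M" using u_bound[of t x] v_bound[of s y] that by auto
    moreover have "0 \<le> (norm (x - y))\<^sup>2 / (2 * \<epsilon>)" "0 \<le> 8 * M * (phase \<beta> g t s x)\<^sup>2" "0 \<le> \<eta> * t"
      "0 \<le> \<alpha> * ln (1 + (norm x)\<^sup>2)" using par that M by auto
    ultimately show False using n unfolding Phi_def by linarith
  qed
  have bdd: "bdd_above V" unfolding V_def bdd_above_def using up by blast
  define \<sigma> where "\<sigma> = Sup V"
  have le\<sigma>: "?P t s x y \<le> \<sigma>" if "t > 0" "s > 0" for t s x y
    unfolding \<sigma>_def using that by (intro cSup_upper bdd) (auto simp: V_def)
  have l\<sigma>: "l < \<sigma>" using le\<sigma>[OF pt(1,2)] pt(3) unfolding l_def by (rule less_le_trans[rotated])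
  define \<kappa> where "\<kappa> = \<sigma> - l"
  have \<kappa>: "\<kappa> > 0" using l\<sigma> by (simp add: \<kappa>_def)
  \<comment> \<open>The offset 2 makes every deficit at most \<kappa>/2, so the whole sequence stays
    above the threshold by \<kappa>/2.\<close>
  have "\<exists>X. fst X > 0 \<and> fst (snd X) > 0 \<and> ?P (fst X) (fst (snd X)) (fst (snd (snd X))) (snd (snd (snd X))) > \<sigma> - \<kappa> / (real n + 2)" for n
  proof -
    have "\<sigma> - \<kappa> / (real n + 2) < Sup V" using \<kappa> by (simp add: \<sigma>_def[symmetric])
    moreover have "V \<noteq> {}" using pt(1,2) unfolding V_def by blast
    ultimately obtain w where "w \<in> V" "\<sigma> - \<kappa> / (real n + 2) < w"
      using less_cSup_iff[OF _ bdd] by blast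
    then obtain t s x y where "t > 0" "s > 0" "\<sigma> - \<kappa> / (real n + 2) < ?P t s x y" by (auto simp: V_def)
    then show ?thesis by (intro exI[of _ "(t, s, x, y)"]) simp
  qed
  then obtain X where X: "\<And>n. fst (X n) > 0" "\<And>n. fst (snd (X n)) > 0"
    "\<And>n. ?P (fst (X n)) (fst (snd (X n))) (fst (snd (snd (X n)))) (snd (snd (snd (X n)))) > \<sigma> - \<kappa> / (real n + 2)"
    by metis
  define T where "T n = fst (X n)" for n
  define S where "S n = fst (snd (X n))" for n
  define A where "A n = fst (snd (snd (X n)))" for n
  define B where "B n = snd (snd (snd (X n)))" for n
  have XT: "X n = (T n, S n, A n, B n)" for n by (simp add: T_def S_def A_def B_def)
  have TS: "T n > 0" "S n > 0" for n using X by (auto simp: T_def S_def)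
  have PX: "?P (T n) (S n) (A n) (B n) > \<sigma> - \<kappa> / (real n + 2)" for n
    using X(3)[of n] by (simp add: T_def S_def A_def B_def)
  have PX2: "?P (T n) (S n) (A n) (B n) > l + \<kappa> / 2" for n
  proof -
    have "\<kappa> / (real n + 2) \<le> \<kappa> / 2" using \<kappa> by (intro divide_left_mono) auto
    then have "\<sigma> - \<kappa> / (real n + 2) \<ge> l + \<kappa> / 2" unfolding \<kappa>_def by argo
    then show ?thesis using PX[of n] by linarith
  qed
  have pos: "?P (T n) (S n) (A n) (B n) > 0" for n using PX2[of n] l0 \<kappa> by linarith
  note bnd = Phi_pos_bounds[OF par(1-3) TS pos]
  have ratio: "\<bar>ln (T n / S n)\<bar> \<le> 3 / 2 * \<beta>" for n
  proof -
    have "\<bar>ln (T n / S n) / \<beta>\<bar> \<le> 3 / 2" using bnd(2)[of n] g(2)[of "A n"] unfolding phase_def by linarith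
    then show ?thesis using par(4) by (simp add: field_simps)
  qed
  have ST: "S n \<le> exp (3 / 2 * \<beta>) * T n" "T n \<le> exp (3 / 2 * \<beta>) * S n" for n
  proof -
    have "ln (T n / S n) = ln (T n) - ln (S n)" using TS[of n] by (simp add: ln_div)
    then have "ln (S n) \<le> 3 / 2 * \<beta> + ln (T n)" "ln (T n) \<le> 3 / 2 * \<beta> + ln (S n)"
      using ratio[of n] by linarith+
    then have "ln (S n) \<le> ln (exp (3 / 2 * \<beta>) * T n)" "ln (T n) \<le> ln (exp (3 / 2 * \<beta>) * S n)"
      using TS[of n] by (simp_all add: ln_mult)
    then show "S n \<le> exp (3 / 2 * \<beta>) * T n" "T n \<le> exp (3 / 2 * \<beta>) * S n"
      using TS[of n] by auto
  qed
  have Tb: "T n \<le> 2 * M / \<eta>" for n using bnd(3)[of n] par(2) by (simp add: field_simps)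
  have Sb: "S n \<le> exp (3 / 2 * \<beta>) * (2 * M / \<eta>)" for n
    using order_trans[OF ST(1)[of n] mult_left_mono[OF Tb[of n]]] by simp
  have Ab: "norm (A n) \<le> sqrt (exp (2 * M / \<alpha>))" for n
  proof -
    have "ln (1 + (norm (A n))\<^sup>2) \<le> 2 * M / \<alpha>" using bnd(4)[of n] par(3) by (simp add: field_simps)
    then have "exp (ln (1 + (norm (A n))\<^sup>2)) \<le> exp (2 * M / \<alpha>)" by simp
    moreover have "exp (ln (1 + (norm (A n))\<^sup>2)) = 1 + (norm (A n))\<^sup>2" by (intro exp_ln) (simp add: add_pos_nonneg)
    ultimately show ?thesis by (intro real_le_rsqrt) linarith
  qed
  have Bb: "norm (B n) \<le> sqrt (exp (2 * M / \<alpha>)) + sqrt (4 * M * \<epsilon>)" for n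
  proof -
    have "norm (A n - B n) \<le> sqrt (4 * M * \<epsilon>)" using bnd(1)[of n] by (intro real_le_rsqrt)
    then show ?thesis using Ab[of n] norm_triangle_sub[of "B n" "A n"] by (simp add: norm_minus_commute)
  qed
  define Q where "Q = {0..2 * M / \<eta>} \<times> {0..exp (3 / 2 * \<beta>) * (2 * M / \<eta>)} \<times>
     cball (0::'a) (sqrt (exp (2 * M / \<alpha>))) \<times> cball (0::'a) (sqrt (exp (2 * M / \<alpha>)) + sqrt (4 * M * \<epsilon>))"
  have "compact Q" unfolding Q_def by (intro compact_Times compact_Icc compact_cball)
  moreover have "\<forall>n. X n \<in> Q"
    unfolding XT Q_def using TS Tb Sb Ab Bb by (auto intro: less_imp_le)
  ultimately obtain z r where zr: "z \<in> Q" "strict_mono (r :: nat \<Rightarrow> nat)" "(X \<circ> r) \<longlonglongrightarrow> z"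
    unfolding compact_def by metis
  obtain t s x y where z: "z = (t, s, x, y)" by (cases z) auto
  have lim: "(\<lambda>n. T (r n)) \<longlonglongrightarrow> t" "(\<lambda>n. S (r n)) \<longlonglongrightarrow> s" "(\<lambda>n. A (r n)) \<longlonglongrightarrow> x" "(\<lambda>n. B (r n)) \<longlonglongrightarrow> y"
    using tendsto_fst[OF zr(3)] tendsto_fst[OF tendsto_snd[OF zr(3)]]
      tendsto_fst[OF tendsto_snd[OF tendsto_snd[OF zr(3)]]] tendsto_snd[OF tendsto_snd[OF tendsto_snd[OF zr(3)]]]
    by (simp_all add: z o_def T_def S_def A_def B_def)
  have ts0: "t \<ge> 0" "s \<ge> 0" using zr(1) by (auto simp: z Q_def)
  have st: "s \<le> exp (3 / 2 * \<beta>) * t" "t \<le> exp (3 / 2 * \<beta>) * s"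
    by (rule LIMSEQ_le[OF lim(2) tendsto_mult[OF tendsto_const lim(1)]], use ST in blast)
       (rule LIMSEQ_le[OF lim(1) tendsto_mult[OF tendsto_const lim(2)]], use ST in blast)
  have u_ev: "\<forall>\<^sub>F n in sequentially. u (T (r n), A (r n)) < u (t, x) + e" if "e > 0" for e
    by (rule usc_on_sequentially[OF usc_u]) (use TS ts0 lim that in \<open>auto intro!: tendsto_Pair less_imp_le\<close>)
  have v_ev: "\<forall>\<^sub>F n in sequentially. - v (S (r n), B (r n)) < - v (s, y) + e" if "e > 0" for e
    by (rule usc_on_sequentially[OF usc_mv]) (use TS ts0 lim that in \<open>auto intro!: tendsto_Pair less_imp_le\<close>)
  have q_lim: "(\<lambda>n. (norm (A (r n) - B (r n)))\<^sup>2 / (2 * \<epsilon>)) \<longlonglongrightarrow> (norm (x - y))\<^sup>2 / (2 * \<epsilon>)"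
    using par(1) by (intro tendsto_intros lim) auto
  \<comment> \<open>The phase has no limit as both times vanish; its penalty is simply dropped,
    being non-negative, and only the quadratic term is kept to meet the Lipschitz bound of
    \<open>u0\<close>.\<close>
  have "t > 0"
  proof (rule ccontr)
    assume "\<not> t > 0"
    then have t0: "t = 0" "s = 0" using ts0 st by auto
    have e: "\<kappa> / 8 > 0" using \<kappa> by simp
    have "\<forall>\<^sub>F n in sequentially. False"
      using u_ev[OF e] v_ev[OF e] order_tendstoD(1)[OF q_lim, of "(norm (x - y))\<^sup>2 / (2 * \<epsilon>) - \<kappa> / 8", simplified, OF \<kappa>]
    proof eventually_elim
      case (elim n)
      have nn: "0 \<le> 8 * M * (phase \<beta> g (T (r n)) (S (r n)) (A (r n)))\<^sup>2" "0 \<le> \<eta> * T (r n)"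
        "0 \<le> \<alpha> * ln (1 + (norm (A (r n)))\<^sup>2)" using par TS[of "r n"] M by auto
      have "?P (T (r n)) (S (r n)) (A (r n)) (B (r n))
         \<le> u (T (r n), A (r n)) - v (S (r n), B (r n)) - (norm (A (r n) - B (r n)))\<^sup>2 / (2 * \<epsilon>)"
        unfolding Phi_def using nn by linarith
      then have "l + \<kappa> / 2 < u (0, x) - v (0, y) - (norm (x - y))\<^sup>2 / (2 * \<epsilon>) + 3 * \<kappa> / 8"
        using PX2[of "r n"] elim unfolding t0 by linarith
      moreover have "u (0, x) - v (0, y) \<le> L * norm (x - y)" using init[of x] init(2)[of y] u0_lip[of x y] by linarith
      moreover have "L * norm (x - y) - (norm (x - y))\<^sup>2 / (2 * \<epsilon>) \<le> l"
      proof -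
        have "0 \<le> (L * \<epsilon> - norm (x - y))\<^sup>2 / (2 * \<epsilon>)" using par(1) by simp
        moreover have "(L * \<epsilon> - norm (x - y))\<^sup>2 / (2 * \<epsilon>) = l - L * norm (x - y) + (norm (x - y))\<^sup>2 / (2 * \<epsilon>)"
          using par(1) by (simp add: l_def power2_eq_square field_simps)
        ultimately show ?thesis by linarith
      qed
      ultimately show False using \<kappa> by linarith
    qed
    then show False by simp
  qed
  then have "s > 0" using st(2) by (simp add: zero_less_mult_iff) (metis exp_gt_zero less_le_trans zero_less_mult_pos)
  have "isCont g x" using g(1) by (simp add: continuous_on_eq_continuous_at)
  then have "(\<lambda>n. g (A (r n))) \<longlonglongrightarrow> g x" by (rule isCont_tendsto_compose[OF _ lim(3)])
  then have pen: "(\<lambda>n. (norm (A (r n) - B (r n)))\<^sup>2 / (2 * \<epsilon>) + 8 * M * (phase \<beta> g (T (r n)) (S (r n)) (A (r n)))\<^sup>2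
     + \<eta> * T (r n) + \<alpha> * ln (1 + (norm (A (r n)))\<^sup>2)) \<longlonglongrightarrow> (norm (x - y))\<^sup>2 / (2 * \<epsilon>) + 8 * M * (phase \<beta> g t s x)\<^sup>2
     + \<eta> * t + \<alpha> * ln (1 + (norm x)\<^sup>2)" (is "?p \<longlonglongrightarrow> ?q")
    unfolding phase_def using par \<open>t > 0\<close> \<open>s > 0\<close>
    by (intro tendsto_intros lim q_lim) (auto simp: add_nonneg_eq_0_iff)
  have "\<sigma> \<le> ?P t s x y"
  proof (rule field_le_epsilon)
    fix e :: real assume "e > 0"
    then have e: "e / 4 > 0" "e / 4 \<noteq> 0" by auto
    have "(\<lambda>n. \<kappa> / (real n + 2)) \<longlonglongrightarrow> 0" by real_asymp
    then have "(\<lambda>n. \<kappa> / (real (r n) + 2)) \<longlonglongrightarrow> 0"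
      using LIMSEQ_subseq_LIMSEQ[OF _ zr(2)] by (force simp: o_def)
    note ev0 = order_tendstoD(2)[OF this e(1)]
    have ev1: "\<forall>\<^sub>F n in sequentially. ?q - e / 4 < ?p n"
      by (rule order_tendstoD(1)[OF pen]) (use e in linarith)
    have "\<forall>\<^sub>F n in sequentially. \<sigma> \<le> ?P t s x y + e"
      using ev0 u_ev[OF e(1)] v_ev[OF e(1)] ev1
    proof eventually_elim
      case (elim n)
      then show ?case using PX[of "r n"] unfolding Phi_def by linarith
    qed
    then show "\<sigma> \<le> ?P t s x y + e" by simp
  qed
  then show ?thesis using that[OF \<open>t > 0\<close> \<open>s > 0\<close>] le\<sigma> pt(1,2) order_trans by blast
qed

end

section \<open>Consequences of (A3')\<close>

context comparison
begin

lemma nu_density: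
  obtains J where "J \<in> borel_measurable borel" "\<And>z. 0 \<le> J z" "\<nu> = density lborel (\<lambda>z. ennreal (J z))"
    "\<And>\<delta>. \<delta> > 0 \<Longrightarrow> integrable lborel (\<lambda>z. indicator (- ball 0 \<delta>) z * J z)"
proof -
  obtain J where J: "J \<in> borel_measurable borel" "\<And>z. 0 \<le> J z" "\<nu> = density lborel (\<lambda>z. ennreal (J z))"
    "\<And>\<delta>. \<delta> > 0 \<Longrightarrow> W11 (- cball 0 \<delta>) J"
    using A3' unfolding singular_density_def by auto
  have "integrable lborel (\<lambda>z. indicator (- ball 0 \<delta>) z * J z)" if "\<delta> > 0" for \<delta>
  proof -
    have "set_integrable lborel (- cball 0 (\<delta> / 2)) J"
      using J(4)[of "\<delta> / 2"] that by (simp add: W11_def)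
    then have "set_integrable lborel (- ball 0 \<delta>) J"
      by (rule set_integrable_subset) (use that in auto)
    then show ?thesis by (simp add: set_integrable_def)
  qed
  then show ?thesis using that J by blast
qed

text \<open>The density is cut off to the far region before it is translated, so mass carried across
  the boundary of the ball is part of the L1 error. Uniformity in \<open>V\<close> holds because
  \<open>V\<close> enters only through an indicator.\<close>

lemma measure_nu_translation:
  assumes \<delta>: "\<delta> > 0" and e: "e > 0"
  obtains d where "d > 0"
    "\<And>(h :: 'a) V. norm h < d \<Longrightarrow> V \<in> sets borel \<Longrightarrow>
       measure \<nu> {z \<in> - ball 0 \<delta>. z + h \<in> V} \<le> measure \<nu> {z \<in> - ball 0 \<delta>. z \<in> V} + e"
proof -
  obtain J where J: "J \<in> borel_measurable borel" "\<And>z. 0 \<le> J z" "\<nu> = density lborel (\<lambda>z. ennreal (J z))"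
    "\<And>\<delta>. \<delta> > 0 \<Longrightarrow> integrable lborel (\<lambda>z. indicator (- ball 0 \<delta>) z * J z)"
    using nu_density by blast
  define j where "j z = indicator (- ball 0 \<delta>) z * J z" for z
  have j: "integrable lborel j" using J(4)[OF \<delta>] unfolding j_def .
  have j0: "0 \<le> j z" for z using J(2) by (simp add: j_def)
  have jb: "j \<in> borel_measurable borel" using j by auto
  obtain d where d: "d > 0" "\<And>h. norm h < d \<Longrightarrow> (\<integral>z. \<bar>j (z + h) - j z\<bar> \<partial>lborel) \<le> e"
    using integral_abs_shift_small[OF j e] by blast
  have meas: "measure \<nu> {z \<in> - ball 0 \<delta>. z \<in> B} = (\<integral>z. j z * indicator B z \<partial>lborel)" if [measurable]: "B \<in> sets borel" for B
  proof -
    have "{z \<in> - ball 0 \<delta>. z \<in> B} \<in> sets \<nu>" by (simp add: Collect_conj_eq borel_closed flip: Compl_eq)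
    then have "measure \<nu> {z \<in> - ball 0 \<delta>. z \<in> B} = (\<integral>z. indicator {z \<in> - ball 0 \<delta>. z \<in> B} z \<partial>\<nu>)" by simp
    also have "\<dots> = (\<integral>z. J z *\<^sub>R indicator {z \<in> - ball 0 \<delta>. z \<in> B} z \<partial>lborel)"
      unfolding J(3) by (rule integral_density) (use J \<open>_ \<in> sets \<nu>\<close> in auto)
    also have "\<dots> = (\<integral>z. j z * indicator B z \<partial>lborel)"
      by (rule Bochner_Integration.integral_cong) (auto simp: j_def indicator_def)
    finally show ?thesis .
  qed
  show ?thesis
  proof (rule that[OF d(1)])
    fix h :: 'a and V assume h: "norm h < d" and V [measurable]: "V \<in> sets (borel :: 'a measure)"
    have Vh [measurable]: "{z. z + h \<in> V} \<in> sets borel" using V by measurable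
    have iV: "integrable lborel (\<lambda>z. j z * indicator V z)" "integrable lborel (\<lambda>z. j (z - h) * indicator V z)"
      "integrable lborel (\<lambda>z. \<bar>j (z - h) - j z\<bar>)"
      using j lborel_integrable_shift[OF j, of "- h"] V by (auto intro!: integrable_real_mult_indicator)
    have "measure \<nu> {z \<in> - ball 0 \<delta>. z + h \<in> V} = (\<integral>z. j z * indicator {z. z + h \<in> V} z \<partial>lborel)"
      using meas[OF Vh] by simp
    also have "\<dots> = (\<integral>z. (\<lambda>z. j (z - h) * indicator V z) (z + h) \<partial>lborel)"
      by (rule Bochner_Integration.integral_cong) (auto simp: indicator_def)
    also have "\<dots> = (\<integral>z. j (z - h) * indicator V z \<partial>lborel)"
      by (rule lborel_integral_shift) (use jb V in measurable)
    also have "\<dots> \<le> (\<integral>z. j z * indicator V z + \<bar>j (z - h) - j z\<bar> \<partial>lborel)"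
      using iV by (intro integral_mono) (auto simp: indicator_def)
    also have "\<dots> = measure \<nu> {z \<in> - ball 0 \<delta>. z \<in> V} + (\<integral>z. \<bar>j (z - h) - j z\<bar> \<partial>lborel)"
      using iV meas[OF V] by simp
    also have "(\<integral>z. \<bar>j (z - h) - j z\<bar> \<partial>lborel) \<le> e" using d(2)[of "- h"] h by simp
    finally show "measure \<nu> {z \<in> - ball 0 \<delta>. z + h \<in> V} \<le> measure \<nu> {z \<in> - ball 0 \<delta>. z \<in> V} + e" by simp
  qed
qed

text \<open>The limit hyperplane is a Lebesgue null set, hence null for \<nu>. So the indicators of
  the half spaces converge almost everywhere, dominated by that of the far region, and the two limit
  half spaces fill this region up to a null set.\<close>

lemma measure_halfspaces_tendsto:
  assumes \<delta>: "\<delta> > 0" and q: "q \<noteq> 0" "P \<longlonglongrightarrow> q" "P' \<longlonglongrightarrow> q"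
  shows "(\<lambda>n. measure \<nu> (- ball 0 \<delta>) - measure \<nu> {z \<in> - ball 0 \<delta>. 0 < P n \<bullet> z}
     - measure \<nu> {z \<in> - ball 0 \<delta>. P' n \<bullet> z < 0}) \<longlonglongrightarrow> 0"
proof -
  obtain J where J: "J \<in> borel_measurable borel" "\<nu> = density lborel (\<lambda>z. ennreal (J z))"
    using nu_density by blast
  let ?F = "- ball (0::'a) \<delta>"
  have meas: "{z \<in> ?F. 0 < p \<bullet> z} \<in> sets borel" "{z \<in> ?F. p \<bullet> z < 0} \<in> sets borel" for p
  proof -
    have "{z. 0 < p \<bullet> z} \<in> sets borel" "{z. p \<bullet> z < 0} \<in> sets borel"
      by (intro borel_open open_Collect_less continuous_intros)+
    moreover have "?F \<in> sets borel" by (simp add: borel_closed)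
    ultimately have "?F \<inter> {z. 0 < p \<bullet> z} \<in> sets borel" "?F \<inter> {z. p \<bullet> z < 0} \<in> sets borel" by blast+
    then show "{z \<in> ?F. 0 < p \<bullet> z} \<in> sets borel" "{z \<in> ?F. p \<bullet> z < 0} \<in> sets borel"
      by (simp_all add: Collect_conj_eq)
  qed
  have "{z. q \<bullet> z = 0} \<in> null_sets lborel"
    using negligible_hyperplane[of q 0] q(1) by (simp add: negligible_iff_null_sets null_sets_completion_iff
        borel_closed closed_hyperplane)
  then have "AE z in lborel. q \<bullet> z \<noteq> 0" using AE_not_in by fastforce
  then have ae: "AE z in \<nu>. q \<bullet> z \<noteq> 0"
    unfolding J(2) by (subst AE_density) (use J(1) in auto)
  have iF: "integrable \<nu> (indicator ?F :: 'a \<Rightarrow> real)"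
    using fmeasurable_far[OF \<delta>] by (intro integrable_real_indicator) (auto simp: fmeasurable_def)
  have conv: "(\<lambda>n. measure \<nu> (A n)) \<longlonglongrightarrow> measure \<nu> B"
    if A: "\<And>n. A n \<in> sets borel" "\<And>n. A n \<subseteq> ?F" and B: "B \<in> sets borel" "B \<subseteq> ?F"
      and ev: "\<And>z. q \<bullet> z \<noteq> 0 \<Longrightarrow> \<forall>\<^sub>F n in sequentially. (z \<in> A n) = (z \<in> B)" for A B
  proof -
    have "(\<lambda>n. \<integral>z. indicator (A n) z \<partial>\<nu>) \<longlonglongrightarrow> (\<integral>z. indicator B z \<partial>\<nu> :: real)"
    proof (rule integral_dominated_convergence[where w = "indicator ?F"])
      show "AE z in \<nu>. (\<lambda>n. indicator (A n) z :: real) \<longlonglongrightarrow> indicator B z"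
        using ae
      proof eventually_elim
        case (elim z)
        have "\<forall>\<^sub>F n in sequentially. indicator (A n) z = (indicator B z :: real)"
          using ev[OF elim] by eventually_elim (simp add: indicator_def)
        then show ?case by (rule tendsto_eventually)
      qed
      show "AE z in \<nu>. norm (indicator (A n) z :: real) \<le> indicator ?F z" for n
        using A(2)[of n] by (intro AE_I2) (auto simp: indicator_def)
    qed (use A B iF in auto)
    then show ?thesis using A B by simp
  qed
  have e1: "\<forall>\<^sub>F n in sequentially. (z \<in> {z \<in> ?F. 0 < P n \<bullet> z}) = (z \<in> {z \<in> ?F. 0 < q \<bullet> z})" if nz: "q \<bullet> z \<noteq> 0" for z
  proof -
    have l: "(\<lambda>n. P n \<bullet> z) \<longlonglongrightarrow> q \<bullet> z" by (intro tendsto_intros q)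
    consider "q \<bullet> z > 0" | "q \<bullet> z < 0" using nz by linarith
    then show ?thesis
    proof cases
      case 1
      from order_tendstoD(1)[OF l 1] show ?thesis by (rule eventually_mono) (use 1 in auto)
    next
      case 2
      from order_tendstoD(2)[OF l 2] show ?thesis by (rule eventually_mono) (use 2 in auto)
    qed
  qed
  have e2: "\<forall>\<^sub>F n in sequentially. (z \<in> {z \<in> ?F. P' n \<bullet> z < 0}) = (z \<in> {z \<in> ?F. q \<bullet> z < 0})" if nz: "q \<bullet> z \<noteq> 0" for z
  proof -
    have l: "(\<lambda>n. P' n \<bullet> z) \<longlonglongrightarrow> q \<bullet> z" by (intro tendsto_intros q)
    consider "q \<bullet> z > 0" | "q \<bullet> z < 0" using nz by linarith
    then show ?thesis
    proof cases
      case 1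
      from order_tendstoD(1)[OF l 1] show ?thesis by (rule eventually_mono) (use 1 in auto)
    next
      case 2
      from order_tendstoD(2)[OF l 2] show ?thesis by (rule eventually_mono) (use 2 in auto)
    qed
  qed
  have "(\<lambda>n. measure \<nu> ?F - measure \<nu> {z \<in> ?F. 0 < P n \<bullet> z} - measure \<nu> {z \<in> ?F. P' n \<bullet> z < 0})
     \<longlonglongrightarrow> measure \<nu> ?F - measure \<nu> {z \<in> ?F. 0 < q \<bullet> z} - measure \<nu> {z \<in> ?F. q \<bullet> z < 0}"
    by (intro tendsto_diff tendsto_const conv e1 e2 meas) auto
  moreover have "measure \<nu> ?F = measure \<nu> {z \<in> ?F. 0 < q \<bullet> z} + measure \<nu> {z \<in> ?F. q \<bullet> z < 0}"
  proof -
    have "measure \<nu> ?F = measure \<nu> ({z \<in> ?F. 0 < q \<bullet> z} \<union> {z \<in> ?F. q \<bullet> z < 0})"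
      using ae meas by (intro measure_eq_AE) (auto simp: borel_closed)
    also have "\<dots> = measure \<nu> {z \<in> ?F. 0 < q \<bullet> z} + measure \<nu> {z \<in> ?F. q \<bullet> z < 0}"
    proof -
      have "{z \<in> ?F. q \<bullet> z < 0} - {z \<in> ?F. 0 < q \<bullet> z} = {z \<in> ?F. q \<bullet> z < 0}" by auto
      moreover have "{z \<in> ?F. 0 < q \<bullet> z} \<in> fmeasurable \<nu>" "{z \<in> ?F. q \<bullet> z < 0} \<in> fmeasurable \<nu>"
        by (intro fmeasurable_far_subset[OF \<delta>] meas, blast)+
      ultimately show ?thesis
        using measure_Un2[of "{z \<in> ?F. 0 < q \<bullet> z}" \<nu> "{z \<in> ?F. q \<bullet> z < 0}"] by (simp only:)
    qed
    finally show ?thesis .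
  qed
  ultimately show ?thesis by simp
qed

text \<open>A lower bound on |p| bounds |p|/(2h) from below, so a single paraboloid parameter \<rho>
  < 1 serves all these p. (A3') at this fixed parameter gives smallness for small radius, uniformly
  in direction.\<close>

lemma near_measure_uniformly_small:
  assumes e: "e > 0" and r: "r > 0" and h: "h > 0"
  obtains \<delta> where "0 < \<delta>" "\<delta> \<le> 1" "\<And>p. norm p \<ge> r \<Longrightarrow> measure \<nu> (near_set \<delta> h p) \<le> e"
proof -
  define \<rho> where "\<rho> = min (1 / 2) (r / (2 * h))"
  have \<rho>: "0 < \<rho>" "\<rho> < 1" "\<rho> \<le> r / (2 * h)" using r h by (auto simp: \<rho>_def)
  have "uniform_limit (sphere 0 1 \<times> {0<..<1})
       (\<lambda>\<delta> (e, r). r * measure \<nu> (paraboloid_set \<delta> r e)) (\<lambda>_. 0) (at_right 0)"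
    using A3' by (simp add: singular_density_def)
  then have "\<forall>\<^sub>F \<delta> in at_right 0. \<forall>x\<in>sphere 0 1 \<times> {0<..<1}.
      dist ((\<lambda>(e, r). r * measure \<nu> (paraboloid_set \<delta> r e)) x) 0 < e * \<rho>"
    by (rule uniform_limitD) (use e \<rho> in auto)
  then obtain b where b: "b > 0" "\<And>\<delta> a r. 0 < \<delta> \<Longrightarrow> \<delta> < b \<Longrightarrow> norm a = 1 \<Longrightarrow> 0 < r \<Longrightarrow> r < 1 \<Longrightarrow>
      r * measure \<nu> (paraboloid_set \<delta> r a) < e * \<rho>"
    unfolding eventually_at_right_field by (force simp: dist_real_def)
  define \<delta> where "\<delta> = min (b / 2) \<rho>"
  have \<delta>: "0 < \<delta>" "\<delta> < b" "\<delta> \<le> \<rho>" using b(1) \<rho> by (auto simp: \<delta>_def)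
  show ?thesis
  proof (rule that[of \<delta>])
    show "0 < \<delta>" "\<delta> \<le> 1" using \<delta> \<rho> by auto
    fix p :: 'a assume p: "norm p \<ge> r"
    then have p0: "p \<noteq> 0" using r by auto
    have "r / (2 * h) \<le> norm p / (2 * h)" using p h by (intro divide_right_mono) auto
    then have "near_set \<delta> h p \<subseteq> paraboloid_set \<delta> \<rho> (sgn p)"
      using \<delta> \<rho> by (intro near_set_subset_paraboloid p0 h) auto
    then have "measure \<nu> (near_set \<delta> h p) \<le> measure \<nu> (paraboloid_set \<delta> \<rho> (sgn p))"
      using p0 \<delta> \<rho> by (intro measure_mono_fmeasurable fmeasurable_paraboloid) (auto simp: norm_sgn)
    then have "\<rho> * measure \<nu> (near_set \<delta> h p) \<le> \<rho> * measure \<nu> (paraboloid_set \<delta> \<rho> (sgn p))"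
      using \<rho> by (intro mult_left_mono) auto
    also have "\<dots> \<le> e * \<rho>" using b(2)[OF \<delta>(1,2), of "sgn p" \<rho>] p0 \<rho> by (simp add: norm_sgn)
    finally show "measure \<nu> (near_set \<delta> h p) \<le> e" using \<rho>(1) by (simp add: mult.commute)
  qed
qed

section \<open>Viscosity inequalities at a maximum point\<close>

definition C11 :: "real \<Rightarrow> ('a \<Rightarrow> real) \<Rightarrow> ('a \<Rightarrow> 'a) \<Rightarrow> bool" where
  "C11 C g D \<longleftrightarrow> (\<forall>x z. \<bar>g (x + z) - g x - D x \<bullet> z\<bar> \<le> C * (norm z)\<^sup>2)"

text \<open>The right-hand sides of the viscosity inequalities, with the test function kept only in the
  ball of radius \<open>\<delta>\<close> and replaced by the solution itself outside.\<close>
definition Tu :: "real \<Rightarrow> real \<Rightarrow> real \<Rightarrow> 'a \<Rightarrow> 'a \<Rightarrow> real" where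
  "Tu \<delta> h t x q = sig \<mu> q * (c x + (measure \<nu> (near_set \<delta> h q)
     + measure \<nu> {z \<in> - ball 0 \<delta>. u (t, x) \<le> u (t, x + z)}
     - measure \<nu> {z \<in> - ball 0 \<delta>. 0 < q \<bullet> z}))"

definition Tv :: "real \<Rightarrow> real \<Rightarrow> real \<Rightarrow> 'a \<Rightarrow> 'a \<Rightarrow> real" where
  "Tv \<delta> h s y p = sig \<mu> p * (c y - (measure \<nu> (near_set \<delta> h p)
     + measure \<nu> {z \<in> - ball 0 \<delta>. v (s, y + z) \<le> v (s, y)}
     - measure \<nu> {z \<in> - ball 0 \<delta>. p \<bullet> z < 0}))"

text \<open>The second-order coefficients of the penalties in x: 1/(2\<epsilon>) from the distance;
  8M times C (Taylor remainder of \<open>g\<close>, with |2W| <= 1) plus 2 (squared increment of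
  \<open>g\<close>); 1 from the logarithm, as \<alpha> <= 1. The value is independent of \<alpha>,
  \<beta> and, apart from C, of \<open>g\<close>.\<close>

definition hess :: "real \<Rightarrow> real \<Rightarrow> real" where
  "hess C \<epsilon> = 1 / (2 * \<epsilon>) + 8 * M * (C + 2) + 1"

definition grad_u :: "real \<Rightarrow> real \<Rightarrow> real \<Rightarrow> ('a \<Rightarrow> real) \<Rightarrow> ('a \<Rightarrow> 'a) \<Rightarrow> real \<Rightarrow> real \<Rightarrow> 'a \<Rightarrow> 'a \<Rightarrow> 'a" where
  "grad_u \<epsilon> \<alpha> \<beta> g D t s x y = (1 / \<epsilon>) *\<^sub>R (x - y) + (16 * M * phase \<beta> g t s x) *\<^sub>R D x
     + (2 * \<alpha> / (1 + (norm x)\<^sup>2)) *\<^sub>R x"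

lemma norm_add_power2: "(norm (a + b))\<^sup>2 = (norm a)\<^sup>2 + 2 * (a \<bullet> b) + (norm b)\<^sup>2" for a b :: 'a
  by (simp add: power2_norm_eq_inner inner_add_left inner_add_right inner_commute)

lemma ln_penalty_le:
  "ln (1 + (norm (x + z))\<^sup>2) - ln (1 + (norm x)\<^sup>2) \<le> (2 / (1 + (norm x)\<^sup>2)) * (x \<bullet> z) + (norm z)\<^sup>2" for x z :: 'a
proof -
  define a b where "a = 1 + (norm x)\<^sup>2" and "b = 1 + (norm (x + z))\<^sup>2"
  have ab: "a \<ge> 1" "b \<ge> 1" by (auto simp: a_def b_def)
  have "ln b - ln a = ln (b / a)" using ab by (simp add: ln_div)
  also have "\<dots> \<le> b / a - 1" using ab by (intro ln_le_minus_one) auto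
  also have "\<dots> = (b - a) / a" using ab by (simp add: field_simps)
  also have "b - a = 2 * (x \<bullet> z) + (norm z)\<^sup>2" unfolding a_def b_def norm_add_power2 by simp
  also have "(2 * (x \<bullet> z) + (norm z)\<^sup>2) / a = (2 / a) * (x \<bullet> z) + (norm z)\<^sup>2 / a" by (simp add: add_divide_distrib)
  also have "(norm z)\<^sup>2 / a \<le> (norm z)\<^sup>2 / 1" using ab by (intro divide_left_mono) auto
  finally show ?thesis by (simp add: a_def b_def)
qed

text \<open>With (s, y) frozen, maximality bounds \<open>u\<close> by the penalties, which are in
  turn bounded by a paraboloid. With (t, x) frozen the same applies to -v; an increase of ln s
  lowers the phase, so W enters with the opposite sign.\<close>

lemma Phi_max_inequalities:
  assumes par: "\<epsilon> > 0" "\<eta> > 0" "0 < \<alpha>" "\<alpha> \<le> 1" "\<beta> > 0"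
    and g: "C11 C g D" "C \<ge> 0" "\<And>x z. \<bar>g (x + z) - g x\<bar> \<le> norm z"
    and ts: "t > 0" "s > 0" and pos: "Phi \<epsilon> \<eta> \<alpha> \<beta> g t s x y > 0"
    and max: "\<And>t' s' x' y'. t' > 0 \<Longrightarrow> s' > 0 \<Longrightarrow> Phi \<epsilon> \<eta> \<alpha> \<beta> g t' s' x' y' \<le> Phi \<epsilon> \<eta> \<alpha> \<beta> g t s x y"
    and \<delta>: "0 < \<delta>" "\<delta> \<le> 1"
  shows "16 * M * phase \<beta> g t s x / (\<beta> * t) + \<eta> \<le> Tu \<delta> (hess C \<epsilon>) t x (grad_u \<epsilon> \<alpha> \<beta> g D t s x y)"
    and "Tv \<delta> (hess C \<epsilon>) s y ((1 / \<epsilon>) *\<^sub>R (x - y)) \<le> 16 * M * phase \<beta> g t s x / (\<beta> * s)"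
proof -
  define W where "W = phase \<beta> g t s x"
  define h where "h = hess C \<epsilon>"
  define p where "p = (1 / \<epsilon>) *\<^sub>R (x - y)"
  define q where "q = grad_u \<epsilon> \<alpha> \<beta> g D t s x y"
  have W: "\<bar>W\<bar> \<le> 1 / 2" using Phi_pos_bounds(2)[OF par(1-3) ts pos] by (simp add: W_def)
  have h: "h > 0" using par M g(2) by (simp add: h_def hess_def add_nonneg_pos)
  have k: "8 * M > 0" using M by simp
  have quad: "(norm (x - y + z))\<^sup>2 / (2 * \<epsilon>) - (norm (x - y))\<^sup>2 / (2 * \<epsilon>) = p \<bullet> z + (norm z)\<^sup>2 / (2 * \<epsilon>)" for z
  proof -
    have "p \<bullet> z = ((x - y) \<bullet> z) / \<epsilon>" unfolding p_def inner_scaleR_left by simp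
    then show ?thesis unfolding norm_add_power2 using par by (simp add: field_simps)
  qed
  have u_le: "u (t', x') \<le> u (t, x) + (q \<bullet> (x' - x) + h * (norm (x' - x))\<^sup>2)
      + \<eta> * (t' - t) + 8 * M * (2 * W * (ln (t' / t) / \<beta>) + 2 * (ln (t' / t) / \<beta>)\<^sup>2)" if t': "t' > 0" for t' x'
  proof -
    define z where "z = x' - x"
    have x': "x' = x + z" by (simp add: z_def)
    define \<tau> where "\<tau> = ln (t' / t) / \<beta>"
    define \<gamma> where "\<gamma> = g x' - g x"
    have "phase \<beta> g t' s x' = W + (\<tau> + \<gamma>)"
      using ts t' by (simp add: W_def phase_def \<tau>_def \<gamma>_def ln_div diff_divide_distrib)
    then have ph: "(phase \<beta> g t' s x')\<^sup>2 - W\<^sup>2 = 2 * W * \<tau> + 2 * W * \<gamma> + (\<tau> + \<gamma>)\<^sup>2"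
      by (simp add: power2_eq_square algebra_simps)
    \<comment> \<open>Decouples the increments in time and space at the price of a factor 2.\<close>
    have sq: "(\<tau> + \<gamma>)\<^sup>2 \<le> 2 * \<tau>\<^sup>2 + 2 * \<gamma>\<^sup>2"
      using zero_le_power2[of "\<tau> - \<gamma>"] by (simp add: power2_eq_square algebra_simps)
    have "\<gamma>\<^sup>2 \<le> (norm z)\<^sup>2" using g(3)[of x z] by (simp add: \<gamma>_def x' abs_le_square_iff[symmetric])
    moreover have "2 * W * \<gamma> \<le> 2 * W * (D x \<bullet> z) + C * (norm z)\<^sup>2"
    proof -
      have "\<bar>2 * W * (\<gamma> - D x \<bullet> z)\<bar> \<le> 1 * (C * (norm z)\<^sup>2)"
        unfolding abs_mult[of "2 * W"] using W g(1) by (intro mult_mono) (auto simp: C11_def \<gamma>_def x')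
      then show ?thesis by (simp add: right_diff_distrib abs_le_iff)
    qed
    ultimately have "(phase \<beta> g t' s x')\<^sup>2 - W\<^sup>2 \<le> 2 * W * \<tau> + 2 * \<tau>\<^sup>2 + 2 * W * (D x \<bullet> z) + (C + 2) * (norm z)\<^sup>2"
      using ph sq by (simp add: algebra_simps)
    then have k1: "8 * M * ((phase \<beta> g t' s x')\<^sup>2 - W\<^sup>2)
      \<le> 8 * M * (2 * W * \<tau> + 2 * \<tau>\<^sup>2 + 2 * W * (D x \<bullet> z) + (C + 2) * (norm z)\<^sup>2)"
      using k by (intro mult_left_mono) auto
    have k2: "\<alpha> * (ln (1 + (norm x')\<^sup>2) - ln (1 + (norm x)\<^sup>2)) \<le> \<alpha> * ((2 / (1 + (norm x)\<^sup>2)) * (x \<bullet> z)) + 1 * (norm z)\<^sup>2"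
    proof -
      have "\<alpha> * (ln (1 + (norm x')\<^sup>2) - ln (1 + (norm x)\<^sup>2)) \<le> \<alpha> * ((2 / (1 + (norm x)\<^sup>2)) * (x \<bullet> z) + (norm z)\<^sup>2)"
        unfolding x' using ln_penalty_le par by (intro mult_left_mono) auto
      also have "\<dots> \<le> \<alpha> * ((2 / (1 + (norm x)\<^sup>2)) * (x \<bullet> z)) + 1 * (norm z)\<^sup>2"
        unfolding distrib_left using par by (intro add_left_mono mult_right_mono) auto
      finally show ?thesis .
    qed
    have "Phi \<epsilon> \<eta> \<alpha> \<beta> g t' s x' y \<le> Phi \<epsilon> \<eta> \<alpha> \<beta> g t s x y" by (rule max) (use t' ts in auto)
    then have "u (t', x') \<le> u (t, x) + ((norm (x - y + z))\<^sup>2 / (2 * \<epsilon>) - (norm (x - y))\<^sup>2 / (2 * \<epsilon>))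
       + 8 * M * ((phase \<beta> g t' s x')\<^sup>2 - W\<^sup>2) + \<eta> * (t' - t) + \<alpha> * (ln (1 + (norm x')\<^sup>2) - ln (1 + (norm x)\<^sup>2))"
      unfolding Phi_def W_def[symmetric] x' by (simp add: algebra_simps)
    also have "\<dots> \<le> u (t, x) + (p \<bullet> z + (norm z)\<^sup>2 / (2 * \<epsilon>))
       + 8 * M * (2 * W * \<tau> + 2 * \<tau>\<^sup>2 + 2 * W * (D x \<bullet> z) + (C + 2) * (norm z)\<^sup>2) + \<eta> * (t' - t)
       + (\<alpha> * ((2 / (1 + (norm x)\<^sup>2)) * (x \<bullet> z)) + 1 * (norm z)\<^sup>2)"
      unfolding quad using k1 k2 by linarith
    also have "\<dots> = u (t, x) + (q \<bullet> z + h * (norm z)\<^sup>2) + \<eta> * (t' - t) + 8 * M * (2 * W * \<tau> + 2 * \<tau>\<^sup>2)"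
      unfolding q_def grad_u_def h_def hess_def W_def[symmetric] p_def[symmetric]
      by (simp add: inner_add_left algebra_simps)
    finally show ?thesis by (simp add: z_def \<tau>_def)
  qed
  have v_le: "- v (s', y') \<le> - v (s, y) + (- p \<bullet> (y' - y) + h * (norm (y' - y))\<^sup>2)
      + 0 * (s' - s) + 8 * M * (2 * (- W) * (ln (s' / s) / \<beta>) + 2 * (ln (s' / s) / \<beta>)\<^sup>2)" if s': "s' > 0" for s' y'
  proof -
    define z where "z = y' - y"
    have y': "y' = y + z" by (simp add: z_def)
    define \<tau> where "\<tau> = ln (s' / s) / \<beta>"
    have phW: "phase \<beta> g t s' x = W - \<tau>"
      using ts s' by (simp add: W_def phase_def \<tau>_def ln_div diff_divide_distrib)
    have ph: "(phase \<beta> g t s' x)\<^sup>2 - W\<^sup>2 = 2 * (- W) * \<tau> + \<tau>\<^sup>2"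
      unfolding phW by (simp add: power2_eq_square algebra_simps)
    have "x - y' = x - y + - z" by (simp add: y')
    then have q2: "(norm (x - y'))\<^sup>2 / (2 * \<epsilon>) - (norm (x - y))\<^sup>2 / (2 * \<epsilon>) = - p \<bullet> z + (norm z)\<^sup>2 / (2 * \<epsilon>)"
      using quad[of "- z"] by (simp only: inner_minus_left inner_minus_right norm_minus_cancel)
    have "Phi \<epsilon> \<eta> \<alpha> \<beta> g t s' x y' \<le> Phi \<epsilon> \<eta> \<alpha> \<beta> g t s x y" by (rule max) (use s' ts in auto)
    then have "- v (s', y') \<le> - v (s, y) + ((norm (x - y'))\<^sup>2 / (2 * \<epsilon>) - (norm (x - y))\<^sup>2 / (2 * \<epsilon>))
       + 8 * M * ((phase \<beta> g t s' x)\<^sup>2 - W\<^sup>2)"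
      unfolding Phi_def W_def[symmetric] by (simp add: algebra_simps)
    also have "\<dots> \<le> - v (s, y) + (- p \<bullet> z + h * (norm z)\<^sup>2) + 8 * M * (2 * (- W) * \<tau> + 2 * \<tau>\<^sup>2)"
    proof -
      have "(1 / (2 * \<epsilon>)) * (norm z)\<^sup>2 \<le> h * (norm z)\<^sup>2"
        using M g(2) by (intro mult_right_mono) (auto simp: h_def hess_def)
      moreover have "8 * M * (2 * (- W) * \<tau> + \<tau>\<^sup>2) \<le> 8 * M * (2 * (- W) * \<tau> + 2 * \<tau>\<^sup>2)"
        using k by (intro mult_left_mono) auto
      ultimately show ?thesis unfolding q2 ph by simp
    qed
    finally show ?thesis by (simp add: z_def \<tau>_def)
  qed
  obtain A where A: "majorized u t x (2 * (8 * M) * W / (\<beta> * t) + \<eta>) A q h"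
    using majorized_log_penalty[OF u_bound ts(1) h par(5) k W u_le] by blast
  have "2 * (8 * M) * W / (\<beta> * t) + \<eta> \<le> Tu \<delta> h t x q"
    unfolding Tu_def by (rule viscosity_subsolution_nonlocal[OF sub ts(1) A mu_pos h \<delta>])
  then show "16 * M * phase \<beta> g t s x / (\<beta> * t) + \<eta> \<le> Tu \<delta> (hess C \<epsilon>) t x (grad_u \<epsilon> \<alpha> \<beta> g D t s x y)"
    by (simp add: W_def h_def q_def)
  have mW: "\<bar>- W\<bar> \<le> 1 / 2" using W by simp
  have mv: "\<bar>- v (t, x)\<bar> \<le> M" if "t \<ge> 0" for t x using v_bound[OF that] by simp
  obtain B where B: "majorized (\<lambda>\<xi>. - v \<xi>) s y (2 * (8 * M) * (- W) / (\<beta> * s) + 0) B (- p) h"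
    using majorized_log_penalty[of "\<lambda>\<xi>. - v \<xi>", OF mv ts(2) h par(5) k mW v_le] by blast
  have mp: "\<forall>e\<in>sphere 0 1. 0 < \<mu> (- e)" using mu_pos by simp
  have "2 * (8 * M) * (- W) / (\<beta> * s) + 0 \<le> sig (\<lambda>e. \<mu> (- e)) (- p) * (- c y + (measure \<nu> (near_set \<delta> h (- p))
     + measure \<nu> {z \<in> - ball 0 \<delta>. - v (s, y) \<le> - v (s, y + z)}
     - measure \<nu> {z \<in> - ball 0 \<delta>. 0 < - p \<bullet> z}))"
    by (rule viscosity_subsolution_nonlocal[OF subsolution_uminus[OF super] ts(2) B mp h \<delta>])
  also have "\<dots> = - Tv \<delta> h s y p"
    unfolding Tv_def near_set_uminus by (simp add: sig_def sgn_minus algebra_simps)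
  finally show "Tv \<delta> (hess C \<epsilon>) s y ((1 / \<epsilon>) *\<^sub>R (x - y)) \<le> 16 * M * phase \<beta> g t s x / (\<beta> * s)"
    by (simp add: W_def h_def p_def)
qed

end

section \<open>Sequences of maximum points\<close>

lemma abs_exp_minus_one_le:
  fixes y :: real
  assumes "\<bar>y\<bar> \<le> 1"
  shows "\<bar>exp y - 1\<bar> \<le> 2 * \<bar>y\<bar>"
proof (cases "y \<ge> 0")
  case True
  then have "exp y \<le> 1 + y + y\<^sup>2" using exp_bound[of y] assms by simp
  also have "y\<^sup>2 \<le> y" using True assms by (simp add: power2_eq_square mult_left_le)
  finally show ?thesis using True by simp
next
  case False
  then have "exp y < 1" by simp
  then show ?thesis using exp_ge_add_one_self[of y] False by linarith
qed

text \<open>A sequence of maximum points of the doubled functional, for fixed \<open>\<epsilon>\<close> and \<open>\<eta>\<close>.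
  The speed \<open>c\<close> may be unbounded: \<open>g n\<close> is \<open>\<plusminus>1\<close> where \<open>\<bar>c\<bar> \<ge> R n\<close>, and the resulting
  rescaling of time compensates the error made by localizing.\<close>
locale max_sequence = comparison \<nu> \<mu> c u0 u v M L Lc
  for \<nu> :: "'a::euclidean_space measure" and \<mu> c u0 u v M L Lc +
  fixes \<epsilon> \<eta> Cg Ms \<kappa> :: real and g :: "nat \<Rightarrow> 'a \<Rightarrow> real" and D :: "nat \<Rightarrow> 'a \<Rightarrow> 'a"
    and \<alpha> \<beta> K R \<theta> E B t s :: "nat \<Rightarrow> real" and x y :: "nat \<Rightarrow> 'a" and d :: 'a
  assumes par: "\<epsilon> > 0" "\<eta> > 0" "Cg \<ge> 0" "\<kappa> \<ge> 0"
    and Ms: "Ms > 0" "\<And>p. sig \<mu> p \<le> Ms * norm p"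
    and \<kappa>: "2 * Ms * Lc * \<kappa> \<le> \<eta> / 2"
    and g: "\<And>n. C11 Cg (g n) (D n)" "\<And>n x. \<bar>g n x\<bar> \<le> 1" "\<And>n x z. \<bar>g n (x + z) - g n x\<bar> \<le> K n * norm z"
    and K: "\<And>n. 0 \<le> K n" "\<And>n. K n \<le> 1" "K \<longlonglongrightarrow> 0"
    and R: "\<And>n. 0 \<le> R n" "\<And>n x. R n \<le> c x \<Longrightarrow> g n x = 1 \<and> D n x = 0"
      "\<And>n x. c x \<le> - R n \<Longrightarrow> g n x = - 1 \<and> D n x = 0"
    and E: "E \<longlonglongrightarrow> 0" and B: "filterlim B at_top sequentially"
    and \<beta>: "\<And>n. 0 < \<beta> n" "\<And>n. \<beta> n \<le> 1 / 2" "\<And>n. (R n + 1) * \<beta> n \<le> E n"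
    and \<alpha>: "\<And>n. 0 < \<alpha> n" "\<And>n. \<alpha> n \<le> 1" "\<And>n. \<alpha> n \<le> \<theta> n * E n"
    and \<theta>: "\<And>n. 0 < \<theta> n" "\<And>n. \<theta> n \<le> 1"
      "\<And>n p w. norm w \<le> \<theta> n * norm p \<Longrightarrow> sig \<mu> (p + w) \<le> exp (\<beta> n / 2) * sig \<mu> p"
      "\<And>n p w. norm w \<le> \<theta> n * norm p \<Longrightarrow> exp (- (\<beta> n / 2)) * sig \<mu> p \<le> sig \<mu> (p + w)"
    and modulus: "\<And>n p w. norm p \<le> B n \<Longrightarrow> norm w \<le> B n * ((R n + 1) * \<beta> n + \<alpha> n) \<Longrightarrow>
      R n * \<bar>sig \<mu> (p + w) - sig \<mu> p\<bar> \<le> E n"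
    and ts: "\<And>n. t n > 0" "\<And>n. s n > 0"
    and pos: "\<And>n. Phi \<epsilon> \<eta> (\<alpha> n) (\<beta> n) (g n) (t n) (s n) (x n) (y n) > 0"
    and max: "\<And>n t' s' x' y'. t' > 0 \<Longrightarrow> s' > 0 \<Longrightarrow>
      Phi \<epsilon> \<eta> (\<alpha> n) (\<beta> n) (g n) t' s' x' y' \<le> Phi \<epsilon> \<eta> (\<alpha> n) (\<beta> n) (g n) (t n) (s n) (x n) (y n)"
    and close: "\<And>n. (norm (x n - y n))\<^sup>2 \<le> \<kappa> * \<epsilon>"
    and d: "(\<lambda>n. x n - y n) \<longlonglongrightarrow> d"
begin

definition W :: "nat \<Rightarrow> real" where "W n = phase (\<beta> n) (g n) (t n) (s n) (x n)"
definition p :: "nat \<Rightarrow> 'a" where "p n = (1 / \<epsilon>) *\<^sub>R (x n - y n)"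
definition q :: "nat \<Rightarrow> 'a" where "q n = (16 * M * W n) *\<^sub>R D n (x n)"
definition a :: "nat \<Rightarrow> 'a" where "a n = (2 * \<alpha> n / (1 + (norm (x n))\<^sup>2)) *\<^sub>R x n"
definition pu :: "nat \<Rightarrow> 'a" where "pu n = p n + (q n + a n)"
definition h :: real where "h = hess Cg \<epsilon>"
definition m :: "nat \<Rightarrow> real" where "m n = s n / t n"
definition P :: real where "P = sqrt (4 * M * \<epsilon>) / \<epsilon>"
definition C0 :: real where "C0 = \<bar>c 0\<bar> + Lc"

lemma h_pos: "h > 0"
  using par M by (simp add: h_def hess_def add_nonneg_pos)

lemma W_le: "\<bar>W n\<bar> \<le> 1 / 2"
  unfolding W_def by (rule Phi_pos_bounds(2)[OF par(1,2) \<alpha>(1) ts pos])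

lemma t_le: "t n \<le> 2 * M / \<eta>"
  using Phi_pos_bounds(3)[OF par(1,2) \<alpha>(1) ts pos, of n] par(2) by (simp add: field_simps)

lemma norm_diff_le: "norm (x n - y n) \<le> sqrt (4 * M * \<epsilon>)"
  using Phi_pos_bounds(1)[OF par(1,2) \<alpha>(1) ts pos, of n] by (rule real_le_rsqrt)

lemma P_nonneg: "P \<ge> 0"
  using par M by (simp add: P_def)

lemma norm_p_le: "norm (p n) \<le> P"
  using norm_diff_le[of n] par(1) by (simp add: p_def P_def divide_right_mono)

text \<open>The definition of the phase, solved for the ratio of times. As |W| <= 1/2, the ratio is
  at least exp(\<beta>/2) where g = 1 and at most exp(-\<beta>/2) where g = -1.\<close>

lemma m_eq: "m n = exp (\<beta> n * (g n (x n) - W n))"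
proof -
  have "ln (t n / s n) = \<beta> n * (W n - g n (x n))" using \<beta>(1)[of n] by (simp add: W_def phase_def)
  then have "ln (m n) = \<beta> n * (g n (x n) - W n)"
    using ts[of n] by (simp add: m_def ln_div algebra_simps)
  moreover have "m n > 0" using ts[of n] by (simp add: m_def)
  ultimately show ?thesis by (metis exp_ln)
qed

lemma m_pos: "m n > 0"
  by (simp add: m_eq)

lemma m_near_1: "\<bar>m n - 1\<bar> \<le> 3 * \<beta> n"
proof -
  have "\<bar>g n (x n) - W n\<bar> \<le> 3 / 2" using g(2)[of n "x n"] W_le[of n] by linarith
  then have le: "\<bar>\<beta> n * (g n (x n) - W n)\<bar> \<le> \<beta> n * (3 / 2)"
    unfolding abs_mult using \<beta>(1)[of n] by (intro mult_mono) auto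
  also have "\<dots> \<le> 1" using \<beta>(2)[of n] by simp
  finally have "\<bar>exp (\<beta> n * (g n (x n) - W n)) - 1\<bar> \<le> 2 * \<bar>\<beta> n * (g n (x n) - W n)\<bar>"
    by (rule abs_exp_minus_one_le)
  then show ?thesis using le unfolding m_eq by linarith
qed

lemma m_le: "m n \<le> 5 / 2"
  using m_near_1[of n] \<beta>(2)[of n] by linarith

lemma E_pos: "E n > 0"
proof -
  have "0 < (R n + 1) * \<beta> n" using R(1)[of n] \<beta>(1)[of n] by (intro mult_pos_pos) auto
  then show ?thesis using \<beta>(3)[of n] by linarith
qed

lemma beta_le_E: "\<beta> n \<le> E n" and R_beta_le_E: "R n * \<beta> n \<le> E n"
proof -
  have "0 \<le> R n * \<beta> n" using R(1)[of n] \<beta>(1)[of n] by simp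
  then show "\<beta> n \<le> E n" "R n * \<beta> n \<le> E n" using \<beta>(1,3)[of n] by (auto simp: distrib_right)
qed

lemma alpha_le_E: "\<alpha> n \<le> E n"
proof -
  have "\<theta> n * E n \<le> 1 * E n" using \<theta>(2)[of n] E_pos[of n] by (intro mult_right_mono) auto
  then show ?thesis using \<alpha>(3)[of n] by simp
qed

lemma norm_a: "norm (a n) = 2 * \<alpha> n * norm (x n) / (1 + (norm (x n))\<^sup>2)"
  using \<alpha>(1)[of n] by (simp add: a_def add_nonneg_pos abs_of_pos add_pos_nonneg)

lemma norm_a_le: "norm (a n) \<le> \<alpha> n"
proof -
  have "0 \<le> (norm (x n) - 1)\<^sup>2" by simp
  then have "2 * norm (x n) \<le> 1 + (norm (x n))\<^sup>2" by (simp add: power2_eq_square algebra_simps)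
  then have "\<alpha> n * (2 * norm (x n)) \<le> \<alpha> n * (1 + (norm (x n))\<^sup>2)" using \<alpha>(1)[of n] by (intro mult_left_mono) auto
  then show ?thesis unfolding norm_a by (simp add: pos_divide_le_eq add_pos_nonneg mult_ac)
qed

lemma C0_nonneg: "C0 \<ge> 0"
  using Lc by (simp add: C0_def)

lemma c_growth: "\<bar>c z\<bar> \<le> C0 * (1 + norm z)"
proof -
  have "\<bar>c z\<bar> \<le> \<bar>c 0\<bar> + Lc * norm z" using c_lip[of z 0] by simp
  also have "\<dots> \<le> C0 * (1 + norm z)" using Lc by (simp add: C0_def algebra_simps)
  finally show ?thesis .
qed

text \<open>\<open>c\<close> grows at most linearly while the gradient of the logarithm decays like
  1/|x|, which is the point of a logarithmic localization. The 3 bounds 2r(1 + r)/(1 + r^2).\<close>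

lemma c_norm_a_le: "\<bar>c (x n)\<bar> * norm (a n) \<le> 3 * C0 * \<alpha> n"
proof -
  define r where "r = norm (x n)"
  have "0 \<le> (r - 1)\<^sup>2" by simp
  then have "(1 + r) * (2 * r) \<le> 3 * (1 + r\<^sup>2)" by (simp add: power2_eq_square algebra_simps)
  then have "(1 + r) * (2 * r) / (1 + r\<^sup>2) \<le> 3" by (simp add: pos_divide_le_eq add_pos_nonneg)
  then have "C0 * \<alpha> n * ((1 + r) * (2 * r) / (1 + r\<^sup>2)) \<le> C0 * \<alpha> n * 3"
    using C0_nonneg \<alpha>(1)[of n] by (intro mult_left_mono) auto
  moreover have "\<bar>c (x n)\<bar> * norm (a n) \<le> C0 * (1 + r) * norm (a n)"
    using c_growth[of "x n"] by (intro mult_right_mono) (auto simp: r_def)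
  moreover have "C0 * (1 + r) * norm (a n) = C0 * \<alpha> n * ((1 + r) * (2 * r) / (1 + r\<^sup>2))"
    unfolding norm_a r_def by simp
  ultimately show ?thesis by simp
qed

text \<open>The Taylor estimate is applied along the unit vector in the direction of the gradient,
  where \<open>g\<close> can change by at most 2.\<close>

lemma norm_D_le: "norm (D n z) \<le> 2 + Cg"
proof (cases "D n z = 0")
  case False
  have "\<bar>g n (z + sgn (D n z)) - g n z - D n z \<bullet> sgn (D n z)\<bar> \<le> Cg * (norm (sgn (D n z)))\<^sup>2"
    using g(1)[of n] unfolding C11_def by blast
  then have "\<bar>g n (z + sgn (D n z)) - g n z - D n z \<bullet> sgn (D n z)\<bar> \<le> Cg" using False by (simp add: norm_sgn)
  moreover have "D n z \<bullet> sgn (D n z) = norm (D n z)"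
    using False by (simp add: sgn_div_norm dot_square_norm power2_eq_square)
  ultimately show ?thesis using g(2)[of n z] g(2)[of n "z + sgn (D n z)"] by linarith
qed (use par in simp)

lemma key_inequalities:
  assumes "0 < \<delta>" "\<delta> \<le> 1"
  shows "16 * M * W n / (\<beta> n * t n) + \<eta> \<le> Tu \<delta> h (t n) (x n) (pu n)"
    and "Tv \<delta> h (s n) (y n) (p n) \<le> 16 * M * W n / (\<beta> n * s n)"
proof -
  have g1: "\<bar>g n (x + z) - g n x\<bar> \<le> norm z" for x z
    using g(3)[of n x z] mult_right_mono[OF K(2)[of n], of "norm z"] by simp
  have "grad_u \<epsilon> (\<alpha> n) (\<beta> n) (g n) (D n) (t n) (s n) (x n) (y n) = pu n"
    by (simp add: grad_u_def pu_def p_def q_def a_def W_def)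
  then show "16 * M * W n / (\<beta> n * t n) + \<eta> \<le> Tu \<delta> h (t n) (x n) (pu n)"
    and "Tv \<delta> h (s n) (y n) (p n) \<le> 16 * M * W n / (\<beta> n * s n)"
    using Phi_max_inequalities[OF par(1,2) \<alpha>(1)[of n] \<alpha>(2)[of n] \<beta>(1)[of n] g(1)[of n] par(3) g1
      ts(1)[of n] ts(2)[of n] pos[of n] max[where n = n] assms]
    unfolding W_def p_def h_def by simp_all
qed

text \<open>The penalty in time contributes 16MW/(\<beta>t) to one inequality and 16MW/(\<beta>s) to
  the other. The weight m = s/t makes them equal, and only \<eta> survives.\<close>

lemma difference_inequality:
  assumes "0 < \<delta>" "\<delta> \<le> 1"
  shows "\<eta> \<le> Tu \<delta> h (t n) (x n) (pu n) - m n * Tv \<delta> h (s n) (y n) (p n)"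
proof -
  have "m n * Tv \<delta> h (s n) (y n) (p n) \<le> m n * (16 * M * W n / (\<beta> n * s n))"
    using key_inequalities(2)[OF assms] m_pos[of n] by (intro mult_left_mono) auto
  also have "\<dots> = 16 * M * W n / (\<beta> n * t n)" using ts[of n] by (simp add: m_def mult_ac)
  finally show ?thesis using key_inequalities(1)[OF assms, of n] by linarith
qed

text \<open>Homogeneity of \<open>sig\<close> supplies the factor |q| that
  \<open>near_measure_bound\<close> needs; the far sets cost at most the mass outside the unit ball.
  The constant does not depend on points, times or n.\<close>

lemma nonlocal_bound:
  obtains C where "C \<ge> 0" "\<And>t x q. Tu 1 h t x q \<le> sig \<mu> q * c x + C * (1 + norm q)"
    "\<And>s y q. sig \<mu> q * c y - C * (1 + norm q) \<le> Tv 1 h s y q"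
proof -
  obtain C1 where C1: "C1 \<ge> 0"
    "\<And>(p :: 'a) h. p \<noteq> 0 \<Longrightarrow> h > 0 \<Longrightarrow> norm p * measure \<nu> (near_set 1 h p) \<le> C1 * (h + norm p)"
    using near_measure_bound by blast
  define F where "F = measure \<nu> (- ball (0::'a) 1)"
  define C where "C = Ms * (C1 * (h + 1) + F)"
  have F: "F \<ge> 0" by (simp add: F_def)
  \<comment> \<open>A set that is not measurable has measure 0 by convention, so the bound holds for
    every predicate.\<close>
  have far: "measure \<nu> {z \<in> - ball 0 1. Q z} \<le> F" for Q
  proof (cases "{z \<in> - ball (0::'a) 1. Q z} \<in> sets \<nu>")
    case True
    then show ?thesis unfolding F_def using fmeasurable_far[of 1] by (intro measure_mono_fmeasurable) auto
  qed (simp add: measure_notin_sets F)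
  have bd: "sig \<mu> q * (measure \<nu> (near_set 1 h q) + measure \<nu> {z \<in> - ball 0 1. Q z} - measure \<nu> {z \<in> - ball 0 1. Q' z})
      \<le> C * (1 + norm q)" for q Q Q'
  proof -
    have "measure \<nu> (near_set 1 h q) + measure \<nu> {z \<in> - ball 0 1. Q z} - measure \<nu> {z \<in> - ball 0 1. Q' z}
      \<le> measure \<nu> (near_set 1 h q) + F"
      using far[of Q] measure_nonneg[of \<nu> "{z \<in> - ball 0 1. Q' z}"] by linarith
    then have "sig \<mu> q * (measure \<nu> (near_set 1 h q) + measure \<nu> {z \<in> - ball 0 1. Q z} - measure \<nu> {z \<in> - ball 0 1. Q' z})
      \<le> sig \<mu> q * (measure \<nu> (near_set 1 h q) + F)" by (intro mult_left_mono sig_nonneg)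
    also have "\<dots> \<le> Ms * norm q * (measure \<nu> (near_set 1 h q) + F)"
      using F by (intro mult_right_mono Ms(2)) auto
    also have "\<dots> = Ms * (norm q * measure \<nu> (near_set 1 h q) + norm q * F)" by (simp add: algebra_simps)
    also have "\<dots> \<le> Ms * (C1 * (h + norm q) + norm q * F)"
    proof (cases "q = 0")
      case False
      then show ?thesis using C1(2)[OF False h_pos] Ms(1) by (intro mult_left_mono add_right_mono) auto
    qed (use C1(1) h_pos Ms(1) in auto)
    also have "\<dots> \<le> Ms * ((C1 * (h + 1) + F) * (1 + norm q))"
    proof -
      have "0 \<le> C1 * (h * norm q)" "0 \<le> C1" using C1(1) h_pos by auto
      then show ?thesis using Ms(1) F by (intro mult_left_mono) (auto simp: algebra_simps)
    qed
    finally show ?thesis by (simp add: C_def mult_ac)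
  qed
  show ?thesis
  proof (rule that[of C])
    show "C \<ge> 0" using Ms(1) C1(1) h_pos F by (simp add: C_def)
    show "Tu 1 h t x q \<le> sig \<mu> q * c x + C * (1 + norm q)" for t x q
      unfolding Tu_def distrib_left[of "sig \<mu> q" "c x"]
      using bd[of q "\<lambda>z. u (t, x) \<le> u (t, x + z)" "\<lambda>z. 0 < q \<bullet> z"] by linarith
    show "sig \<mu> q * c y - C * (1 + norm q) \<le> Tv 1 h s y q" for s y q
      unfolding Tv_def right_diff_distrib[of "sig \<mu> q" "c y"]
      using bd[of q "\<lambda>z. v (s, y + z) \<le> v (s, y)" "\<lambda>z. q \<bullet> z < 0"] by linarith
  qed
qed

text \<open>In the region where \<open>D n\<close> does not vanish the speed, and hence the time derivative, is
  controlled by \<open>R n\<close>.\<close>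
lemma q_le:
  obtains C where "C \<ge> 0" "\<And>n. norm (q n) \<le> C * ((R n + 1) * \<beta> n)"
proof -
  obtain C where C: "C \<ge> 0" "\<And>t x q. Tu 1 h t x q \<le> sig \<mu> q * c x + C * (1 + norm q)"
    "\<And>s y q. sig \<mu> q * c y - C * (1 + norm q) \<le> Tv 1 h s y q"
    using nonlocal_bound by blast
  define P2 where "P2 = P + 8 * M * (2 + Cg) + 1"
  define T where "T = 2 * M / \<eta>"
  define l where "l = Lc * sqrt (4 * M * \<epsilon>)"
  define C2 where "C2 = (5 / 2) * T * (Ms * P2 * (1 + l) + C * (1 + P2))"
  have P2: "P \<le> P2" "P2 \<ge> 0" using P_nonneg M par(3) by (auto simp: P2_def)
  have l: "l \<ge> 0" using Lc M par(1) by (simp add: l_def)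
  have T: "T \<ge> 0" using M par by (simp add: T_def)
  have C2: "C2 \<ge> 0" unfolding C2_def using T Ms(1) P2 l C(1) by (intro mult_nonneg_nonneg add_nonneg_nonneg) auto
  have "norm (q n) \<le> C2 * (2 + Cg) * ((R n + 1) * \<beta> n)" for n
  proof (cases "\<bar>c (x n)\<bar> < R n")
    case False
    then have "D n (x n) = 0" using R(2)[of n "x n"] R(3)[of "x n" n] by (auto simp: abs_if split: if_splits)
    then show ?thesis using C2 par(3) R(1)[of n] \<beta>(1)[of n] by (simp add: q_def)
  next
    case True
    \<comment> \<open>The penalty contributes b/t and b/s to the time derivatives. The inequality
      for \<open>u\<close> bounds b from above and the one for \<open>v\<close> from below, both by
      multiples of R + 1; multiplying by \<beta> recovers the coefficient of \<open>D n\<close> in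
      \<open>q n\<close>.\<close>
    define b where "b = 16 * M * W n / \<beta> n"
    have qn: "norm (q n) \<le> 8 * M * (2 + Cg)"
    proof -
      have "\<bar>16 * M * W n\<bar> \<le> 8 * M" using W_le[of n] M by (simp add: abs_mult)
      then show ?thesis unfolding q_def norm_scaleR using norm_D_le[of n "x n"] M by (intro mult_mono) auto
    qed
    have pun: "norm (pu n) \<le> P2"
      using norm_triangle_ineq[of "p n" "q n + a n"] norm_triangle_ineq[of "q n" "a n"]
        qn norm_p_le[of n] norm_a_le[of n] \<alpha>(2)[of n] by (simp add: pu_def P2_def)
    have pn: "norm (p n) \<le> P2" using norm_p_le[of n] P2 by linarith
    have gen: "Ms * P2 * (R n + l) + C * (1 + P2) \<le> (Ms * P2 * (1 + l) + C * (1 + P2)) * (R n + 1)"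
    proof -
      have "0 \<le> Ms * P2" "0 \<le> Ms * P2 * (l * R n)" "0 \<le> C * (1 + P2) * R n" using Ms(1) P2 l R(1)[of n] C(1) by auto
      then show ?thesis by (simp add: algebra_simps)
    qed
    have X: "X * (Ms * P2 * (R n + l) + C * (1 + P2)) \<le> C2 * (R n + 1)" if "0 \<le> X" "X \<le> (5 / 2) * T" for X
    proof -
      have "X * (Ms * P2 * (R n + l) + C * (1 + P2)) \<le> (5 / 2) * T * ((Ms * P2 * (1 + l) + C * (1 + P2)) * (R n + 1))"
        using that gen Ms(1) P2 l R(1)[of n] C(1) by (intro mult_mono) auto
      then show ?thesis by (simp add: C2_def mult_ac)
    qed
    have b_up: "b \<le> C2 * (R n + 1)"
    proof -
      have "b / t n \<le> Tu 1 h (t n) (x n) (pu n)" using key_inequalities(1)[of 1 n] par(2) by (simp add: b_def)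
      also have "\<dots> \<le> sig \<mu> (pu n) * c (x n) + C * (1 + norm (pu n))" by (rule C(2))
      also have "\<dots> \<le> Ms * P2 * (R n + l) + C * (1 + P2)"
      proof (intro add_mono mult_left_mono)
        have "sig \<mu> (pu n) * c (x n) \<le> sig \<mu> (pu n) * (R n + l)"
          using True l by (intro mult_left_mono sig_nonneg) auto
        also have "\<dots> \<le> Ms * P2 * (R n + l)"
          using Ms pun R(1)[of n] l order_trans[OF Ms(2)[of "pu n"] mult_left_mono[OF pun]]
          by (intro mult_right_mono) auto
        finally show "sig \<mu> (pu n) * c (x n) \<le> Ms * P2 * (R n + l)" .
      qed (use pun C(1) in auto)
      finally have "b \<le> t n * (Ms * P2 * (R n + l) + C * (1 + P2))"
        using ts(1)[of n] by (simp add: pos_divide_le_eq mult.commute)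
      also have "\<dots> \<le> C2 * (R n + 1)" using ts(1)[of n] t_le[of n] T by (intro X) (auto simp: T_def)
      finally show ?thesis .
    qed
    have b_lo: "- b \<le> C2 * (R n + 1)"
    proof -
      have cy: "- c (y n) \<le> R n + l"
      proof -
        have "\<bar>c (x n) - c (y n)\<bar> \<le> l"
          using c_lip[of "x n" "y n"] mult_left_mono[OF norm_diff_le[of n] Lc] by (simp add: l_def)
        then show ?thesis using True by linarith
      qed
      have "Tv 1 h (s n) (y n) (p n) \<le> b / s n" using key_inequalities(2)[of 1 n] by (simp add: b_def)
      then have "- b / s n \<le> sig \<mu> (p n) * (- c (y n)) + C * (1 + norm (p n))"
        using C(3)[of "p n" "y n" "s n"] by simp
      also have "\<dots> \<le> Ms * P2 * (R n + l) + C * (1 + P2)"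
      proof (intro add_mono mult_left_mono)
        have "sig \<mu> (p n) * (- c (y n)) \<le> sig \<mu> (p n) * (R n + l)"
          using cy by (intro mult_left_mono sig_nonneg)
        also have "\<dots> \<le> Ms * P2 * (R n + l)"
          using Ms pn R(1)[of n] l order_trans[OF Ms(2)[of "p n"] mult_left_mono[OF pn]]
          by (intro mult_right_mono) auto
        finally show "sig \<mu> (p n) * (- c (y n)) \<le> Ms * P2 * (R n + l)" .
      qed (use pn C(1) in auto)
      finally have "- b \<le> s n * (Ms * P2 * (R n + l) + C * (1 + P2))"
        using ts(2)[of n] by (simp only: pos_divide_le_eq mult.commute[of "s n"])
      also have "\<dots> \<le> C2 * (R n + 1)"
      proof (rule X)
        have "s n = m n * t n" using ts[of n] by (simp add: m_def)
        also have "\<dots> \<le> (5 / 2) * T" using m_le[of n] t_le[of n] ts(1)[of n] T by (intro mult_mono) (auto simp: T_def)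
        finally show "s n \<le> (5 / 2) * T" .
      qed (use ts(2)[of n] in auto)
      finally show ?thesis .
    qed
    have "\<bar>b\<bar> \<le> C2 * (R n + 1)" using b_up b_lo by (auto simp: abs_le_iff)
    then have "\<bar>b\<bar> * \<beta> n * norm (D n (x n)) \<le> C2 * (R n + 1) * \<beta> n * (2 + Cg)"
      using norm_D_le[of n "x n"] \<beta>(1)[of n] C2 R(1)[of n] by (intro mult_mono mult_nonneg_nonneg) auto
    moreover have "norm (q n) = \<bar>b\<bar> * \<beta> n * norm (D n (x n))"
      using \<beta>(1)[of n] by (simp add: q_def b_def abs_mult)
    ultimately have "norm (q n) \<le> C2 * (R n + 1) * \<beta> n * (2 + Cg)" by simp
    then show ?thesis by (simp add: mult_ac)
  qed
  then show ?thesis using that[of "C2 * (2 + Cg)"] C2 par(3) by auto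
qed

end

section \<open>Local terms in the limit\<close>

context max_sequence
begin

lemma q_tendsto: "q \<longlonglongrightarrow> 0" and a_tendsto: "a \<longlonglongrightarrow> 0"
proof -
  obtain C where C: "C \<ge> 0" "\<And>n. norm (q n) \<le> C * ((R n + 1) * \<beta> n)" using q_le by blast
  have "norm (q n) \<le> C * E n" for n
    using order_trans[OF C(2) mult_left_mono[OF \<beta>(3) C(1)]] .
  moreover have "(\<lambda>n. C * E n) \<longlonglongrightarrow> 0" using tendsto_mult_right_zero[OF E] by simp
  ultimately show "q \<longlonglongrightarrow> 0" by (metis (no_types, lifting) Lim_null_comparison always_eventually)
  have "norm (a n) \<le> E n" for n using norm_a_le[of n] alpha_le_E[of n] by linarith
  then show "a \<longlonglongrightarrow> 0" using E by (metis (no_types, lifting) Lim_null_comparison always_eventually)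
qed

lemma p_tendsto: "p \<longlonglongrightarrow> (1 / \<epsilon>) *\<^sub>R d"
  unfolding p_def by (intro tendsto_intros d)

lemma pu_tendsto: "pu \<longlonglongrightarrow> (1 / \<epsilon>) *\<^sub>R d"
  using tendsto_add[OF p_tendsto tendsto_add[OF q_tendsto a_tendsto]] by (simp add: pu_def[abs_def])

lemma m_tendsto: "m \<longlonglongrightarrow> 1"
proof -
  have "\<beta> \<longlonglongrightarrow> 0"
    by (rule tendsto_sandwich[OF _ _ tendsto_const E]) (auto intro!: always_eventually less_imp_le \<beta>(1) beta_le_E)
  then have "(\<lambda>n. 3 * \<beta> n) \<longlonglongrightarrow> 0" using tendsto_mult_right_zero by blast
  then have "(\<lambda>n. m n - 1) \<longlonglongrightarrow> 0"
    by (rule Lim_null_comparison[rotated]) (use m_near_1 in simp)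
  then show ?thesis by (simp add: LIM_zero_iff)
qed

lemma sig_tendsto:
  assumes "X \<longlonglongrightarrow> z" shows "(\<lambda>n. sig \<mu> (X n)) \<longlonglongrightarrow> sig \<mu> z"
  using continuous_sig assms by (simp add: continuous_on_eq_continuous_at isCont_tendsto_compose)

lemma small_gradient_case:
  assumes "\<not> norm (a n) \<le> \<theta> n * norm (p n)"
  shows "Ms * norm (p n) * \<bar>c (x n)\<bar> \<le> 3 * Ms * C0 * E n"
proof -
  have "\<theta> n * (norm (p n) * \<bar>c (x n)\<bar>) \<le> norm (a n) * \<bar>c (x n)\<bar>"
    using assms by (simp add: mult.assoc[symmetric] mult_right_mono)
  also have "\<dots> \<le> 3 * C0 * \<alpha> n" using c_norm_a_le[of n] by (simp add: mult.commute)
  also have "\<dots> \<le> 3 * C0 * (\<theta> n * E n)" using \<alpha>(3)[of n] C0_nonneg by (intro mult_left_mono) auto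
  finally have "\<theta> n * (norm (p n) * \<bar>c (x n)\<bar>) \<le> \<theta> n * (3 * C0 * E n)" by (simp add: mult_ac)
  then have "norm (p n) * \<bar>c (x n)\<bar> \<le> 3 * C0 * E n" using \<theta>(1)[of n] by simp
  then have "Ms * (norm (p n) * \<bar>c (x n)\<bar>) \<le> Ms * (3 * C0 * E n)" using Ms(1) by (intro mult_left_mono) auto
  then show ?thesis by (simp add: mult_ac)
qed

text \<open>Where |c| >= R the phase penalty has no gradient, and m outweighs the relative error of
  \<open>sig\<close>: the product has the good sign unless p is so small that
  \<open>small_gradient_case\<close> applies. Where |c| < R the deviations of \<open>sig\<close> and
  of m remain small after multiplication by R.\<close>

lemma speed_difference:
  obtains C where "C \<ge> 0" "\<forall>\<^sub>F n in sequentially. (sig \<mu> (pu n) - m n * sig \<mu> (p n)) * c (x n) \<le> C * E n"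
proof -
  obtain C1 where C1: "C1 \<ge> 0" "\<And>n. norm (q n) \<le> C1 * ((R n + 1) * \<beta> n)" using q_le by blast
  define C where "C = 6 * Ms * C0 + (1 + 3 * Ms * P)"
  have C: "6 * Ms * C0 \<le> C" "1 + 3 * Ms * P \<le> C" "C \<ge> 0"
    using Ms(1) C0_nonneg P_nonneg by (auto simp: C_def)
  \<comment> \<open>\<open>P\<close> and \<open>C1\<close> depend on \<epsilon>, whereas the modulus
    assumption was fixed beforehand; this is what the divergence of \<open>B\<close> is for.\<close>
  have "\<forall>\<^sub>F n in sequentially. P + C1 + 1 \<le> B n" using B by (simp add: filterlim_at_top)
  then have "\<forall>\<^sub>F n in sequentially. (sig \<mu> (pu n) - m n * sig \<mu> (p n)) * c (x n) \<le> C * E n"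
  proof eventually_elim
    case (elim n)
    have CE: "6 * Ms * C0 * E n \<le> C * E n" using C E_pos[of n] by (intro mult_right_mono) auto
    consider "c (x n) \<ge> R n" | "c (x n) \<le> - R n" | "\<bar>c (x n)\<bar> < R n" by linarith
    then show ?case
    proof cases
      case 1
      then have g1: "g n (x n) = 1" "q n = 0" using R(2)[of n "x n"] by (auto simp: q_def)
      have c0: "0 \<le> c (x n)" using 1 R(1)[of n] by linarith
      have "\<beta> n * (1 / 2) \<le> \<beta> n * (1 - W n)" using W_le[of n] \<beta>(1)[of n] by (intro mult_left_mono) auto
      then have mg: "exp (\<beta> n / 2) \<le> m n" by (simp add: m_eq g1)
      show ?thesis
      proof (cases "norm (a n) \<le> \<theta> n * norm (p n)")
        case True
        then have "sig \<mu> (pu n) \<le> exp (\<beta> n / 2) * sig \<mu> (p n)" using \<theta>(3) by (simp add: pu_def g1)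
        also have "\<dots> \<le> m n * sig \<mu> (p n)" using mg by (intro mult_right_mono sig_nonneg)
        finally have "(sig \<mu> (pu n) - m n * sig \<mu> (p n)) * c (x n) \<le> 0"
          using c0 by (simp add: mult_nonpos_nonneg)
        also have "\<dots> \<le> C * E n" using C(3) E_pos[of n] by simp
        finally show ?thesis .
      next
        case False
        have "sig \<mu> (pu n) \<le> Ms * norm (p n) + Ms * norm (a n)"
          using Ms(2)[of "pu n"] mult_left_mono[OF norm_triangle_ineq[of "p n" "a n"], of Ms] Ms(1)
          by (simp add: pu_def g1 distrib_left)
        moreover have "0 \<le> m n * sig \<mu> (p n)" using m_pos[of n] sig_nonneg by simp
        ultimately have "(sig \<mu> (pu n) - m n * sig \<mu> (p n)) * c (x n) \<le> (Ms * norm (p n) + Ms * norm (a n)) * c (x n)"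
          using c0 by (intro mult_right_mono) auto
        also have "\<dots> = Ms * norm (p n) * \<bar>c (x n)\<bar> + Ms * (\<bar>c (x n)\<bar> * norm (a n))"
          using c0 by (simp add: algebra_simps)
        also have "\<dots> \<le> 3 * Ms * C0 * E n + Ms * (3 * C0 * E n)"
        proof (intro add_mono small_gradient_case[OF False] mult_left_mono)
          show "\<bar>c (x n)\<bar> * norm (a n) \<le> 3 * C0 * E n"
            using c_norm_a_le[of n] mult_left_mono[OF alpha_le_E[of n], of "3 * C0"] C0_nonneg by simp
        qed (use Ms(1) in simp)
        finally show ?thesis using CE by (simp add: algebra_simps)
      qed
    next
      case 2
      then have g1: "g n (x n) = - 1" "q n = 0" using R(3)[of "x n" n] by (auto simp: q_def)
      have c0: "c (x n) \<le> 0" using 2 R(1)[of n] by linarith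
      have "\<beta> n * (- 1 - W n) \<le> \<beta> n * (- 1 / 2)" using W_le[of n] \<beta>(1)[of n] by (intro mult_left_mono) auto
      then have mg: "m n \<le> exp (- (\<beta> n / 2))" by (simp add: m_eq g1)
      show ?thesis
      proof (cases "norm (a n) \<le> \<theta> n * norm (p n)")
        case True
        then have "exp (- (\<beta> n / 2)) * sig \<mu> (p n) \<le> sig \<mu> (pu n)" using \<theta>(4) by (simp add: pu_def g1)
        moreover have "m n * sig \<mu> (p n) \<le> exp (- (\<beta> n / 2)) * sig \<mu> (p n)" using mg by (intro mult_right_mono sig_nonneg)
        ultimately have "(sig \<mu> (pu n) - m n * sig \<mu> (p n)) * c (x n) \<le> 0"
          using c0 by (intro mult_nonneg_nonpos) auto
        also have "\<dots> \<le> C * E n" using C(3) E_pos[of n] by simp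
        finally show ?thesis .
      next
        case False
        have m1: "m n \<le> 1" using mg \<beta>(1)[of n] by (simp add: order_trans[OF mg])
        have "(sig \<mu> (pu n) - m n * sig \<mu> (p n)) * c (x n) \<le> (m n * sig \<mu> (p n)) * \<bar>c (x n)\<bar>"
          using c0 mult_nonneg_nonpos[OF sig_nonneg[of "pu n"] c0] by (simp add: algebra_simps)
        also have "\<dots> \<le> (1 * (Ms * norm (p n))) * \<bar>c (x n)\<bar>"
          using m1 m_pos[of n] by (intro mult_right_mono mult_mono Ms(2) sig_nonneg) auto
        also have "\<dots> \<le> 3 * Ms * C0 * E n" using small_gradient_case[OF False] by simp
        also have "\<dots> \<le> 6 * Ms * C0 * E n" using Ms(1) C0_nonneg E_pos[of n] by simp
        finally show ?thesis using CE by linarith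
      qed
    next
      case 3
      have Bn: "norm (p n) \<le> B n" using norm_p_le[of n] elim C1(1) by linarith
      have "norm (q n + a n) \<le> C1 * ((R n + 1) * \<beta> n) + 1 * \<alpha> n"
        using norm_triangle_ineq[of "q n" "a n"] C1(2)[of n] norm_a_le[of n] by linarith
      also have "\<dots> \<le> B n * ((R n + 1) * \<beta> n) + B n * \<alpha> n"
        using elim C1(1) P_nonneg R(1)[of n] \<beta>(1)[of n] \<alpha>(1)[of n] by (intro add_mono mult_right_mono) auto
      finally have "norm (q n + a n) \<le> B n * ((R n + 1) * \<beta> n + \<alpha> n)" by (simp add: distrib_left)
      from modulus[OF Bn this] have m1: "R n * \<bar>sig \<mu> (pu n) - sig \<mu> (p n)\<bar> \<le> E n" by (simp add: pu_def)
      have m2: "R n * \<bar>(1 - m n) * sig \<mu> (p n)\<bar> \<le> 3 * Ms * P * E n"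
      proof -
        have "\<bar>(1 - m n) * sig \<mu> (p n)\<bar> \<le> (3 * \<beta> n) * (Ms * P)"
          unfolding abs_mult using m_near_1[of n] Ms sig_nonneg[of "p n"] \<beta>(1)[of n]
            order_trans[OF Ms(2)[of "p n"] mult_left_mono[OF norm_p_le[of n]]]
          by (intro mult_mono) auto
        then have "R n * \<bar>(1 - m n) * sig \<mu> (p n)\<bar> \<le> R n * ((3 * \<beta> n) * (Ms * P))"
          using R(1) by (intro mult_left_mono)
        also have "\<dots> = 3 * Ms * P * (R n * \<beta> n)" by simp
        also have "\<dots> \<le> 3 * Ms * P * E n" using R_beta_le_E[of n] Ms(1) P_nonneg by (intro mult_left_mono) auto
        finally show ?thesis .
      qed
      have "(sig \<mu> (pu n) - m n * sig \<mu> (p n)) * c (x n) \<le> \<bar>sig \<mu> (pu n) - m n * sig \<mu> (p n)\<bar> * \<bar>c (x n)\<bar>"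
        by (metis abs_ge_self abs_mult)
      also have "\<dots> \<le> (\<bar>sig \<mu> (pu n) - sig \<mu> (p n)\<bar> + \<bar>(1 - m n) * sig \<mu> (p n)\<bar>) * R n"
        using 3 by (intro mult_mono) (auto simp: left_diff_distrib)
      also have "\<dots> \<le> (1 + 3 * Ms * P) * E n" using m1 m2 by (simp add: algebra_simps)
      also have "\<dots> \<le> C * E n" using C E_pos[of n] by (intro mult_right_mono) auto
      finally show ?thesis .
    qed
  qed
  then show ?thesis using that C(3) by blast
qed

text \<open>After \<open>speed_difference\<close> there remains the change of \<open>c\<close>
  between x and y, which costs at most Ms Lc |x - y|^2/\<epsilon>. The assumed closeness |x - y|^2
  <= \<kappa>\<epsilon> keeps this below \<eta>/2.\<close>

lemma local_part:
  assumes "e > 0"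
  shows "\<forall>\<^sub>F n in sequentially. sig \<mu> (pu n) * c (x n) - m n * sig \<mu> (p n) * c (y n) \<le> \<eta> / 2 * (m n) + e"
proof -
  obtain C where C: "C \<ge> 0" "\<forall>\<^sub>F n in sequentially. (sig \<mu> (pu n) - m n * sig \<mu> (p n)) * c (x n) \<le> C * E n"
    using speed_difference by blast
  have "(\<lambda>n. C * E n) \<longlonglongrightarrow> 0" using tendsto_mult_right_zero[OF E] by simp
  from order_tendstoD(2)[OF this assms] C(2) show ?thesis
  proof eventually_elim
    case (elim n)
    have "sig \<mu> (p n) * (c (x n) - c (y n)) \<le> (Ms * norm (p n)) * (Lc * norm (x n - y n))"
      using c_lip[of "x n" "y n"] sig_nonneg[of "p n"] Ms
      by (intro order_trans[OF mult_left_mono mult_right_mono[OF Ms(2)]]) (auto simp: Lc)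
    also have "\<dots> = Ms * Lc * ((norm (x n - y n))\<^sup>2 / \<epsilon>)"
      using par(1) by (simp add: p_def power2_eq_square)
    also have "\<dots> \<le> Ms * Lc * \<kappa>"
      using close[of n] par(1) Ms(1) Lc by (intro mult_left_mono) (auto simp: pos_divide_le_eq)
    also have "\<dots> \<le> \<eta> / 2"
    proof -
      have "0 \<le> Ms * Lc * \<kappa>" using Ms(1) Lc par(4) by simp
      then show ?thesis using \<kappa> by linarith
    qed
    finally have "m n * (sig \<mu> (p n) * (c (x n) - c (y n))) \<le> m n * (\<eta> / 2)"
      using m_pos[of n] by (intro mult_left_mono) auto
    then show ?case using elim by (simp add: algebra_simps)
  qed
qed

section \<open>Nonlocal terms in the limit\<close>

definition F :: "real \<Rightarrow> real" where "F \<delta> = measure \<nu> (- ball (0::'a) \<delta>)"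
definition Uu :: "real \<Rightarrow> nat \<Rightarrow> real" where
  "Uu \<delta> n = measure \<nu> {z \<in> - ball 0 \<delta>. u (t n, x n) \<le> u (t n, x n + z)}"
definition Vv :: "real \<Rightarrow> nat \<Rightarrow> real" where
  "Vv \<delta> n = measure \<nu> {z \<in> - ball 0 \<delta>. v (s n, y n + z) \<le> v (s n, y n)}"
definition Hu :: "real \<Rightarrow> nat \<Rightarrow> real" where "Hu \<delta> n = measure \<nu> {z \<in> - ball 0 \<delta>. 0 < pu n \<bullet> z}"
definition Hv :: "real \<Rightarrow> nat \<Rightarrow> real" where "Hv \<delta> n = measure \<nu> {z \<in> - ball 0 \<delta>. p n \<bullet> z < 0}"

lemma far_le:
  assumes "\<delta> > 0" shows "measure \<nu> {z \<in> - ball 0 \<delta>. Q z} \<le> F \<delta>"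
proof (cases "{z \<in> - ball (0::'a) \<delta>. Q z} \<in> sets \<nu>")
  case True
  then show ?thesis unfolding F_def using fmeasurable_far[OF assms] by (intro measure_mono_fmeasurable) auto
qed (simp add: measure_notin_sets F_def)

text \<open>The local terms consume at most half of \<eta>, since m tends to 1; the other half has
  to be paid by the nonlocal terms.\<close>

lemma nonlocal_lower_bound:
  assumes "0 < \<delta>" "\<delta> \<le> 1" "e > 0"
  shows "\<forall>\<^sub>F n in sequentially. \<eta> / 2 - e \<le>
    sig \<mu> (pu n) * (measure \<nu> (near_set \<delta> h (pu n)) + Uu \<delta> n - Hu \<delta> n)
    + m n * sig \<mu> (p n) * (measure \<nu> (near_set \<delta> h (p n)) + Vv \<delta> n - Hv \<delta> n)"
proof -
  have "(\<lambda>n. \<eta> / 2 * m n) \<longlonglongrightarrow> \<eta> / 2 * 1" by (intro tendsto_intros m_tendsto)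
  from order_tendstoD(2)[OF this, of "\<eta> / 2 + e / 2"] assms(3)
  have "\<forall>\<^sub>F n in sequentially. \<eta> / 2 * m n < \<eta> / 2 + e / 2" by simp
  moreover have "e / 2 > 0" using assms(3) by simp
  note local_part[OF this]
  ultimately show ?thesis
  proof eventually_elim
    case (elim n)
    show ?case
      using difference_inequality[OF assms(1,2), of n] elim
      unfolding Tu_def Tv_def Uu_def[symmetric] Vv_def[symmetric] Hu_def[symmetric] Hv_def[symmetric]
      by (simp add: algebra_simps)
  qed
qed

text \<open>If d = 0, both gradients tend to 0. Then (A3) makes the gradient times the near mass
  small with h fixed, and the far masses are bounded. Each term is at most \<eta>/16, the second one
  up to m <= 5/2, which falls short of the required 7\<eta>/16.\<close>

lemma limit_gradient_nonzero: "d \<noteq> 0"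
proof
  assume d0: "d = 0"
  define e where "e = \<eta> / (16 * (h + 1) * (Ms + 1))"
  have den: "16 * (h + 1) * (Ms + 1) > 0" using h_pos Ms(1) by simp
  have e: "e > 0" using par(2) den by (simp add: e_def)
  obtain \<rho> where \<rho>: "\<rho> > 0"
    "\<And>(p::'a) h. p \<noteq> 0 \<Longrightarrow> h > 0 \<Longrightarrow> norm p \<le> \<rho> * h \<Longrightarrow> norm p * measure \<nu> (near_set 1 h p) \<le> e * h"
    "\<And>p :: 'a. norm p \<le> \<rho> \<Longrightarrow> norm p * measure \<nu> (- ball (0::'a) 1) \<le> e"
    using near_measure_small[OF e] by blast
  define \<rho>' where "\<rho>' = min \<rho> (\<rho> * h)"
  have \<rho>': "\<rho>' > 0" using \<rho>(1) h_pos by (simp add: \<rho>'_def)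
  have small: "sig \<mu> w * (measure \<nu> (near_set 1 h w) + X - Y) \<le> Ms * (e * h + e)"
    if "norm w < \<rho>'" "X \<le> F 1" "0 \<le> Y" "0 \<le> X" for w X Y
  proof (cases "w = 0")
    case True
    then show ?thesis using Ms(1) e h_pos by simp
  next
    case False
    have "sig \<mu> w * (measure \<nu> (near_set 1 h w) + X - Y) \<le> sig \<mu> w * (measure \<nu> (near_set 1 h w) + F 1)"
      using that by (intro mult_left_mono sig_nonneg) auto
    also have "\<dots> \<le> Ms * norm w * (measure \<nu> (near_set 1 h w) + F 1)"
      using that by (intro mult_right_mono Ms(2)) auto
    also have "\<dots> = Ms * (norm w * measure \<nu> (near_set 1 h w) + norm w * F 1)" by (simp add: algebra_simps)
    also have "\<dots> \<le> Ms * (e * h + e)"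
      using \<rho>(2)[OF False h_pos] \<rho>(3)[of w] that(1) Ms(1) unfolding F_def \<rho>'_def
      by (intro mult_left_mono add_mono) auto
    finally show ?thesis .
  qed
  have Me: "Ms * (e * h + e) \<le> \<eta> / 16"
  proof -
    have "Ms * (e * h + e) \<le> (Ms + 1) * (e * (h + 1))"
      using e h_pos Ms(1) by (simp add: algebra_simps)
    also have "\<dots> = \<eta> / 16" using den by (simp add: e_def field_simps)
    finally show ?thesis .
  qed
  have pl: "\<forall>\<^sub>F n in sequentially. norm (p n) < \<rho>'" "\<forall>\<^sub>F n in sequentially. norm (pu n) < \<rho>'"
    using p_tendsto pu_tendsto \<rho>' unfolding tendsto_iff by (auto simp: d0 dist_norm)
  have "\<eta> / 16 > 0" using par(2) by simp
  from nonlocal_lower_bound[OF zero_less_one order_refl this] pl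
  have "\<forall>\<^sub>F n in sequentially. False"
  proof eventually_elim
    case (elim n)
    have U: "0 \<le> Uu 1 n" "Uu 1 n \<le> F 1" "0 \<le> Hu 1 n" "0 \<le> Vv 1 n" "Vv 1 n \<le> F 1" "0 \<le> Hv 1 n"
      unfolding Uu_def Hu_def Vv_def Hv_def by (rule measure_nonneg far_le[OF zero_less_one])+
    have 1: "sig \<mu> (pu n) * (measure \<nu> (near_set 1 h (pu n)) + Uu 1 n - Hu 1 n) \<le> \<eta> / 16"
      using small[OF elim(3) U(2,3,1)] Me by linarith
    have "sig \<mu> (p n) * (measure \<nu> (near_set 1 h (p n)) + Vv 1 n - Hv 1 n) \<le> \<eta> / 16"
      using small[OF elim(2) U(5,6,4)] Me by linarith
    then have "m n * (sig \<mu> (p n) * (measure \<nu> (near_set 1 h (p n)) + Vv 1 n - Hv 1 n)) \<le> m n * (\<eta> / 16)"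
      using m_pos[of n] by (intro mult_left_mono) auto
    also have "\<dots> \<le> (5 / 2) * (\<eta> / 16)" using m_le par(2) by (intro mult_right_mono) auto
    finally show False using 1 elim(1) par(2) unfolding mult.assoc by linarith
  qed
  then show False by simp
qed

text \<open>The competitor (x + z, y + z + k) with k = \<tau>(x - y) shrinks the distance by the
  factor 1 - \<tau>. This gains at least G > 0, while for |z| < Rz the other penalties change by
  amounts that tend to 0 uniformly in z. Hence a jump z not lowering \<open>u\<close> forces
  \<open>v\<close> to increase strictly at z + k. Strictness matters: the complement of a strict
  superlevel set is exactly what \<open>Vv\<close> measures, so the two masses add up to that of the
  far region.\<close>

lemma far_sets_comparison:
  assumes \<delta>: "0 < \<delta>" and e: "e > 0"
  shows "\<forall>\<^sub>F n in sequentially. Uu \<delta> n + Vv \<delta> n \<le> F \<delta> + 2 * e"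
proof -
  obtain d0 where d0: "d0 > 0"
    "\<And>(h :: 'a) V. norm h < d0 \<Longrightarrow> V \<in> sets borel \<Longrightarrow>
       measure \<nu> {z \<in> - ball 0 \<delta>. z + h \<in> V} \<le> measure \<nu> {z \<in> - ball 0 \<delta>. z \<in> V} + e"
    using measure_nu_translation[OF \<delta> e] by blast
  obtain Rz where Rz: "Rz > \<delta>" "measure \<nu> (- ball (0::'a) Rz) \<le> e"
  proof -
    have "(\<lambda>n. measure \<nu> (- ball (0::'a) (\<delta> + 1 + real n))) \<longlonglongrightarrow> measure \<nu> (\<Inter>n. - ball (0::'a) (\<delta> + 1 + real n))"
    proof (rule Lim_measure_decseq)
      show "decseq (\<lambda>n. - ball (0::'a) (\<delta> + 1 + real n))" by (auto simp: decseq_def)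
      show "emeasure \<nu> (- ball (0::'a) (\<delta> + 1 + real i)) \<noteq> \<infinity>" for i
        using far_finite[of "\<delta> + 1 + real i"] \<delta> by simp
    qed (auto simp: borel_closed)
    moreover have "(\<Inter>n. - ball (0::'a) (\<delta> + 1 + real n)) = {}"
    proof -
      have False if z: "z \<in> (\<Inter>n. - ball (0::'a) (\<delta> + 1 + real n))" for z
      proof -
        obtain n where "norm z < real n" using reals_Archimedean2 by blast
        then have "z \<in> ball 0 (\<delta> + 1 + real n)" using \<delta> by simp
        then show False using z by blast
      qed
      then show ?thesis by blast
    qed
    ultimately have "(\<lambda>n. measure \<nu> (- ball (0::'a) (\<delta> + 1 + real n))) \<longlonglongrightarrow> 0" by simp
    from eventually_happens[OF order_tendstoD(2)[OF this e]]
    obtain n where "measure \<nu> (- ball (0::'a) (\<delta> + 1 + real n)) < e" by auto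
    then show thesis using that[of "\<delta> + 1 + real n"] by simp
  qed
  \<comment> \<open>Keeps the shift \<tau>(x - y) shorter than \<open>d0\<close> for all n, by the a
    priori bound on |x - y|.\<close>
  define \<tau> where "\<tau> = min 1 (d0 / (sqrt (4 * M * \<epsilon>) + 1))"
  have sq: "sqrt (4 * M * \<epsilon>) \<ge> 0" using M par(1) by simp
  have sq1: "sqrt (4 * M * \<epsilon>) + 1 > 0" using sq by linarith
  have \<tau>: "0 < \<tau>" "\<tau> \<le> 1" using divide_pos_pos[OF d0(1) sq1] by (auto simp: \<tau>_def)
  have \<tau>d: "\<tau> * norm (x n - y n) < d0" for n
  proof -
    have "\<tau> * norm (x n - y n) \<le> d0 / (sqrt (4 * M * \<epsilon>) + 1) * sqrt (4 * M * \<epsilon>)"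
      using norm_diff_le[of n] \<tau> sq by (intro mult_mono) (auto simp: \<tau>_def)
    also have "\<dots> = d0 * (sqrt (4 * M * \<epsilon>) / (sqrt (4 * M * \<epsilon>) + 1))" by simp
    also have "\<dots> < d0 * 1"
    proof (rule mult_strict_left_mono)
      show "sqrt (4 * M * \<epsilon>) / (sqrt (4 * M * \<epsilon>) + 1) < 1" unfolding divide_less_eq_1_pos[OF sq1] by simp
    qed (rule d0(1))
    also have "\<dots> = d0" by simp
    finally show ?thesis .
  qed
  define G where "G = \<tau> * (norm d)\<^sup>2 / (8 * \<epsilon>)"
  have G: "G > 0" using \<tau> limit_gradient_nonzero par(1) by (simp add: G_def)
  have \<alpha>0: "\<alpha> \<longlonglongrightarrow> 0"
    by (rule tendsto_sandwich[OF _ _ tendsto_const E]) (auto intro!: always_eventually less_imp_le \<alpha>(1) alpha_le_E)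
  have "(\<lambda>n. 8 * M * K n * (Rz + Rz\<^sup>2) + \<alpha> n * (Rz + Rz\<^sup>2)) \<longlonglongrightarrow> 8 * M * 0 * (Rz + Rz\<^sup>2) + 0 * (Rz + Rz\<^sup>2)"
    by (intro tendsto_intros K \<alpha>0)
  then have "(\<lambda>n. 8 * M * K n * (Rz + Rz\<^sup>2) + \<alpha> n * (Rz + Rz\<^sup>2)) \<longlonglongrightarrow> 0" by simp
  note ev1 = order_tendstoD(2)[OF this G]
  have "(\<lambda>n. (norm (x n - y n))\<^sup>2) \<longlonglongrightarrow> (norm d)\<^sup>2" by (intro tendsto_intros d)
  moreover have "(norm d)\<^sup>2 / 2 < (norm d)\<^sup>2" using limit_gradient_nonzero by simp
  ultimately have "\<forall>\<^sub>F n in sequentially. (norm d)\<^sup>2 / 2 < (norm (x n - y n))\<^sup>2"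
    by (rule order_tendstoD(1))
  with ev1 show ?thesis
  proof eventually_elim
    case (elim n)
    define k where "k = \<tau> *\<^sub>R (x n - y n)"
    define V where "V = {z. - v (s n, y n + z) < - v (s n, y n)}"
    have nk: "norm k < d0" using \<tau>d[of n] \<tau> by (simp add: k_def)
    have gain: "G \<le> (norm (x n - y n))\<^sup>2 / (2 * \<epsilon>) - (norm (x n - y n - k))\<^sup>2 / (2 * \<epsilon>)"
    proof -
      have "x n - y n - k = (1 - \<tau>) *\<^sub>R (x n - y n)" by (simp add: k_def scaleR_left_diff_distrib)
      then have "(norm (x n - y n - k))\<^sup>2 = (1 - \<tau>)\<^sup>2 * (norm (x n - y n))\<^sup>2" by (simp add: power_mult_distrib)
      moreover have "(1 - \<tau>)\<^sup>2 \<le> 1 - \<tau>" using \<tau> by (simp add: power2_eq_square mult_left_le)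
      ultimately have "(norm (x n - y n - k))\<^sup>2 \<le> (1 - \<tau>) * (norm (x n - y n))\<^sup>2"
        by (simp add: mult_right_mono)
      then have "\<tau> * (norm (x n - y n))\<^sup>2 \<le> (norm (x n - y n))\<^sup>2 - (norm (x n - y n - k))\<^sup>2"
        by (simp add: left_diff_distrib)
      moreover have "\<tau> * ((norm d)\<^sup>2 / 2) \<le> \<tau> * (norm (x n - y n))\<^sup>2" using elim \<tau> by (intro mult_left_mono) auto
      moreover have "\<tau> * ((norm d)\<^sup>2 / 4) \<le> \<tau> * ((norm d)\<^sup>2 / 2)" using \<tau> by (intro mult_left_mono) auto
      ultimately have "\<tau> * ((norm d)\<^sup>2 / 4) \<le> (norm (x n - y n))\<^sup>2 - (norm (x n - y n - k))\<^sup>2" by linarith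
      then have "\<tau> * ((norm d)\<^sup>2 / 4) / (2 * \<epsilon>) \<le> ((norm (x n - y n))\<^sup>2 - (norm (x n - y n - k))\<^sup>2) / (2 * \<epsilon>)"
        using par(1) by (intro divide_right_mono) auto
      then show ?thesis by (simp add: G_def diff_divide_distrib)
    qed
    have sub: "z + k \<in> V" if z: "norm z < Rz" "u (t n, x n) \<le> u (t n, x n + z)" for z
    proof -
      have "Phi \<epsilon> \<eta> (\<alpha> n) (\<beta> n) (g n) (t n) (s n) (x n + z) (y n + (z + k))
          \<le> Phi \<epsilon> \<eta> (\<alpha> n) (\<beta> n) (g n) (t n) (s n) (x n) (y n)"
        by (rule max[OF ts])
      moreover have "x n + z - (y n + (z + k)) = x n - y n - k" by simp
      moreover have "(phase (\<beta> n) (g n) (t n) (s n) (x n + z))\<^sup>2 - (phase (\<beta> n) (g n) (t n) (s n) (x n))\<^sup>2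
         \<le> K n * (Rz + Rz\<^sup>2)"
      proof -
        define \<gamma> where "\<gamma> = g n (x n + z) - g n (x n)"
        have \<gamma>: "\<bar>\<gamma>\<bar> \<le> K n * Rz"
          using g(3)[of n "x n" z] mult_left_mono[of "norm z" Rz "K n"] z(1) K(1)[of n] by (simp add: \<gamma>_def)
        have "phase (\<beta> n) (g n) (t n) (s n) (x n + z) = W n + \<gamma>" by (simp add: phase_def W_def \<gamma>_def)
        then have "(phase (\<beta> n) (g n) (t n) (s n) (x n + z))\<^sup>2 - (W n)\<^sup>2 = 2 * W n * \<gamma> + \<gamma>\<^sup>2"
          by (simp add: power2_eq_square algebra_simps)
        also have "\<dots> \<le> K n * Rz + K n * Rz\<^sup>2"
        proof (rule add_mono)
          have "\<bar>2 * W n * \<gamma>\<bar> \<le> 1 * (K n * Rz)"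
            unfolding abs_mult[of "2 * W n"] using W_le[of n] \<gamma> by (intro mult_mono) auto
          then show "2 * W n * \<gamma> \<le> K n * Rz" by linarith
          have "\<bar>\<gamma>\<bar>\<^sup>2 \<le> (K n * Rz)\<^sup>2" using \<gamma> by (intro power_mono) auto
          also have "\<dots> = (K n * K n) * Rz\<^sup>2" by (simp add: power2_eq_square)
          also have "\<dots> \<le> K n * Rz\<^sup>2" using K(1,2)[of n] by (intro mult_right_mono) (auto simp: mult_left_le)
          finally show "\<gamma>\<^sup>2 \<le> K n * Rz\<^sup>2" by simp
        qed
        finally show ?thesis by (simp add: W_def distrib_left)
      qed
      then have "8 * M * ((phase (\<beta> n) (g n) (t n) (s n) (x n + z))\<^sup>2 - (phase (\<beta> n) (g n) (t n) (s n) (x n))\<^sup>2)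
         \<le> 8 * M * (K n * (Rz + Rz\<^sup>2))" using M by (intro mult_left_mono) auto
      moreover have "\<alpha> n * (ln (1 + (norm (x n + z))\<^sup>2) - ln (1 + (norm (x n))\<^sup>2)) \<le> \<alpha> n * (Rz + Rz\<^sup>2)"
      proof -
        have "(2 / (1 + (norm (x n))\<^sup>2)) * (x n \<bullet> z) \<le> Rz"
        proof -
          have "0 \<le> (norm (x n) - 1)\<^sup>2" by simp
          then have "2 * norm (x n) \<le> 1 + (norm (x n))\<^sup>2" by (simp add: power2_eq_square algebra_simps)
          then have "2 / (1 + (norm (x n))\<^sup>2) * norm (x n) \<le> 1" by (simp add: pos_divide_le_eq add_pos_nonneg)
          then have "2 / (1 + (norm (x n))\<^sup>2) * norm (x n) * norm z \<le> 1 * Rz"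
            using z(1) by (intro mult_mono) auto
          moreover have "(2 / (1 + (norm (x n))\<^sup>2)) * (x n \<bullet> z) \<le> (2 / (1 + (norm (x n))\<^sup>2)) * (norm (x n) * norm z)"
            by (intro mult_left_mono norm_cauchy_schwarz) (simp add: add_nonneg_nonneg)
          ultimately show ?thesis by (simp add: mult.assoc)
        qed
        moreover have "(norm z)\<^sup>2 \<le> Rz\<^sup>2" using z(1) by (intro power_mono) auto
        ultimately have "ln (1 + (norm (x n + z))\<^sup>2) - ln (1 + (norm (x n))\<^sup>2) \<le> Rz + Rz\<^sup>2"
          using ln_penalty_le[of "x n" z] by linarith
        then show ?thesis using \<alpha>(1)[of n] by (intro mult_left_mono) auto
      qed
      ultimately have "v (s n, y n) < v (s n, y n + (z + k))"
        using gain elim(1) z(2) unfolding Phi_def by (simp add: algebra_simps)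
      then show ?thesis by (simp add: V_def)
    qed
    have V_open: "open V"
      unfolding open_dist
    proof
      fix z assume "z \<in> V"
      then obtain r where r: "r > 0" "\<And>\<xi>. \<xi> \<in> {0..} \<times> UNIV \<Longrightarrow> dist \<xi> (s n, y n + z) < r \<Longrightarrow> - v \<xi> < - v (s n, y n)"
        using usc_on_ball[OF usc_mv, of "(s n, y n + z)" "- v (s n, y n)"] ts(2)[of n] by (auto simp: V_def)
      have "z' \<in> V" if "dist z' z < r" for z'
        using r(2)[of "(s n, y n + z')"] that ts(2)[of n] by (simp add: V_def dist_Pair_Pair)
      then show "\<exists>e>0. \<forall>z'. dist z' z < e \<longrightarrow> z' \<in> V" using r(1) by blast
    qed
    have Vb: "V \<in> sets borel" using V_open by (rule borel_open)
    have Vkb: "{z. z + k \<in> V} \<in> sets borel"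
    proof -
      have "open ((\<lambda>z. z + k) -` V)" by (rule open_vimage[OF V_open]) (intro continuous_intros)
      then show ?thesis by (simp add: vimage_def borel_open)
    qed
    have far_b: "- ball (0::'a) r \<in> sets borel" for r by (simp add: borel_closed)
    have fm: "{z \<in> - ball 0 \<delta>. z \<in> A} \<in> fmeasurable \<nu>" if "A \<in> sets borel" for A
    proof -
      have "- ball 0 \<delta> \<inter> A \<in> fmeasurable \<nu>"
        using that far_b by (intro fmeasurable_far_subset[OF \<delta>]) auto
      moreover have "{z \<in> - ball 0 \<delta>. z \<in> A} = - ball 0 \<delta> \<inter> A" by blast
      ultimately show ?thesis by (simp only:)
    qed
    have fm_k: "{z \<in> - ball 0 \<delta>. z + k \<in> V} \<in> fmeasurable \<nu>" using fm[OF Vkb] by simp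
    have "Uu \<delta> n \<le> measure \<nu> ({z \<in> - ball 0 \<delta>. z + k \<in> V} \<union> - ball 0 Rz)"
    proof (cases "{z \<in> - ball 0 \<delta>. u (t n, x n) \<le> u (t n, x n + z)} \<in> sets \<nu>")
      case True
      then show ?thesis unfolding Uu_def
        using fm_k fmeasurable_far[of Rz] Rz(1) \<delta>
        by (intro measure_mono_fmeasurable fmeasurable.Un) (auto intro: sub)
    qed (simp add: Uu_def measure_notin_sets)
    also have "\<dots> \<le> measure \<nu> {z \<in> - ball 0 \<delta>. z + k \<in> V} + measure \<nu> (- ball 0 Rz)"
      using fm_k fmeasurableD far_b by (intro measure_Un_le) auto
    also have "\<dots> \<le> measure \<nu> {z \<in> - ball 0 \<delta>. z \<in> V} + e + e"
      using d0(2)[OF nk Vb] Rz(2) by simp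
    finally have 1: "Uu \<delta> n \<le> measure \<nu> {z \<in> - ball 0 \<delta>. z \<in> V} + 2 * e" by simp
    have "measure \<nu> ({z \<in> - ball 0 \<delta>. z \<in> V} \<union> {z \<in> - ball 0 \<delta>. z \<in> - V})
      = measure \<nu> {z \<in> - ball 0 \<delta>. z \<in> V} + measure \<nu> {z \<in> - ball 0 \<delta>. z \<in> - V}"
    proof -
      have "{z \<in> - ball 0 \<delta>. z \<in> - V} - {z \<in> - ball 0 \<delta>. z \<in> V} = {z \<in> - ball 0 \<delta>. z \<in> - V}" by auto
      then show ?thesis using measure_Un2[OF fm[OF Vb] fm[of "- V"]] Vb by (simp only: borel_comp)
    qed
    moreover have "{z \<in> - ball 0 \<delta>. z \<in> V} \<union> {z \<in> - ball 0 \<delta>. z \<in> - V} = - ball 0 \<delta>" by auto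
    moreover have "{z \<in> - ball 0 \<delta>. z \<in> - V} = {z \<in> - ball 0 \<delta>. v (s n, y n + z) \<le> v (s n, y n)}"
      by (auto simp: V_def)
    ultimately have "F \<delta> = measure \<nu> {z \<in> - ball 0 \<delta>. z \<in> V} + Vv \<delta> n"
      unfolding F_def Vv_def by simp
    then show ?case using 1 by linarith
  qed
qed

text \<open>With a nonzero limit gradient both weights tend to the same \<sigma>, so only X + Y
  matters. The near masses give 2e, the far superlevel sets exceed the far mass by at most 2e, and
  the half spaces exhaust it up to e: in total 5e.\<close>

lemma contradiction: False
proof -
  define p0 where "p0 = (1 / \<epsilon>) *\<^sub>R d"
  have p0: "p0 \<noteq> 0" using limit_gradient_nonzero par(1) by (simp add: p0_def)
  note lims = p_tendsto[folded p0_def] pu_tendsto[folded p0_def]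
  define \<sigma> where "\<sigma> = sig \<mu> p0"
  have \<sigma>: "\<sigma> \<ge> 0" by (simp add: \<sigma>_def sig_nonneg)
  define w where "w = 5 * \<sigma> + 4"
  define e where "e = \<eta> / (4 * w)"
  have w: "w > 0" using \<sigma> by (simp add: w_def)
  then have e: "e > 0" using par(2) by (simp add: e_def)
  have e_le: "(5 * \<sigma> + 4) * e < \<eta> / 2"
    using w par(2) by (simp add: w_def[symmetric] e_def)
  have np: "norm p0 / 2 > 0" using p0 by simp
  obtain \<delta> where \<delta>: "0 < \<delta>" "\<delta> \<le> 1" "\<And>p. norm p \<ge> norm p0 / 2 \<Longrightarrow> measure \<nu> (near_set \<delta> h p) \<le> e"
    using near_measure_uniformly_small[OF e np h_pos] by blast
  have F: "F \<delta> \<ge> 0" by (simp add: F_def)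
  \<comment> \<open>Scaled by the bound 2F + e for |X| and |Y|, so that replacing either weight by
    \<sigma> costs at most e.\<close>
  define f where "f = e / (2 * F \<delta> + e)"
  have f: "f > 0" using e F by (simp add: f_def add_nonneg_pos)
  have ff: "f * (2 * F \<delta> + e) \<le> e" using e F by (simp add: f_def)
  have n1: "\<forall>\<^sub>F n in sequentially. norm p0 / 2 < norm (p n)" "\<forall>\<^sub>F n in sequentially. norm p0 / 2 < norm (pu n)"
    using order_tendstoD(1)[OF tendsto_norm[OF lims(1)], of "norm p0 / 2"]
      order_tendstoD(1)[OF tendsto_norm[OF lims(2)], of "norm p0 / 2"] np by auto
  have s1: "\<forall>\<^sub>F n in sequentially. \<bar>sig \<mu> (pu n) - \<sigma>\<bar> < f"
    using sig_tendsto[OF lims(2)] f unfolding tendsto_iff \<sigma>_def by (simp add: dist_real_def)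
  have "(\<lambda>n. m n * sig \<mu> (p n)) \<longlonglongrightarrow> 1 * \<sigma>"
    unfolding \<sigma>_def by (intro tendsto_mult m_tendsto sig_tendsto lims)
  then have s2: "\<forall>\<^sub>F n in sequentially. \<bar>m n * sig \<mu> (p n) - \<sigma>\<bar> < f"
    using f unfolding tendsto_iff by (simp add: dist_real_def)
  have "(\<lambda>n. F \<delta> - Hu \<delta> n - Hv \<delta> n) \<longlonglongrightarrow> 0"
    unfolding F_def Hu_def Hv_def by (rule measure_halfspaces_tendsto[OF \<delta>(1) p0 lims(2) lims(1)])
  then have hs: "\<forall>\<^sub>F n in sequentially. F \<delta> - Hu \<delta> n - Hv \<delta> n < e" by (rule order_tendstoD(2)[OF _ e])
  have "\<forall>\<^sub>F n in sequentially. False"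
    using n1 s1 s2 hs far_sets_comparison[OF \<delta>(1) e] nonlocal_lower_bound[OF \<delta>(1,2) e]
  proof eventually_elim
    case (elim n)
    define X where "X = measure \<nu> (near_set \<delta> h (pu n)) + Uu \<delta> n - Hu \<delta> n"
    define Y where "Y = measure \<nu> (near_set \<delta> h (p n)) + Vv \<delta> n - Hv \<delta> n"
    have near: "measure \<nu> (near_set \<delta> h (pu n)) \<le> e" "measure \<nu> (near_set \<delta> h (p n)) \<le> e"
      using \<delta>(3) elim(1,2) by auto
    have bd: "0 \<le> Uu \<delta> n" "Uu \<delta> n \<le> F \<delta>" "0 \<le> Hu \<delta> n" "Hu \<delta> n \<le> F \<delta>"
       "0 \<le> Vv \<delta> n" "Vv \<delta> n \<le> F \<delta>" "0 \<le> Hv \<delta> n" "Hv \<delta> n \<le> F \<delta>"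
      unfolding Uu_def Hu_def Vv_def Hv_def by (rule measure_nonneg far_le[OF \<delta>(1)])+
    have XY: "\<bar>X\<bar> \<le> 2 * F \<delta> + e" "\<bar>Y\<bar> \<le> 2 * F \<delta> + e"
      using near bd measure_nonneg[of \<nu> "near_set \<delta> h (pu n)"] measure_nonneg[of \<nu> "near_set \<delta> h (p n)"]
      unfolding X_def Y_def by linarith+
    have dX: "(sig \<mu> (pu n) - \<sigma>) * X \<le> e"
    proof -
      have "\<bar>(sig \<mu> (pu n) - \<sigma>) * X\<bar> \<le> f * (2 * F \<delta> + e)"
        unfolding abs_mult using elim(3) XY f by (intro mult_mono) auto
      then show ?thesis using ff by linarith
    qed
    have dY: "(m n * sig \<mu> (p n) - \<sigma>) * Y \<le> e"
    proof -
      have "\<bar>(m n * sig \<mu> (p n) - \<sigma>) * Y\<bar> \<le> f * (2 * F \<delta> + e)"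
        unfolding abs_mult[of "m n * sig \<mu> (p n) - \<sigma>"] using elim(4) XY f by (intro mult_mono) auto
      then show ?thesis using ff by linarith
    qed
    have "X + Y \<le> 5 * e" using near elim(5,6) unfolding X_def Y_def by linarith
    then have "\<sigma> * (X + Y) \<le> \<sigma> * (5 * e)" using \<sigma> by (intro mult_left_mono)
    moreover have "\<eta> / 2 - e \<le> sig \<mu> (pu n) * X + m n * sig \<mu> (p n) * Y"
      using elim(7) unfolding X_def Y_def .
    moreover have "sig \<mu> (pu n) * X + m n * sig \<mu> (p n) * Y
       = \<sigma> * (X + Y) + (sig \<mu> (pu n) - \<sigma>) * X + (m n * sig \<mu> (p n) - \<sigma>) * Y" by (simp add: algebra_simps)
    ultimately have "\<eta> / 2 \<le> \<sigma> * (5 * e) + 3 * e" using dX dY by linarith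
    moreover have "\<sigma> * (5 * e) + 3 * e \<le> (5 * \<sigma> + 4) * e" using e by (simp add: algebra_simps)
    ultimately show False using e_le by linarith
  qed
  then show False by simp
qed

end

section \<open>The comparison principle\<close>

text \<open>Testing with a multiple rD of D, with r small enough that C r < 1, contradicts the
  quadratic bound unless D = 0.\<close>

lemma quadratically_small_linear_eq_0:
  fixes D :: "'a::real_inner"
  assumes "C \<ge> 0" "\<And>z. norm z < 1 \<Longrightarrow> \<bar>D \<bullet> z\<bar> \<le> C * (norm z)\<^sup>2"
  shows "D = 0"
proof (rule ccontr)
  assume D: "D \<noteq> 0"
  define r where "r = 1 / ((C + 1) * (norm D + 1))"
  have den: "C + 1 > 0" "norm D + 1 > 0" using assms(1) by (auto simp: add_nonneg_pos)
  have r: "r > 0" using den by (simp add: r_def)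
  have "(C + 1) * (norm D + 1) \<ge> norm D + 1" using assms(1) by (simp add: distrib_right)
  then have "norm D < (C + 1) * (norm D + 1)" by linarith
  moreover have "norm (r *\<^sub>R D) = norm D / ((C + 1) * (norm D + 1))" using den by (simp add: r_def)
  ultimately have "norm (r *\<^sub>R D) < 1" using mult_pos_pos[OF den] by (simp only: divide_less_eq_1_pos)
  then have "\<bar>D \<bullet> (r *\<^sub>R D)\<bar> \<le> C * (norm (r *\<^sub>R D))\<^sup>2" by (rule assms(2))
  then have "r * (norm D)\<^sup>2 \<le> C * r * (r * (norm D)\<^sup>2)"
    using r by (simp add: power_mult_distrib dot_square_norm power2_eq_square mult_ac)
  moreover have "C * r < 1"
  proof -
    have "C < (C + 1) * (norm D + 1)" 
      using mult_nonneg_nonneg[OF assms(1) norm_ge_zero[of D]] norm_ge_zero[of D] unfolding distrib_left distrib_right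
      by linarith
    then show ?thesis using den by (simp add: r_def pos_divide_less_eq)
  qed
  moreover have "r * (norm D)\<^sup>2 > 0" using r D by simp
  ultimately show False by (metis less_irrefl mult.left_neutral mult_strict_right_mono order_less_le_trans)
qed

section \<open>Choice of cut-offs and parameters\<close>

context comparison
begin

text \<open>A truncated sign of \<open>c\<close>: a dead zone |c| <= r, linear ramps of width w, and
  the values 1 and -1 beyond them.\<close>

definition clamp_speed :: "real \<Rightarrow> real \<Rightarrow> 'a \<Rightarrow> real" where
  "clamp_speed r w x = max (-1) (min 1 ((max 0 (c x - r) + min 0 (c x + r)) / w))"

lemma clamp_speed_bounds:
  assumes "r \<ge> 0" "w > 0"
  shows "\<bar>clamp_speed r w x\<bar> \<le> 1"
    and "\<bar>clamp_speed r w x - clamp_speed r w y\<bar> \<le> Lc / w * norm (x - y)"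
    and "c x \<ge> r + w \<Longrightarrow> clamp_speed r w x = 1"
    and "c x \<le> - (r + w) \<Longrightarrow> clamp_speed r w x = - 1"
    and "\<bar>c x\<bar> \<le> r \<Longrightarrow> clamp_speed r w x = 0"
proof -
  show "\<bar>clamp_speed r w x\<bar> \<le> 1" by (auto simp: clamp_speed_def)
  have 1: "\<bar>max (-1) (min 1 a) - max (-1) (min 1 b)\<bar> \<le> \<bar>a - b\<bar>" for a b :: real by (auto simp: max_def min_def)
  have 2: "\<bar>(max 0 (a - r) + min 0 (a + r)) - (max 0 (b - r) + min 0 (b + r))\<bar> \<le> \<bar>a - b\<bar>" for a b :: real
    using assms(1) by (auto simp: max_def min_def)
  have "\<bar>clamp_speed r w x - clamp_speed r w y\<bar>
     \<le> \<bar>(max 0 (c x - r) + min 0 (c x + r)) / w - (max 0 (c y - r) + min 0 (c y + r)) / w\<bar>"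
    unfolding clamp_speed_def by (rule 1)
  also have "\<dots> = \<bar>(max 0 (c x - r) + min 0 (c x + r)) - (max 0 (c y - r) + min 0 (c y + r))\<bar> / w"
    using assms(2) by (simp add: diff_divide_distrib[symmetric])
  also have "\<dots> \<le> (Lc * norm (x - y)) / w"
    using assms(2) 2[of "c x" "c y"] c_lip[of x y] by (intro divide_right_mono) auto
  finally show "\<bar>clamp_speed r w x - clamp_speed r w y\<bar> \<le> Lc / w * norm (x - y)" by simp
  show "c x \<ge> r + w \<Longrightarrow> clamp_speed r w x = 1"
    using assms by (simp add: clamp_speed_def max_def min_def pos_le_divide_eq)
  show "c x \<le> - (r + w) \<Longrightarrow> clamp_speed r w x = - 1"
  proof -
    assume le: "c x \<le> - (r + w)"
    have "(max 0 (c x - r) + min 0 (c x + r)) / w \<le> - 1"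
      using le assms by (simp add: max_def min_def pos_divide_le_eq)
    then show ?thesis unfolding clamp_speed_def by linarith
  qed
  show "\<bar>c x\<bar> \<le> r \<Longrightarrow> clamp_speed r w x = 0"
  proof -
    assume le: "\<bar>c x\<bar> \<le> r"
    have "max 0 (c x - r) + min 0 (c x + r) = 0" using le by linarith
    then show ?thesis by (simp add: clamp_speed_def)
  qed
qed

text \<open>A mollified \<open>clamp_speed\<close>. Wide ramps give the small Lipschitz constant k,
  at the price of a large R but not of a large C. The margin 2 Lc in r and R is the oscillation of
  \<open>c\<close> over the radius 2 seen by the mollifier; where the clamp is constant on that
  scale, \<open>g\<close> is locally constant and D = 0. Vanishing at x0 makes the phase 0 at a
  prescribed starting point.\<close>

lemma smooth_sign_of_speed:
  obtains C where "C \<ge> 0"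
    "\<And>x0 k. k > 0 \<Longrightarrow> \<exists>R\<ge>0. \<exists>g D. C11 C g D \<and> (\<forall>x. \<bar>g x\<bar> \<le> 1) \<and> (\<forall>x z. \<bar>g (x + z) - g x\<bar> \<le> k * norm z) \<and>
       (\<forall>x. R \<le> c x \<longrightarrow> g x = 1 \<and> D x = 0) \<and> (\<forall>x. c x \<le> - R \<longrightarrow> g x = -1 \<and> D x = 0) \<and> g x0 = 0"
proof -
  obtain C where C: "C \<ge> 0"
    "\<And>(f :: 'a \<Rightarrow> real) K. (\<And>x. \<bar>f x\<bar> \<le> 1) \<Longrightarrow> (\<And>x y. \<bar>f x - f y\<bar> \<le> K * norm (x - y)) \<Longrightarrow>
      \<exists>g D. (\<forall>x. \<bar>g x\<bar> \<le> 1) \<and> (\<forall>x z. \<bar>g (x + z) - g x\<bar> \<le> K * norm z) \<and>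
        (\<forall>x z. \<bar>g (x + z) - g x - D x \<bullet> z\<bar> \<le> C * (norm z)\<^sup>2) \<and>
        (\<forall>x k. (\<forall>w. norm (w - x) < 2 \<longrightarrow> f w = k) \<longrightarrow> (\<forall>z. norm z < 1 \<longrightarrow> g (x + z) = k))"
  proof (rule C11_smoothing[where 'a = 'a], goal_cases)
    case (1 C)
    show ?case
    proof (rule 1(1)[OF 1(2)])
      fix f :: "'a \<Rightarrow> real" and K
      assume "\<And>x. \<bar>f x\<bar> \<le> 1" "\<And>x y. \<bar>f x - f y\<bar> \<le> K * norm (x - y)"
      then show "\<exists>g D. (\<forall>x. \<bar>g x\<bar> \<le> 1) \<and> (\<forall>x z. \<bar>g (x + z) - g x\<bar> \<le> K * norm z) \<and>
        (\<forall>x z. \<bar>g (x + z) - g x - D x \<bullet> z\<bar> \<le> C * (norm z)\<^sup>2) \<and>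
        (\<forall>x k. (\<forall>w. norm (w - x) < 2 \<longrightarrow> f w = k) \<longrightarrow> (\<forall>z. norm z < 1 \<longrightarrow> g (x + z) = k))"
        by (rule 1(3))
    qed
  qed
  show ?thesis
  proof (rule that[OF C(1)])
    fix x0 :: 'a and k :: real assume k: "k > 0"
    define r where "r = \<bar>c x0\<bar> + 2 * Lc"
    define w where "w = (Lc + 1) / k"
    have r: "r \<ge> 0" using Lc by (simp add: r_def)
    have w: "w > 0" using Lc k by (simp add: w_def)
    define R where "R = r + w + 2 * Lc"
    have near: "\<bar>c z - c x\<bar> \<le> 2 * Lc" if "norm (z - x) < 2" for x z
      using c_lip[of z x] mult_left_mono[of "norm (z - x)" 2 Lc] Lc that by auto
    have Lw: "Lc / w \<le> k" using k Lc by (simp add: w_def pos_divide_le_eq)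
    have "\<bar>clamp_speed r w x - clamp_speed r w y\<bar> \<le> k * norm (x - y)" for x y
      using clamp_speed_bounds(2)[OF r w, of x y] mult_right_mono[OF Lw, of "norm (x - y)"] by simp
    then obtain g D where g: "\<forall>x. \<bar>g x\<bar> \<le> 1" "\<forall>x z. \<bar>g (x + z) - g x\<bar> \<le> k * norm z"
        "\<forall>x z. \<bar>g (x + z) - g x - D x \<bullet> z\<bar> \<le> C * (norm z)\<^sup>2"
        "\<forall>x k. (\<forall>w'. norm (w' - x) < 2 \<longrightarrow> clamp_speed r w w' = k) \<longrightarrow> (\<forall>z. norm z < 1 \<longrightarrow> g (x + z) = k)"
      using C(2)[of "clamp_speed r w" k] clamp_speed_bounds(1)[OF r w] by blast
    have const: "g x = l \<and> D x = 0" if l: "\<And>w'. norm (w' - x) < 2 \<Longrightarrow> clamp_speed r w w' = l" for x l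
    proof -
      have gl: "g (x + z) = l" if "norm z < 1" for z using g(4) l that by blast
      from gl[of 0] have gx: "g x = l" by simp
      have "D x = 0"
      proof (rule quadratically_small_linear_eq_0[OF C(1)])
        fix z :: 'a assume "norm z < 1"
        then show "\<bar>D x \<bullet> z\<bar> \<le> C * (norm z)\<^sup>2" using g(3)[rule_format, of x z] gl[of z] gx by simp
      qed
      then show ?thesis using gx by simp
    qed
    have "g x = 1 \<and> D x = 0" if "R \<le> c x" for x
    proof (rule const)
      fix z assume "norm (z - x) < 2"
      then show "clamp_speed r w z = 1"
        using near[of z x] that by (intro clamp_speed_bounds(3)[OF r w]) (auto simp: R_def)
    qed
    moreover have "g x = - 1 \<and> D x = 0" if "c x \<le> - R" for x
    proof (rule const)
      fix z assume "norm (z - x) < 2"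
      then show "clamp_speed r w z = - 1"
        using near[of z x] that by (intro clamp_speed_bounds(4)[OF r w]) (auto simp: R_def)
    qed
    moreover have "g x0 = 0 \<and> D x0 = 0"
    proof (rule const)
      fix z assume "norm (z - x0) < 2"
      then show "clamp_speed r w z = 0"
        using near[of z x0] by (intro clamp_speed_bounds(5)[OF r w]) (auto simp: r_def)
    qed
    moreover have "R \<ge> 0" using r w Lc by (simp add: R_def)
    ultimately show "\<exists>R\<ge>0. \<exists>g D. C11 C g D \<and> (\<forall>x. \<bar>g x\<bar> \<le> 1) \<and> (\<forall>x z. \<bar>g (x + z) - g x\<bar> \<le> k * norm z) \<and>
       (\<forall>x. R \<le> c x \<longrightarrow> g x = 1 \<and> D x = 0) \<and> (\<forall>x. c x \<le> - R \<longrightarrow> g x = -1 \<and> D x = 0) \<and> g x0 = 0"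
      using g(1-3) unfolding C11_def by blast
  qed
qed

text \<open>The dependencies run in one direction: \<beta> is small against 1/(R + 1) and the
  modulus of \<open>sig\<close>, \<theta> is the relative perturbation that a factor exp(\<beta>/2)
  tolerates, and \<alpha> is small against \<theta>. Thus even the slight tilt s/t, of order
  \<beta>, outweighs the localization.\<close>

lemma small_parameters:
  assumes R: "R \<ge> 0" and e: "e > 0" and B: "B \<ge> 0"
  obtains \<beta> \<theta> \<alpha> where "0 < \<beta>" "\<beta> \<le> 1 / 2" "(R + 1) * \<beta> \<le> e" "0 < \<theta>" "\<theta> \<le> 1"
    "\<And>p w. norm w \<le> \<theta> * norm p \<Longrightarrow> sig \<mu> (p + w) \<le> exp (\<beta> / 2) * sig \<mu> p"
    "\<And>p w. norm w \<le> \<theta> * norm p \<Longrightarrow> exp (- (\<beta> / 2)) * sig \<mu> p \<le> sig \<mu> (p + w)"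
    "0 < \<alpha>" "\<alpha> \<le> 1" "\<alpha> \<le> \<theta> * e"
    "\<And>p w. norm p \<le> B \<Longrightarrow> norm w \<le> B * ((R + 1) * \<beta> + \<alpha>) \<Longrightarrow> R * \<bar>sig \<mu> (p + w) - sig \<mu> p\<bar> \<le> e"
proof -
  have eR: "e / (R + 1) > 0" using R e by (simp add: add_nonneg_pos)
  obtain d where d: "d > 0" "\<And>p q. norm p \<le> B \<Longrightarrow> norm (q - p) < d \<Longrightarrow> \<bar>sig \<mu> q - sig \<mu> p\<bar> < e / (R + 1)"
    using sig_uniformly_continuous[OF eR] by blast
  \<comment> \<open>Both (R + 1)\<beta> and \<alpha> will be at most k, so the perturbation is at
    most 2Bk, less than d.\<close>
  define k where "k = d / 4 / (B + 1)"
  have k: "k > 0" using d B by (simp add: k_def add_nonneg_pos)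
  have "B + 1 \<noteq> 0" using B by linarith
  then have Bk: "(B + 1) * k = d / 4"
    by (metis k_def nonzero_mult_div_cancel_left times_divide_eq_right)
  define \<beta> where "\<beta> = min (1 / 2) (min (e / (R + 1)) (k / (R + 1)))"
  have kR: "k / (R + 1) > 0" using k R by (simp add: add_nonneg_pos)
  have \<beta>: "0 < \<beta>" "\<beta> \<le> 1 / 2" "\<beta> \<le> e / (R + 1)" "\<beta> \<le> k / (R + 1)"
    unfolding \<beta>_def using eR kR by linarith+
  have \<beta>2: "(R + 1) * \<beta> \<le> e" "(R + 1) * \<beta> \<le> k"
    using \<beta>(3,4) R by (auto simp: pos_le_divide_eq add_nonneg_pos mult.commute)
  have "\<beta> / 2 > 0" using \<beta>(1) by simp
  then obtain \<theta>0 where \<theta>0: "\<theta>0 > 0" "\<And>p w. norm w \<le> \<theta>0 * norm p \<Longrightarrow> sig \<mu> (p + w) \<le> exp (\<beta> / 2) * sig \<mu> p"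
    "\<And>p w. norm w \<le> \<theta>0 * norm p \<Longrightarrow> exp (- (\<beta> / 2)) * sig \<mu> p \<le> sig \<mu> (p + w)"
    using sig_relative_perturbation by blast
  define \<theta> where "\<theta> = min \<theta>0 1"
  have \<theta>: "0 < \<theta>" "\<theta> \<le> 1" using \<theta>0(1) by (auto simp: \<theta>_def)
  have \<theta>le: "norm w \<le> \<theta>0 * norm p" if "norm w \<le> \<theta> * norm p" for p w :: 'a
    using that mult_right_mono[of \<theta> \<theta>0 "norm p"] by (simp add: \<theta>_def)
  define \<alpha> where "\<alpha> = min 1 (min (\<theta> * e) k)"
  have \<alpha>: "0 < \<alpha>" "\<alpha> \<le> 1" "\<alpha> \<le> \<theta> * e" "\<alpha> \<le> k" using \<theta> e k by (auto simp: \<alpha>_def)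
  have md: "R * \<bar>sig \<mu> (p + w) - sig \<mu> p\<bar> \<le> e" if "norm p \<le> B" "norm w \<le> B * ((R + 1) * \<beta> + \<alpha>)" for p w
  proof -
    have "B * ((R + 1) * \<beta> + \<alpha>) \<le> B * (2 * k)" using \<beta>2 \<alpha> B by (intro mult_left_mono) auto
    also have "\<dots> \<le> (B + 1) * (2 * k)" using k by (intro mult_right_mono) auto
    also have "\<dots> < d" using Bk d by simp
    finally have "\<bar>sig \<mu> (p + w) - sig \<mu> p\<bar> < e / (R + 1)" using that by (intro d(2)) auto
    then have "R * \<bar>sig \<mu> (p + w) - sig \<mu> p\<bar> \<le> (R + 1) * (e / (R + 1))" using R by (intro mult_mono) auto
    also have "\<dots> = e" using R by (simp add: add_nonneg_eq_0_iff)
    finally show ?thesis .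
  qed
  show ?thesis
    by (rule that[of \<beta> \<theta> \<alpha>]) (use \<beta> \<beta>2 \<theta> \<theta>0 \<theta>le \<alpha> md in auto)
qed

lemma comparison_principle:
  assumes t0: "t0 > 0"
  shows "u (t0, x0) \<le> v (t0, x0)"
proof (rule ccontr)
  assume "\<not> u (t0, x0) \<le> v (t0, x0)"
  then obtain th where th: "th > 0" "u (t0, x0) - v (t0, x0) = th" by (metis diff_gt_0_iff_gt not_le)
  \<comment> \<open>At the starting point \<eta> t0 costs a quarter of the gap \<open>th\<close>,
    and the localization less than another quarter for large n. The remainder exceeds the threshold
    L^2 \<epsilon>/2 of \<open>Phi_attains_max\<close>, which is below \<open>th / 4\<close> for
    \<epsilon> <= \<open>\<epsilon>0\<close>.\<close>
  define \<eta> where "\<eta> = th / (4 * t0)"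
  have \<eta>: "\<eta> > 0" "\<eta> * t0 = th / 4" using th t0 by (auto simp: \<eta>_def)
  obtain Ms where Ms: "Ms > 0" "\<And>p. sig \<mu> p \<le> Ms * norm p" using sig_bound by blast
  define \<kappa> where "\<kappa> = \<eta> / (4 * (Ms * Lc + 1))"
  have MsLc: "Ms * Lc + 1 > 0" using Ms Lc by (simp add: add_nonneg_pos)
  have \<kappa>: "\<kappa> > 0" using \<eta> MsLc by (simp add: \<kappa>_def)
  have \<kappa>2: "2 * Ms * Lc * \<kappa> \<le> \<eta> / 2"
  proof -
    have "2 * (Ms * Lc) * \<kappa> \<le> 2 * (Ms * Lc + 1) * \<kappa>" using \<kappa> by (intro mult_right_mono) auto
    also have "\<dots> = \<eta> / 2" using MsLc by (simp add: \<kappa>_def field_simps)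
    finally show ?thesis by simp
  qed
  define \<epsilon>0 where "\<epsilon>0 = th / 4 / (L\<^sup>2 + 1)"
  have L1: "L\<^sup>2 + 1 > 0" by (simp add: add_nonneg_pos)
  have \<epsilon>0: "\<epsilon>0 > 0" using th L1 by (simp add: \<epsilon>0_def)
  have L\<epsilon>: "L\<^sup>2 * \<epsilon> / 2 < th / 4" if "\<epsilon> \<le> \<epsilon>0" for \<epsilon>
  proof -
    have "L\<^sup>2 * \<epsilon> \<le> L\<^sup>2 * \<epsilon>0" using that by (intro mult_left_mono) auto
    also have "\<dots> \<le> (L\<^sup>2 + 1) * \<epsilon>0" using \<epsilon>0 by (intro mult_right_mono) auto
    also have "\<dots> = th / 4"
      using L1 by (metis \<epsilon>0_def less_irrefl nonzero_mult_div_cancel_left times_divide_eq_right)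
    finally have "L\<^sup>2 * \<epsilon> \<le> th / 4" .
    then show ?thesis using th(1) by linarith
  qed
  obtain Cg where Cg: "Cg \<ge> 0"
    "\<And>x0 k. k > 0 \<Longrightarrow> \<exists>R\<ge>0. \<exists>g D. C11 Cg g D \<and> (\<forall>x. \<bar>g x\<bar> \<le> 1) \<and> (\<forall>x z. \<bar>g (x + z) - g x\<bar> \<le> k * norm z) \<and>
       (\<forall>x. R \<le> c x \<longrightarrow> g x = 1 \<and> D x = 0) \<and> (\<forall>x. c x \<le> - R \<longrightarrow> g x = -1 \<and> D x = 0) \<and> g x0 = 0"
    using smooth_sign_of_speed by blast
  define E where "E n = 1 / (real n + 1)" for n
  have Epos: "E n > 0" "E n \<le> 1" for n by (auto simp: E_def)
  have E0: "E \<longlonglongrightarrow> 0" unfolding E_def by real_asymp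
  have "\<forall>n. \<exists>R g D. R \<ge> 0 \<and> C11 Cg g D \<and> (\<forall>x. \<bar>g x\<bar> \<le> 1) \<and> (\<forall>x z. \<bar>g (x + z) - g x\<bar> \<le> E n * norm z) \<and>
       (\<forall>x. R \<le> c x \<longrightarrow> g x = 1 \<and> D x = 0) \<and> (\<forall>x. c x \<le> - R \<longrightarrow> g x = -1 \<and> D x = 0) \<and> g x0 = 0"
    using Cg(2)[OF Epos(1)] by metis
  then obtain R g D where g: "\<And>n. R n \<ge> 0" "\<And>n. C11 Cg (g n) (D n)" "\<And>n x. \<bar>g n x\<bar> \<le> 1"
    "\<And>n x z. \<bar>g n (x + z) - g n x\<bar> \<le> E n * norm z" "\<And>n x. R n \<le> c x \<Longrightarrow> g n x = 1 \<and> D n x = 0"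
    "\<And>n x. c x \<le> - R n \<Longrightarrow> g n x = -1 \<and> D n x = 0" "\<And>n. g n x0 = 0"
    by metis
  \<comment> \<open>None of these choices refers to \<epsilon>; \<open>real n\<close> serves as the
    gradient bound \<open>B\<close>, which eventually exceeds every constant that does depend on
    \<epsilon>.\<close>
  have "\<forall>n. \<exists>\<beta> \<theta> \<alpha>. 0 < \<beta> \<and> \<beta> \<le> 1 / 2 \<and> (R n + 1) * \<beta> \<le> E n \<and> 0 < \<theta> \<and> \<theta> \<le> 1 \<and>
    (\<forall>p w. norm w \<le> \<theta> * norm p \<longrightarrow> sig \<mu> (p + w) \<le> exp (\<beta> / 2) * sig \<mu> p) \<and>
    (\<forall>p w. norm w \<le> \<theta> * norm p \<longrightarrow> exp (- (\<beta> / 2)) * sig \<mu> p \<le> sig \<mu> (p + w)) \<and>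
    0 < \<alpha> \<and> \<alpha> \<le> 1 \<and> \<alpha> \<le> \<theta> * E n \<and>
    (\<forall>p w. norm p \<le> real n \<longrightarrow> norm w \<le> real n * ((R n + 1) * \<beta> + \<alpha>) \<longrightarrow> R n * \<bar>sig \<mu> (p + w) - sig \<mu> p\<bar> \<le> E n)"
    (is "\<forall>n. ?par n")
  proof
    fix n
    show "?par n"
      by (rule small_parameters[OF g(1)[of n] Epos(1)[of n] of_nat_0_le_iff[of n]]) blast
  qed
  then obtain \<beta> \<theta> \<alpha> where pa: "\<And>n. 0 < \<beta> n" "\<And>n. \<beta> n \<le> 1 / 2" "\<And>n. (R n + 1) * \<beta> n \<le> E n"
    "\<And>n. 0 < \<theta> n" "\<And>n. \<theta> n \<le> 1"
    "\<And>n p w. norm w \<le> \<theta> n * norm p \<Longrightarrow> sig \<mu> (p + w) \<le> exp (\<beta> n / 2) * sig \<mu> p"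
    "\<And>n p w. norm w \<le> \<theta> n * norm p \<Longrightarrow> exp (- (\<beta> n / 2)) * sig \<mu> p \<le> sig \<mu> (p + w)"
    "\<And>n. 0 < \<alpha> n" "\<And>n. \<alpha> n \<le> 1" "\<And>n. \<alpha> n \<le> \<theta> n * E n"
    "\<And>n p w. norm p \<le> real n \<Longrightarrow> norm w \<le> real n * ((R n + 1) * \<beta> n + \<alpha> n) \<Longrightarrow>
        R n * \<bar>sig \<mu> (p + w) - sig \<mu> p\<bar> \<le> E n"
    by metis
  define \<Phi> where "\<Phi> \<epsilon> n t s x y = Phi \<epsilon> \<eta> (\<alpha> n) (\<beta> n) (g n) t s x y" for \<epsilon> n t s x y
  have gc: "continuous_on UNIV (g n)" for n
  proof -
    have "\<bar>g n x - g n y\<bar> \<le> E n * norm (x - y)" for x y using g(4)[of n y "x - y"] by simp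
    then have "(E n)-lipschitz_on UNIV (g n)"
      using Epos(1)[of n] by (intro lipschitz_onI) (auto simp: dist_norm)
    then show ?thesis by (rule lipschitz_on_continuous_on)
  qed
  have \<alpha>0: "\<alpha> \<longlonglongrightarrow> 0"
  proof (rule tendsto_sandwich[OF _ _ tendsto_const E0])
    have "\<alpha> n \<le> E n" for n
    proof -
      have "\<theta> n * E n \<le> 1 * E n" using pa(5)[of n] Epos(1)[of n] by (intro mult_right_mono) auto
      then show ?thesis using pa(10)[of n] by linarith
    qed
    then show "\<forall>\<^sub>F n in sequentially. \<alpha> n \<le> E n" by simp
  qed (auto intro!: always_eventually less_imp_le pa(8))
  have "(\<lambda>n. \<alpha> n * ln (1 + (norm x0)\<^sup>2)) \<longlonglongrightarrow> 0" using tendsto_mult_left_zero[OF \<alpha>0] .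
  moreover have "th / 4 > 0" using th(1) by simp
  ultimately have start_ev: "\<forall>\<^sub>F n in sequentially. \<alpha> n * ln (1 + (norm x0)\<^sup>2) < th / 4"
    by (rule order_tendstoD(2))
  have start: "\<Phi> \<epsilon> n t0 t0 x0 x0 > th / 4" if "\<alpha> n * ln (1 + (norm x0)\<^sup>2) < th / 4" for \<epsilon> n
    using that th \<eta> t0 by (simp add: \<Phi>_def Phi_def phase_def g(7))
  define Mx where "Mx \<epsilon> n t s x y \<longleftrightarrow> t > 0 \<and> s > 0 \<and> \<Phi> \<epsilon> n t s x y > 0 \<and>
     (\<forall>t' s' x' y'. t' > 0 \<longrightarrow> s' > 0 \<longrightarrow> \<Phi> \<epsilon> n t' s' x' y' \<le> \<Phi> \<epsilon> n t s x y)" for \<epsilon> n t s x y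
  have ex_max: "\<exists>t s x y. Mx \<epsilon> n t s x y" if \<epsilon>: "0 < \<epsilon>" "\<epsilon> \<le> \<epsilon>0" and n: "\<alpha> n * ln (1 + (norm x0)\<^sup>2) < th / 4" for \<epsilon> n
  proof -
    have gt: "\<Phi> \<epsilon> n t0 t0 x0 x0 > L\<^sup>2 * \<epsilon> / 2" using start[OF n, of \<epsilon>] L\<epsilon>[OF \<epsilon>(2)] by linarith
    obtain t s x y where m: "t > 0" "s > 0" "\<Phi> \<epsilon> n t0 t0 x0 x0 \<le> \<Phi> \<epsilon> n t s x y"
      "\<And>t' s' x' y'. t' > 0 \<Longrightarrow> s' > 0 \<Longrightarrow> \<Phi> \<epsilon> n t' s' x' y' \<le> \<Phi> \<epsilon> n t s x y"
      using Phi_attains_max[OF \<epsilon>(1) \<eta>(1) pa(8) pa(1) gc g(3) t0 t0 gt[unfolded \<Phi>_def]] unfolding \<Phi>_def by blast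
    have "\<Phi> \<epsilon> n t s x y > 0" using m(3) start[OF n, of \<epsilon>] th(1) by linarith
    then show ?thesis using m unfolding Mx_def by blast
  qed
  \<comment> \<open>Otherwise infinitely many n admit a maximum with |x - y|^2 <=
    \<kappa>\<epsilon>. The differences x - y are then bounded, and a convergent subsequence
    satisfies all assumptions of \<open>max_sequence\<close>, which is contradictory.\<close>
  have far_apart: "\<forall>\<^sub>F n in sequentially. \<forall>t s x y. Mx \<epsilon> n t s x y \<longrightarrow> \<kappa> * \<epsilon> < (norm (x - y))\<^sup>2" if \<epsilon>: "0 < \<epsilon>" for \<epsilon>
  proof (rule ccontr)
    assume "\<not> ?thesis"
    then obtain r :: "nat \<Rightarrow> nat" where r: "strict_mono r"
      "\<And>n. \<not> (\<forall>t s x y. Mx \<epsilon> (r n) t s x y \<longrightarrow> \<kappa> * \<epsilon> < (norm (x - y))\<^sup>2)"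
      using not_eventually_sequentiallyD by blast
    have "\<forall>n. \<exists>t s x y. Mx \<epsilon> (r n) t s x y \<and> (norm (x - y))\<^sup>2 \<le> \<kappa> * \<epsilon>"
      using r(2) by (auto simp: not_less)
    then obtain t s x y where X: "\<And>n. Mx \<epsilon> (r n) (t n) (s n) (x n) (y n)"
      "\<And>n. (norm (x n - y n))\<^sup>2 \<le> \<kappa> * \<epsilon>" by metis
    have "x n - y n \<in> cball 0 (sqrt (\<kappa> * \<epsilon>))" for n
      using X(2)[of n] by (simp add: real_le_rsqrt)
    moreover have "compact (cball (0::'a) (sqrt (\<kappa> * \<epsilon>)))" by (rule compact_cball)
    ultimately have "\<exists>l\<in>cball 0 (sqrt (\<kappa> * \<epsilon>)). \<exists>q. strict_mono (q :: nat \<Rightarrow> nat) \<and> ((\<lambda>n. x n - y n) \<circ> q) \<longlonglongrightarrow> l"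
      unfolding compact_def by simp
    then obtain d q where q: "strict_mono (q :: nat \<Rightarrow> nat)" "((\<lambda>n. x n - y n) \<circ> q) \<longlonglongrightarrow> d"
      by blast
    define k where "k = r \<circ> q"
    have k: "strict_mono k" unfolding k_def by (rule strict_mono_o[OF r(1) q(1)])
    have Xk: "Mx \<epsilon> (k n) (t (q n)) (s (q n)) (x (q n)) (y (q n))" for n using X(1)[of "q n"] by (simp add: k_def)
    interpret ms: max_sequence \<nu> \<mu> c u0 u v M L Lc \<epsilon> \<eta> Cg Ms \<kappa> "\<lambda>n. g (k n)" "\<lambda>n. D (k n)"
      "\<lambda>n. \<alpha> (k n)" "\<lambda>n. \<beta> (k n)" "\<lambda>n. E (k n)" "\<lambda>n. R (k n)" "\<lambda>n. \<theta> (k n)" "\<lambda>n. E (k n)" "\<lambda>n. real (k n)"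
      "\<lambda>n. t (q n)" "\<lambda>n. s (q n)" "\<lambda>n. x (q n)" "\<lambda>n. y (q n)" d
    proof (intro max_sequence.intro comparison_axioms max_sequence_axioms.intro)
      show "\<epsilon> > 0" "\<eta> > 0" "Cg \<ge> 0" "\<kappa> \<ge> 0" "Ms > 0" "2 * Ms * Lc * \<kappa> \<le> \<eta> / 2"
        using \<epsilon> \<eta> Cg(1) \<kappa> Ms(1) \<kappa>2 by auto
      show "sig \<mu> p \<le> Ms * norm p" for p by (rule Ms(2))
      show "C11 Cg (g (k n)) (D (k n))" for n by (rule g(2))
      show "\<bar>g (k n) x\<bar> \<le> 1" for n x by (rule g(3))
      show "\<bar>g (k n) (x + z) - g (k n) x\<bar> \<le> E (k n) * norm z" for n x z by (rule g(4))
      show "0 \<le> E (k n)" "E (k n) \<le> 1" for n using Epos[of "k n"] by auto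
      show "(\<lambda>n. E (k n)) \<longlonglongrightarrow> 0" "(\<lambda>n. E (k n)) \<longlonglongrightarrow> 0"
        using LIMSEQ_subseq_LIMSEQ[OF E0 k] by (auto simp: o_def)
      show "0 \<le> R (k n)" for n by (rule g(1))
      show "g (k n) x = 1 \<and> D (k n) x = 0" if "R (k n) \<le> c x" for n x using that by (rule g(5))
      show "g (k n) x = - 1 \<and> D (k n) x = 0" if "c x \<le> - R (k n)" for n x using that by (rule g(6))
      show "filterlim (\<lambda>n. real (k n)) at_top sequentially"
        by (rule filterlim_compose[OF filterlim_real_sequentially filterlim_subseq[OF k]])
      show "0 < \<beta> (k n)" "\<beta> (k n) \<le> 1 / 2" "(R (k n) + 1) * \<beta> (k n) \<le> E (k n)" "0 < \<alpha> (k n)" "\<alpha> (k n) \<le> 1"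
        "\<alpha> (k n) \<le> \<theta> (k n) * E (k n)" "0 < \<theta> (k n)" "\<theta> (k n) \<le> 1" for n
        by (rule pa)+
      show "sig \<mu> (p + w) \<le> exp (\<beta> (k n) / 2) * sig \<mu> p" if "norm w \<le> \<theta> (k n) * norm p" for n p w
        using that by (rule pa(6))
      show "exp (- (\<beta> (k n) / 2)) * sig \<mu> p \<le> sig \<mu> (p + w)" if "norm w \<le> \<theta> (k n) * norm p" for n p w
        using that by (rule pa(7))
      show "R (k n) * \<bar>sig \<mu> (p + w) - sig \<mu> p\<bar> \<le> E (k n)"
        if "norm p \<le> real (k n)" "norm w \<le> real (k n) * ((R (k n) + 1) * \<beta> (k n) + \<alpha> (k n))" for n p w
        using that by (rule pa(11))
      show "t (q n) > 0" "s (q n) > 0" for n using Xk[of n] by (auto simp: Mx_def)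
      show "Phi \<epsilon> \<eta> (\<alpha> (k n)) (\<beta> (k n)) (g (k n)) (t (q n)) (s (q n)) (x (q n)) (y (q n)) > 0" for n
        using Xk[of n] by (auto simp: Mx_def \<Phi>_def)
      show "Phi \<epsilon> \<eta> (\<alpha> (k n)) (\<beta> (k n)) (g (k n)) t' s' x' y'
        \<le> Phi \<epsilon> \<eta> (\<alpha> (k n)) (\<beta> (k n)) (g (k n)) (t (q n)) (s (q n)) (x (q n)) (y (q n))"
        if "t' > 0" "s' > 0" for n t' s' x' y'
        using Xk[of n] that by (auto simp: Mx_def \<Phi>_def)
      show "(norm (x (q n) - y (q n)))\<^sup>2 \<le> \<kappa> * \<epsilon>" for n by (rule X(2))
      show "(\<lambda>n. x (q n) - y (q n)) \<longlonglongrightarrow> d" using q(2) by (simp add: o_def)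
    qed
    show False by (rule ms.contradiction)
  qed
  \<comment> \<open>Stated for all \<epsilon> at once because the step for \<epsilon> uses the
    hypothesis at \<epsilon>/2. A maximum point for \<epsilon>/2 has |x - y|^2 >
    \<kappa>\<epsilon>/2, and evaluating it with \<epsilon> instead relieves the penalty by |x -
    y|^2/(2\<epsilon>), hence by at least \<kappa>/4.\<close>
  have grow: "\<forall>\<epsilon>. 0 < \<epsilon> \<and> \<epsilon> \<le> \<epsilon>0 \<longrightarrow> (\<forall>\<^sub>F n in sequentially. \<exists>t s x y. t > 0 \<and> s > 0 \<and> real N * (\<kappa> / 4) \<le> \<Phi> \<epsilon> n t s x y)" for N
  proof (induction N)
    case 0
    show ?case
    proof (intro allI impI)
      fix \<epsilon> assume "0 < \<epsilon> \<and> \<epsilon> \<le> \<epsilon>0"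
      show "\<forall>\<^sub>F n in sequentially. \<exists>t s x y. t > 0 \<and> s > 0 \<and> real 0 * (\<kappa> / 4) \<le> \<Phi> \<epsilon> n t s x y"
        using start_ev
      proof eventually_elim
        case (elim n)
        have "0 \<le> \<Phi> \<epsilon> n t0 t0 x0 x0" using start[OF elim, of \<epsilon>] th(1) by linarith
        then show ?case using t0 by auto
      qed
    qed
  next
    case (Suc N)
    show ?case
    proof (intro allI impI)
      fix \<epsilon> assume \<epsilon>: "0 < \<epsilon> \<and> \<epsilon> \<le> \<epsilon>0"
      then have \<epsilon>2: "0 < \<epsilon> / 2" "\<epsilon> / 2 \<le> \<epsilon>0" by auto
      have "\<forall>\<^sub>F n in sequentially. \<exists>t s x y. t > 0 \<and> s > 0 \<and> real N * (\<kappa> / 4) \<le> \<Phi> (\<epsilon> / 2) n t s x y"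
        using Suc.IH \<epsilon>2 by blast
      then show "\<forall>\<^sub>F n in sequentially. \<exists>t s x y. t > 0 \<and> s > 0 \<and> real (Suc N) * (\<kappa> / 4) \<le> \<Phi> \<epsilon> n t s x y"
        using start_ev far_apart[OF \<epsilon>2(1)]
      proof eventually_elim
        case (elim n)
        obtain t s x y where m: "Mx (\<epsilon> / 2) n t s x y" using ex_max[OF \<epsilon>2 elim(2)] by blast
        then have ge: "real N * (\<kappa> / 4) \<le> \<Phi> (\<epsilon> / 2) n t s x y"
          using elim(1) unfolding Mx_def by (meson order_trans)
        have "\<kappa> * (\<epsilon> / 2) < (norm (x - y))\<^sup>2" using elim(3) m by blast
        then have "\<kappa> / 4 \<le> (norm (x - y))\<^sup>2 / (2 * \<epsilon>)" using \<epsilon> by (simp add: pos_le_divide_eq)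
        moreover have "\<Phi> \<epsilon> n t s x y = \<Phi> (\<epsilon> / 2) n t s x y + (norm (x - y))\<^sup>2 / (2 * \<epsilon>)"
          using \<epsilon> by (simp add: \<Phi>_def Phi_def field_simps)
        ultimately have "real (Suc N) * (\<kappa> / 4) \<le> \<Phi> \<epsilon> n t s x y" using ge by (simp add: distrib_right)
        then show ?case using m unfolding Mx_def by blast
      qed
    qed
  qed
  obtain N where "8 * M < real N * \<kappa>" using reals_Archimedean3[OF \<kappa>] by blast
  then have N: "2 * M < real N * (\<kappa> / 4)" by simp
  have "\<forall>\<^sub>F n in sequentially. \<exists>t s x y. t > 0 \<and> s > 0 \<and> real N * (\<kappa> / 4) \<le> \<Phi> \<epsilon>0 n t s x y"
    using grow[of N] \<epsilon>0 by blast
  from eventually_happens'[OF sequentially_bot this]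
  obtain n t s x y where ts: "t > 0" "s > 0" and ge: "real N * (\<kappa> / 4) \<le> \<Phi> \<epsilon>0 n t s x y"
    by blast
  have "u (t, x) - v (s, y) \<le> 2 * M" using u_bound[of t x] v_bound[of s y] ts by auto
  moreover have "0 \<le> (norm (x - y))\<^sup>2 / (2 * \<epsilon>0)" "0 \<le> 8 * M * (phase (\<beta> n) (g n) t s x)\<^sup>2" "0 \<le> \<eta> * t"
    "0 \<le> \<alpha> n * ln (1 + (norm x)\<^sup>2)" using \<epsilon>0 M \<eta> ts pa(8)[of n] by auto
  ultimately show False using ge N unfolding \<Phi>_def Phi_def by linarith
qed

end

theorem theorem2:
  fixes \<mu> c\<^sub>1 u\<^sub>0 :: "'a::euclidean_space \<Rightarrow> real"
    and \<nu> :: "'a measure"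
    and u v :: "real \<times> 'a \<Rightarrow> real"
  assumes A1: "continuous_on (sphere 0 1) \<mu>" "\<forall>e\<in>sphere 0 1. 0 < \<mu> e"
    and A2: "\<exists>L. L-lipschitz_on UNIV c\<^sub>1"
    and A3: "singular_measure \<nu>"
    and A3': "singular_density \<nu>"
    and u0: "bounded (range u\<^sub>0)" "\<exists>L. L-lipschitz_on UNIV u\<^sub>0"
    and u: "viscosity_subsolution \<mu> c\<^sub>1 \<nu> u" "bounded (u ` ({0..} \<times> UNIV))"
    and v: "viscosity_supersolution \<mu> c\<^sub>1 \<nu> v" "bounded (v ` ({0..} \<times> UNIV))"
    and init: "\<forall>x. u (0, x) \<le> u\<^sub>0 x \<and> u\<^sub>0 x \<le> v (0, x)"
  shows "\<forall>t>0. \<forall>x. u (t, x) \<le> v (t, x)"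
proof -
  obtain Lc where Lc: "Lc-lipschitz_on UNIV c\<^sub>1" using A2 by blast
  obtain L where L: "L-lipschitz_on UNIV u\<^sub>0" using u0(2) by blast
  obtain Bu where Bu: "\<And>\<xi>. \<xi> \<in> {0..} \<times> UNIV \<Longrightarrow> \<bar>u \<xi>\<bar> \<le> Bu"
    using u(2) unfolding bounded_iff by auto
  obtain Bv where Bv: "\<And>\<xi>. \<xi> \<in> {0..} \<times> UNIV \<Longrightarrow> \<bar>v \<xi>\<bar> \<le> Bv"
    using v(2) unfolding bounded_iff by auto
  \<comment> \<open>The 1 keeps the coefficient 8M of the phase penalty positive even if both
    solutions vanish.\<close>
  define M where "M = max 1 (max Bu Bv)"
  interpret comparison \<nu> \<mu> c\<^sub>1 u\<^sub>0 u v M L Lc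
  proof
    show "\<bar>c\<^sub>1 x - c\<^sub>1 y\<bar> \<le> Lc * norm (x - y)" for x y
      using lipschitz_onD[OF Lc, of x y] by (simp add: dist_norm)
    show "Lc \<ge> 0" using Lc by (rule lipschitz_on_nonneg)
    show "\<bar>u\<^sub>0 x - u\<^sub>0 y\<bar> \<le> L * norm (x - y)" for x y
      using lipschitz_onD[OF L, of x y] by (simp add: dist_norm)
    show "M \<ge> 1" by (simp add: M_def)
    show "\<bar>u (t, x)\<bar> \<le> M" if "t \<ge> 0" for t x
      using Bu[of "(t, x)"] that by (simp add: M_def le_max_iff_disj)
    show "\<bar>v (t, x)\<bar> \<le> M" if "t \<ge> 0" for t x
      using Bv[of "(t, x)"] that by (simp add: M_def le_max_iff_disj)
  qed (use A1 A3 A3' u(1) v(1) init in auto)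
  show ?thesis using comparison_principle by blast
qed

end
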